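(* Let $d\ge1$ and let $F\in(\mathbb D^{2,p})^d$ with $p>d$ be such that $\mathbb P(\det\sigma_F>0)>0$. **A.** Conditionally on $\{\det\sigma_F>0\}$, the law of $F$ is absolutely continuous with respect to the Lebesgue measure, and the density is lower semi-continuous (i.e. it admits a lower semi-continuous version). **B.** In particular the law of $F$ is locally lower bounded by the Lebesgue measure $\lambda$ in the following sense: there exist a non-empty open set $D\subset\mathbb R^d$ and some $\delta>0$ such that for every Borel set $A\subset\mathbb R^d$, $$\mathbb P(F\in A)\ge\delta\,\lambda(A\cap D).$$
   Context: $W=(W^1,\dots,W^N)$ is a Brownian motion on $[0,1]$ on a probability space $(\Omega,\mathcal F,\mathbb P)$; $\mathbb D^{m,p}$ is the usual Malliavin–Sobolev space of functionals of $W$ that are $m$ times Malliavin differentiable in $L^p$. The Malliavin covariance matrix of $F=(F^1,\dots,F^d)$ is $\sigma_F^{i,j}=\sum_{k=1}^N\int_0^1D^k_sF^i\,D^k_sF^j\,ds$. *)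

theory Defs
  imports "HOL-Probability.Probability"
begin

section \<open>Brownian motion on the unit interval\<close>

text \<open>
  The component \<open>W\<^sup>k\<close> of the \<open>N\<close>-dimensional process is \<open>W k\<close>, with \<open>k\<close> ranging over a finite
  index type of cardinality \<open>N\<close>. Values of \<open>W k t\<close> for \<open>t\<close> outside \<open>[0,1]\<close> are irrelevant.
  The independence clause comprises both the independence of the components and the independence
  of the increments of each component.
\<close>

definition brownian_motion :: "'a measure \<Rightarrow> ('n::finite \<Rightarrow> real \<Rightarrow> 'a \<Rightarrow> real) \<Rightarrow> bool" where
  "brownian_motion M W \<longleftrightarrow>
     prob_space M \<and>
     (\<forall>k. \<forall>t\<in>{0..1}. W k t \<in> borel_measurable M) \<and>
     (\<forall>k. AE \<omega> in M. W k 0 \<omega> = 0) \<and>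
     (\<forall>k. AE \<omega> in M. continuous_on {0..1} (\<lambda>t. W k t \<omega>)) \<and>
     (\<forall>k s t. 0 \<le> s \<longrightarrow> s < t \<longrightarrow> t \<le> 1 \<longrightarrow>
        distributed M lborel (\<lambda>\<omega>. W k t \<omega> - W k s \<omega>)
          (\<lambda>x. ennreal (normal_density 0 (sqrt (t - s)) x))) \<and>
     (\<forall>(m::nat) (t::nat \<Rightarrow> real). strict_mono_on {..m} t \<longrightarrow> t ` {..m} \<subseteq> {0..1} \<longrightarrow>
        prob_space.indep_vars M (\<lambda>_. borel)
          (\<lambda>(k, i) \<omega>. W k (t (Suc i)) \<omega> - W k (t i) \<omega>) (UNIV \<times> {..<m}))"

section \<open>The Hilbert space \<open>L\<^sup>2([0,1]; \<real>\<^sup>N)\<close> and the Wiener integral\<close>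

text \<open>
  The Hilbert space \<open>H = L\<^sup>2([0,1]; \<real>\<^sup>N)\<close> is \<open>L\<^sup>2\<close> of the following measure: an element \<open>h\<close>
  has \<open>k\<close>-th component \<open>\<lambda>s. h (k, s)\<close>. Correspondingly \<open>H \<otimes> H\<close> is \<open>L\<^sup>2\<close> of the product of this
  measure with itself.
\<close>

definition noise :: "('n::finite \<times> real) measure" where
  "noise = count_space UNIV \<Otimes>\<^sub>M restrict_space lborel {0..1}"

definition L2_norm :: "'b measure \<Rightarrow> ('b \<Rightarrow> real) \<Rightarrow> real" where
  "L2_norm N u = sqrt (\<integral>z. (u z)\<^sup>2 \<partial>N)"

text \<open>A list entry \<open>(c, k, a, b)\<close> stands for the function \<open>c 1\<^bsub>(a,b]\<^esub>\<close> in the \<open>k\<close>-th component.\<close>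

definition step_fun :: "(real \<times> 'n::finite \<times> real \<times> real) list \<Rightarrow> 'n \<times> real \<Rightarrow> real" where
  "step_fun xs = (\<lambda>(j, s). \<Sum>(c, k, a, b)\<leftarrow>xs. c * of_bool (k = j \<and> a < s \<and> s \<le> b))"

definition step_integral ::
  "('n::finite \<Rightarrow> real \<Rightarrow> 'a \<Rightarrow> real) \<Rightarrow> (real \<times> 'n \<times> real \<times> real) list \<Rightarrow> 'a \<Rightarrow> real" where
  "step_integral W xs = (\<lambda>\<omega>. \<Sum>(c, k, a, b)\<leftarrow>xs. c * (W k b \<omega> - W k a \<omega>))"

text \<open>
  \<open>X\<close> is a version of \<open>W(h) = \<Sum>\<^sub>k \<integral>\<^sub>0\<^sup>1 h\<^sup>k(s) dW\<^sup>k\<^sub>s\<close>, the continuous extension of the integral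
  from step functions to \<open>H\<close>.
\<close>

definition is_wiener_integral ::
  "'a measure \<Rightarrow> ('n::finite \<Rightarrow> real \<Rightarrow> 'a \<Rightarrow> real) \<Rightarrow> ('n \<times> real \<Rightarrow> real) \<Rightarrow> ('a \<Rightarrow> real) \<Rightarrow> bool" where
  "is_wiener_integral M W h X \<longleftrightarrow>
     h \<in> borel_measurable noise \<and> integrable noise (\<lambda>z. (h z)\<^sup>2) \<and> X \<in> borel_measurable M \<and>
     (\<exists>xs :: nat \<Rightarrow> (real \<times> 'n \<times> real \<times> real) list.
        (\<forall>m. \<forall>(c, k, a, b)\<in>set (xs m). 0 \<le> a \<and> a \<le> b \<and> b \<le> 1) \<and>
        (\<lambda>m. L2_norm noise (\<lambda>z. step_fun (xs m) z - h z)) \<longlonglongrightarrow> 0 \<and>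
        (\<lambda>m. \<integral>\<^sup>+\<omega>. ennreal ((step_integral W (xs m) \<omega> - X \<omega>)\<^sup>2) \<partial>M) \<longlonglongrightarrow> 0)"

section \<open>Smooth functionals and Malliavin--Sobolev spaces\<close>

definition part_deriv :: "nat \<Rightarrow> ((nat \<Rightarrow> real) \<Rightarrow> real) \<Rightarrow> (nat \<Rightarrow> real) \<Rightarrow> real" where
  "part_deriv i f x = deriv (\<lambda>t. f (x(i := t))) (x i)"

text \<open>
  The class \<open>C\<^sub>p\<^sup>\<infinity>(\<real>\<^sup>n)\<close> of smooth functions which have polynomial growth together with all their
  partial derivatives. In order to let \<open>n\<close> vary, a function on \<open>\<real>\<^sup>n\<close> is encoded as a function on
  sequences that depends on the coordinates \<open>i < n\<close> only; for such functions continuity in the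
  product topology is continuity on \<open>\<real>\<^sup>n\<close>.
\<close>

definition smooth_poly_growth :: "nat \<Rightarrow> ((nat \<Rightarrow> real) \<Rightarrow> real) \<Rightarrow> bool" where
  "smooth_poly_growth n f \<longleftrightarrow>
     (\<forall>x y. (\<forall>i<n. x i = y i) \<longrightarrow> f x = f y) \<and>
     (\<forall>is\<in>lists {..<n}. let g = foldr part_deriv is f in
        continuous_on UNIV g \<and>
        (\<forall>i<n. \<forall>x. (\<lambda>t. g (x(i := t))) differentiable (at (x i))) \<and>
        (\<exists>(C::real) (q::nat). \<forall>x. \<bar>g x\<bar> \<le> C * (1 + (\<Sum>i<n. \<bar>x i\<bar>)) ^ q))"

text \<open>
  \<open>G\<close> is a smooth functional \<open>f(W(h\<^sub>0), \<dots>, W(h\<^bsub>n-1\<^esub>))\<close>, and \<open>DG\<close> and \<open>D2G\<close> are its first and second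
  Malliavin derivatives, \<open>DG \<omega> (k, s)\<close> being \<open>D\<^sup>k\<^sub>s G(\<omega>)\<close>.
\<close>

definition smooth_functional ::
  "'a measure \<Rightarrow> ('n::finite \<Rightarrow> real \<Rightarrow> 'a \<Rightarrow> real) \<Rightarrow> ('a \<Rightarrow> real) \<Rightarrow>
   ('a \<Rightarrow> 'n \<times> real \<Rightarrow> real) \<Rightarrow> ('a \<Rightarrow> ('n \<times> real) \<times> ('n \<times> real) \<Rightarrow> real) \<Rightarrow> bool" where
  "smooth_functional M W G DG D2G \<longleftrightarrow>
     (\<exists>n f h X. smooth_poly_growth n f \<and> (\<forall>i<n. is_wiener_integral M W (h i) (X i)) \<and>
        G = (\<lambda>\<omega>. f (\<lambda>i. X i \<omega>)) \<and>
        DG = (\<lambda>\<omega> z. \<Sum>i<n. part_deriv i f (\<lambda>i. X i \<omega>) * h i z) \<and>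
        D2G = (\<lambda>\<omega> (z, z'). \<Sum>i<n. \<Sum>j<n.
                 part_deriv i (part_deriv j f) (\<lambda>i. X i \<omega>) * h i z * h j z'))"

text \<open>
  Convergence \<open>U\<^sub>m \<rightarrow> U\<close> in \<open>L\<^sup>p(\<Omega>; L\<^sup>2(N))\<close>. The square integrability of \<open>U \<omega>\<close> is demanded
  explicitly because the Bochner integral in \<^const>\<open>L2_norm\<close> would otherwise be \<open>0\<close> by convention.
\<close>

definition Lp_L2_tendsto ::
  "'a measure \<Rightarrow> 'b measure \<Rightarrow> real \<Rightarrow> (nat \<Rightarrow> 'a \<Rightarrow> 'b \<Rightarrow> real) \<Rightarrow> ('a \<Rightarrow> 'b \<Rightarrow> real) \<Rightarrow> bool" where
  "Lp_L2_tendsto M N p Um U \<longleftrightarrow>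
     case_prod U \<in> borel_measurable (M \<Otimes>\<^sub>M N) \<and>
     (AE \<omega> in M. integrable N (\<lambda>z. (U \<omega> z)\<^sup>2)) \<and>
     (\<lambda>m. \<integral>\<^sup>+\<omega>. ennreal (L2_norm N (\<lambda>z. Um m \<omega> z - U \<omega> z) powr p) \<partial>M) \<longlonglongrightarrow> 0"

text \<open>
  \<open>F \<in> \<D>\<^bsup>2,p\<^esup>\<close> with Malliavin derivatives \<open>DF\<close> and \<open>D2F\<close>: the space is the closure of the smooth
  functionals under the norm \<open>(E|F|\<^sup>p + E\<parallel>DF\<parallel>\<^sup>p\<^sub>H + E\<parallel>D2F\<parallel>\<^sup>p\<^bsub>H\<otimes>H\<^esub>)\<^bsup>1/p\<^esup>\<close>, and the derivatives of \<open>F\<close>,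
  which are determined up to null sets, are the corresponding limits. Hence \<open>F \<in> \<D>\<^bsup>2,p\<^esup>\<close>
  means that the relation holds for some \<open>DF\<close> and \<open>D2F\<close>.
\<close>

definition has_malliavin_derivs_2 ::
  "'a measure \<Rightarrow> ('n::finite \<Rightarrow> real \<Rightarrow> 'a \<Rightarrow> real) \<Rightarrow> real \<Rightarrow> ('a \<Rightarrow> real) \<Rightarrow>
   ('a \<Rightarrow> 'n \<times> real \<Rightarrow> real) \<Rightarrow> ('a \<Rightarrow> ('n \<times> real) \<times> ('n \<times> real) \<Rightarrow> real) \<Rightarrow> bool" where
  "has_malliavin_derivs_2 M W p F DF D2F \<longleftrightarrow>
     F \<in> borel_measurable M \<and>
     (\<exists>G DG D2G.
        (\<forall>m::nat. smooth_functional M W (G m) (DG m) (D2G m)) \<and>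
        (\<lambda>m. \<integral>\<^sup>+\<omega>. ennreal (\<bar>G m \<omega> - F \<omega>\<bar> powr p) \<partial>M) \<longlonglongrightarrow> 0 \<and>
        Lp_L2_tendsto M noise p DG DF \<and>
        Lp_L2_tendsto M (noise \<Otimes>\<^sub>M noise) p D2G D2F)"

definition malliavin_covariance ::
  "('d::finite \<Rightarrow> 'a \<Rightarrow> 'n::finite \<times> real \<Rightarrow> real) \<Rightarrow> 'a \<Rightarrow> real ^ 'd ^ 'd" where
  "malliavin_covariance DF \<omega> =
     (\<chi> i j. \<Sum>k\<in>UNIV. LBINT s:{0..1}. DF i \<omega> (k, s) * DF j \<omega> (k, s))"

section \<open>Lower semi-continuity\<close>

text \<open>
  Densities take values in \<open>[0,\<infinity>]\<close>: a lower semi-continuous version may be forced to be infinite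
  on a (dense) null set.
\<close>

definition lower_semicontinuous :: "('b::topological_space \<Rightarrow> ennreal) \<Rightarrow> bool" where
  "lower_semicontinuous f \<longleftrightarrow> (\<forall>x. f x \<le> Liminf (at x) f)"

end

theory Submission
  imports Defs
begin

text \<open>
  No integration by parts is used. Where \<open>det \<sigma>\<^sub>F > 0\<close> the derivative \<open>DF\<close>, tested against suitable
  \<open>d\<close> of the countably many step directions \<open>1\<^bsub>(0,b]\<^esub> e\<^sub>k\<close> with rational \<open>b\<close>, is an invertible matrix.
  By Girsanov's theorem the law of \<open>F\<close> is an average of the push-forwards of Lebesgue measure with
  continuous weights on the \<open>d\<close>-dimensional fibres spanned by such directions. Since \<open>p > d\<close>, Morrey's
  inequality, applied to \<open>DF\<close> and \<open>D\<^sup>2F\<close> along an approximation by smooth functionals, makes \<open>F\<close> continuously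
  differentiable on almost every fibre. Hence, after multiplication by a weight that is continuous
  on the fibres and supported where the matrix is invertible, each fibre contributes a continuous
  density. Averaging over the fibres (Fatou's lemma) and summing countably many such weights preserve
  lower semi-continuity.
\<close>

section \<open>Densities of push-forwards under local diffeomorphisms\<close>

text \<open>The sample space is an arbitrary probability space without shifts or topology, and
  \<open>F\<close> is given only as a limit of smooth functionals. Functionals are therefore first
  replaced by measurable functions of the path, which can be evaluated at translated paths; the
  original variables are recovered almost surely at the unshifted path.

  Both Malliavin derivatives are used: Morrey's inequality for \<open>F\<close> with
  \<open>DF\<close> gives uniform convergence of the approximations on a fibre, and for
  \<open>DF\<close> with \<open>D2F\<close> it gives uniform convergence of their derivatives, which
  makes the limit differentiable with continuous derivative. The inequality is applied on a
  \<open>d\<close>-dimensional ball only, so the threshold is \<open>d\<close> although the noise is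
  infinite-dimensional.

  Which \<open>d\<close> directions are non-degenerate depends on the sample point, so countably
  many choices have to be combined. No uniform bound on the fibre densities is available, so
  averaging them cannot use dominated convergence; Fatou's inequality is what remains, and with it
  lower semi-continuity instead of continuity.\<close>

lemma continuous_on_det:
  fixes A :: "'a::topological_space \<Rightarrow> real^'n^'n"
  assumes "\<And>i j. continuous_on S (\<lambda>x. A x $ i $ j)"
  shows "continuous_on S (\<lambda>x. det (A x))"
  unfolding det_def by (intro continuous_intros assms)

lemma ennreal_times_indicator: "ennreal a * indicator A x = ennreal (a * indicator A x)"
  by (simp split: split_indicator)

text \<open>\<open>F\<close> is continuous on \<open>U\<close> only and arbitrary elsewhere; since
  the weight vanishes off \<open>U\<close>, the product is the extension by zero of a function that
  is measurable on \<open>U\<close>.\<close>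

lemma borel_measurable_weighted_preimage:
  fixes V :: "'a::topological_space \<Rightarrow> real" and F :: "'a \<Rightarrow> 'b::topological_space"
  assumes U: "open U" and F: "continuous_on U F" and V: "continuous_on UNIV V"
    and 0: "\<And>y. y \<notin> U \<Longrightarrow> V y = 0" and A: "A \<in> sets borel"
  shows "(\<lambda>y. V y * indicator A (F y)) \<in> borel_measurable borel"
proof -
  have "(\<lambda>y. if y \<in> U then V y * indicator A (F y) else 0) \<in> borel_measurable borel"
  proof (rule measurable_restrict_space_iff[THEN iffD1])
    show "U \<inter> space borel \<in> sets borel" using U by auto
    have 1: "F \<in> borel_measurable (restrict_space borel U)"
      using F borel_measurable_continuous_on_restrict by blast
    have 2: "V \<in> borel_measurable (restrict_space borel U)"
      by (rule measurable_restrict_space1[OF borel_measurable_continuous_onI[OF V]])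
    show "(\<lambda>y. V y * indicator A (F y)) \<in> borel_measurable (restrict_space borel U)"
      using 1 2 A by measurable
  qed auto
  also have "(\<lambda>y. if y \<in> U then V y * indicator A (F y) else 0) = (\<lambda>y. V y * indicator A (F y))"
    using 0 by (auto simp: fun_eq_iff)
  finally show ?thesis .
qed

text \<open>An equality of integrals replaces an equality of measures built with
  \<open>distr\<close>, because \<open>F\<close> need not be measurable where \<open>V\<close>
  vanishes. The density \<open>f\<close> is real valued: infinite values can arise only later, by
  averaging and summation.\<close>

definition pushforward_density ::
  "('a::euclidean_space \<Rightarrow> real) \<Rightarrow> ('a \<Rightarrow> 'b::euclidean_space) \<Rightarrow> ('b \<Rightarrow> real) \<Rightarrow> bool" where
  "pushforward_density V F f \<longleftrightarrow> continuous_on UNIV f \<and> (\<forall>x. 0 \<le> f x) \<and> (\<forall>A\<in>sets borel.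
     (\<integral>\<^sup>+y. ennreal (V y) * indicator A (F y) \<partial>lborel) = (\<integral>\<^sup>+x. ennreal (f x) * indicator A x \<partial>lborel))"

text \<open>Change of variables: the density is \<open>V (g x)\<close> divided by the absolute
  Jacobian at \<open>g x\<close> on \<open>T\<close>, and zero elsewhere. Compactness of the support
  \<open>C\<close> makes this extension continuous and integrable.\<close>

lemma local_pushforward_density:
  fixes F :: "real^'m::{finite,wellorder} \<Rightarrow> real^'m::_"
    and F' :: "real^'m::_ \<Rightarrow> ((real^'m::_) \<Rightarrow>\<^sub>L (real^'m::_))"
  assumes U: "open U" and T: "open T" and hom: "homeomorphism U T F g"
    and der: "\<And>x. x \<in> U \<Longrightarrow> (F has_derivative blinfun_apply (F' x)) (at x)"
    and cont: "continuous_on U F'"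
    and derg: "\<And>y. y \<in> T \<Longrightarrow> (g has_derivative g' y) (at y)"
    and g': "\<And>y. y \<in> T \<Longrightarrow> g' y = inv (blinfun_apply (F' (g y)))"
    and bij: "\<And>y. y \<in> T \<Longrightarrow> bij (blinfun_apply (F' (g y)))"
    and V: "continuous_on UNIV V" "\<And>y. 0 \<le> V y" and C: "compact C" "C \<subseteq> U" "\<And>y. y \<notin> C \<Longrightarrow> V y = 0"
  shows "\<exists>f. pushforward_density V F f"
proof -
  define D where "D x = \<bar>det (matrix (blinfun_apply (F' x)))\<bar>" for x
  have gU: "g y \<in> U" "F (g y) = y" if "y \<in> T" for y
    using that hom by (auto simp: homeomorphism_def)
  have FT: "F x \<in> T" "g (F x) = x" if "x \<in> U" for x
    using that hom by (auto simp: homeomorphism_def)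
  have contF: "continuous_on U F" and contg: "continuous_on T g"
    using hom by (auto simp: homeomorphism_def)
  have contD: "continuous_on U D"
    unfolding D_def
  proof (intro continuous_on_rabs continuous_on_det)
    fix i j
    have "continuous_on U (\<lambda>x. blinfun_apply (F' x) (axis j 1) $ i)"
      by (intro continuous_intros cont)
    then show "continuous_on U (\<lambda>x. matrix (blinfun_apply (F' x)) $ i $ j)"
      by (simp add: matrix_def)
  qed
  have Dpos: "D x > 0" if "x \<in> U" for x
  proof -
    have "bij (blinfun_apply (F' x))" using bij[of "F x"] FT[OF that] by auto
    moreover have "linear (blinfun_apply (F' x))"
      by (simp add: bounded_linear.linear blinfun.bounded_linear_right)
    ultimately have "det (matrix (blinfun_apply (F' x))) \<noteq> 0"
      by (metis bij_is_inj det_nz_iff_inj)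
    then show ?thesis by (simp add: D_def)
  qed
  define f where "f x = (if x \<in> T then V (g x) / D (g x) else 0)" for x
  have FC: "compact (F ` C)"
    by (meson C(1,2) compact_continuous_image contF continuous_on_subset)
  have FCT: "F ` C \<subseteq> T" using C FT by auto
  have f0: "f x = 0" if "x \<notin> F ` C" for x
  proof (cases "x \<in> T")
    case True
    then have "g x \<notin> C" using that gU(2) by (metis image_eqI)
    then show ?thesis by (simp add: f_def C(3))
  qed (simp add: f_def)
  have contT: "continuous_on T f"
  proof (rule continuous_on_cong[THEN iffD2, OF refl])
    show "f x = V (g x) / D (g x)" if "x \<in> T" for x using that by (simp add: f_def)
    show "continuous_on T (\<lambda>x. V (g x) / D (g x))"
    proof (intro continuous_on_divide)
      show "continuous_on T (\<lambda>x. V (g x))"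
        by (rule continuous_on_compose2[OF V(1) contg]) auto
      show "continuous_on T (\<lambda>x. D (g x))"
        by (rule continuous_on_compose2[OF contD contg]) (use gU in auto)
      show "\<forall>x\<in>T. D (g x) \<noteq> 0" using Dpos gU by (metis less_irrefl)
    qed
  qed
  \<comment> \<open>The open set \<open>T\<close> and the complement of the compact image of
    \<open>C\<close> cover the space; \<open>f\<close> is continuous on the first and zero on the
    second.\<close>
  have contf: "continuous_on UNIV f"
  proof -
    have "continuous_on (T \<union> - (F ` C)) f"
    proof (rule continuous_on_open_Un[OF T _ contT])
      show "open (- F ` C)" using FC compact_imp_closed by blast
      show "continuous_on (- F ` C) f"
        by (rule continuous_on_cong[THEN iffD2, OF refl _ continuous_on_const[of _ 0]]) (use f0 in auto)
    qed
    moreover have "T \<union> - (F ` C) = UNIV" using FCT by auto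
    ultimately show ?thesis by simp
  qed
  have fpos: "0 \<le> f x" for x
    using Dpos gU V(2) by (auto simp: f_def intro!: divide_nonneg_pos)
  have main: "(\<integral>\<^sup>+y. ennreal (V y) * indicator A (F y) \<partial>lborel) = (\<integral>\<^sup>+x. ennreal (f x) * indicator A x \<partial>lborel)"
    if A: "A \<in> sets borel" for A
  proof -
    define h where "h x = f x * indicator A x" for x
    define k where "k y = V y * indicator A (F y)" for y
    have hmeas[measurable]: "h \<in> borel_measurable borel"
      unfolding h_def using A borel_measurable_continuous_onI[OF contf] by measurable
    have kmeas[measurable]: "k \<in> borel_measurable borel"
      unfolding k_def using C by (intro borel_measurable_weighted_preimage[OF U contF V(1) _ A]) auto
    \<comment> \<open>The change of variables formula transports the value of an integral, so a
      finite value has to exist beforehand: \<open>h\<close> is bounded and vanishes off a compact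
      set.\<close>
    have hb: "\<exists>b. (h has_integral b) UNIV"
    proof -
      have "bounded (f ` (F ` C))"
        by (meson FC compact_continuous_image compact_imp_bounded contf continuous_on_subset subset_UNIV)
      then obtain B where B: "\<And>x. x \<in> F ` C \<Longrightarrow> \<bar>f x\<bar> \<le> B" by (auto simp: bounded_iff)
      have "(\<integral>\<^sup>+x. h x \<partial>lborel) \<le> (\<integral>\<^sup>+x. ennreal B * indicator (F ` C) x \<partial>lborel)"
        using B f0 fpos by (intro nn_integral_mono) (fastforce simp: h_def indicator_def intro!: ennreal_leI)
      also have "\<dots> = ennreal B * emeasure lborel (F ` C)"
        using FC by (simp add: nn_integral_cmult_indicator borel_compact)
      also have "\<dots> < \<infinity>"
        using emeasure_compact_finite[OF FC] by (simp add: ennreal_mult_less_top)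
      finally obtain b where "0 \<le> b" "(\<integral>\<^sup>+x. h x \<partial>lborel) = ennreal b"
        by (metis ennreal_cases infinity_ennreal_def less_irrefl)
      then have "(h has_integral b) UNIV"
        using fpos by (intro nn_integral_has_integral) (auto simp: h_def)
      then show ?thesis by blast
    qed
    then obtain b where b: "(h has_integral b) UNIV" by blast
    have bT: "(h has_integral b) T"
    proof -
      have "(\<lambda>x. if x \<in> T then h x else 0) = h" by (auto simp: h_def f_def)
      then show ?thesis using b has_integral_restrict_UNIV[of T h b] by simp
    qed
    have "((\<lambda>x. \<bar>det (matrix (blinfun_apply (F' x)))\<bar> * h (F x)) has_integral b) U"
    proof (rule cov_invertible_nonneg_eq[THEN iffD2, OF _ _ _ _ _ _ bT])
      show "(F has_derivative blinfun_apply (F' x)) (at x within U)" if "x \<in> U" for x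
        using der that has_derivative_at_withinI by blast
      show "(g has_derivative g' y) (at y within T)" if "y \<in> T" for y
        using derg that has_derivative_at_withinI by blast
      show "g' y \<circ> blinfun_apply (F' (g y)) = id" if "y \<in> T" for y
        using g'[OF that] bij[OF that] by (simp add: bij_is_inj)
    qed (use FT gU fpos in \<open>auto simp: h_def\<close>)
    moreover have "\<bar>det (matrix (blinfun_apply (F' x)))\<bar> * h (F x) = k x" if "x \<in> U" for x
      using Dpos[OF that] FT[OF that] by (simp add: h_def k_def f_def D_def[symmetric])
    ultimately have "(k has_integral b) U"
      using has_integral_cong by (metis (mono_tags, lifting))
    moreover have "(\<lambda>x. if x \<in> U then k x else 0) = k" using C by (auto simp: k_def fun_eq_iff)
    ultimately have kb: "(k has_integral b) UNIV"
      using has_integral_restrict_UNIV[of U k b] by simp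
    have "(\<integral>\<^sup>+x. k x \<partial>lborel) = b"
      by (rule nn_integral_has_integral_lborel[OF kmeas _ kb]) (simp add: k_def V)
    moreover have "(\<integral>\<^sup>+x. h x \<partial>lborel) = b"
      by (rule nn_integral_has_integral_lborel[OF hmeas _ b]) (simp add: h_def fpos)
    ultimately show ?thesis
      unfolding h_def k_def by (simp add: ennreal_mult' V fpos ennreal_indicator)
  qed
  show ?thesis unfolding pushforward_density_def using contf fpos main by blast
qed

text \<open>Partition of unity: by the inverse function theorem every point of \<open>K\<close> has
  a neighbourhood on which \<open>F\<close> is a diffeomorphism. Finitely many of these cover
  \<open>K\<close>, the weight \<open>V\<close> is split accordingly, and the local densities add
  up.\<close>

lemma pushforward_density_wellorder:
  fixes F :: "real^'m::{finite,wellorder} \<Rightarrow> real^'m::_"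
    and F' :: "real^'m::_ \<Rightarrow> ((real^'m::_) \<Rightarrow>\<^sub>L (real^'m::_))"
  assumes Q: "open Q"
    and der: "\<And>x. x \<in> Q \<Longrightarrow> (F has_derivative blinfun_apply (F' x)) (at x)"
    and cont: "continuous_on Q F'"
    and V: "continuous_on UNIV V" "\<And>y. 0 \<le> V y" and K: "compact K" "K \<subseteq> Q" "\<And>y. y \<notin> K \<Longrightarrow> V y = 0"
    and inj: "\<And>y. y \<in> K \<Longrightarrow> inj (blinfun_apply (F' y))"
  shows "\<exists>f. pushforward_density V F f"
proof (cases "K = {}")
  case True
  then have "V = (\<lambda>_. 0)" using K by auto
  then have "pushforward_density V F (\<lambda>_. 0)"
    by (simp add: pushforward_density_def)
  then show ?thesis by blast
next
  case False
  have contF: "continuous_on Q F"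
    using der by (meson has_derivative_continuous_on has_derivative_at_withinI)
  define chart where "chart U \<longleftrightarrow> (\<exists>T g g'. open U \<and> U \<subseteq> Q \<and> open T \<and> homeomorphism U T F g \<and>
          (\<forall>y\<in>T. (g has_derivative g' y) (at y)) \<and> (\<forall>y\<in>T. g' y = inv (blinfun_apply (F' (g y)))) \<and>
          (\<forall>y\<in>T. bij (blinfun_apply (F' (g y)))))" for U
  have "\<exists>U r. 0 < r \<and> cball x r \<subseteq> U \<and> chart U" if x: "x \<in> K" for x
  proof -
    have "linear (blinfun_apply (F' x))"
      by (simp add: bounded_linear.linear blinfun.bounded_linear_right)
    then obtain G where G: "linear G" "G \<circ> blinfun_apply (F' x) = id"
      using linear_injective_left_inverse inj[OF x] by blast
    then have "bounded_linear G" by (simp add: linear_conv_bounded_linear)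
    then have inv: "Blinfun G o\<^sub>L F' x = id_blinfun"
      using G by (intro blinfun_eqI) (simp add: bounded_linear_Blinfun_apply fun_eq_iff)
    have xQ: "x \<in> Q" using x K(2) by blast
    show ?thesis
    proof (rule inverse_function_theorem[OF Q der cont xQ inv])
      fix U T g g'
      assume *: "open U" "U \<subseteq> Q" "x \<in> U" "open T" "homeomorphism U T F g"
        and **: "\<And>y. y \<in> T \<Longrightarrow> (g has_derivative g' y) (at y)"
        "\<And>y. y \<in> T \<Longrightarrow> g' y = inv (blinfun_apply (F' (g y)))"
        "\<And>y. y \<in> T \<Longrightarrow> bij (blinfun_apply (F' (g y)))"
      have "chart U"
        unfolding chart_def by (intro exI[of _ T] exI[of _ g] exI[of _ g'] conjI ballI * **)
      moreover obtain r where "0 < r" "cball x r \<subseteq> U" using open_contains_cball *(1,3) by blast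
      ultimately show ?thesis by blast
    qed
  qed
  then obtain U r where Ur: "\<And>x. x \<in> K \<Longrightarrow> 0 < r x" "\<And>x. x \<in> K \<Longrightarrow> cball x (r x) \<subseteq> U x"
    "\<And>x. x \<in> K \<Longrightarrow> chart (U x)"
    by metis
  have "K \<subseteq> (\<Union>x\<in>K. ball x (r x))" using Ur(1) by force
  with K(1) obtain I where I: "I \<subseteq> K" "finite I" "K \<subseteq> (\<Union>x\<in>I. ball x (r x))"
    by (elim compactE_image) auto
  \<comment> \<open>Tent functions: \<open>d x\<close> is positive exactly on the open ball of
    radius \<open>r x\<close> about \<open>x\<close>, and the closed ball lies in the chart
    \<open>U x\<close>.\<close>
  define d where "d x y = max 0 (r x - dist x y)" for x y
  define S where "S y = (\<Sum>x\<in>I. d x y)" for y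
  have contd: "continuous_on UNIV (d x)" for x
    unfolding d_def by (intro continuous_intros)
  have contS: "continuous_on UNIV S"
    unfolding S_def by (intro continuous_on_sum contd)
  have Spos: "S y > 0" if y: "y \<in> K" for y
  proof -
    obtain x where x: "x \<in> I" "dist x y < r x" using I(3) y by auto
    have "0 < d x y" using x by (simp add: d_def)
    also have "d x y \<le> S y" unfolding S_def
      by (rule member_le_sum[OF x(1)]) (auto simp: d_def I)
    finally show ?thesis .
  qed
  \<comment> \<open>\<open>S\<close> may vanish away from \<open>K\<close>. Replacing it in the
    denominator by its maximum with \<open>c\<close>, the minimum of \<open>S\<close> over
    \<open>K\<close>, keeps the quotients continuous everywhere and changes nothing on
    \<open>K\<close>.\<close>
  obtain c where c: "c > 0" "\<And>y. y \<in> K \<Longrightarrow> c \<le> S y"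
  proof -
    obtain x where "x \<in> K" "\<And>y. y \<in> K \<Longrightarrow> S x \<le> S y"
      using continuous_attains_inf[OF K(1) False continuous_on_subset[OF contS]] by auto
    then show ?thesis using that Spos by blast
  qed
  define W where "W x y = V y * d x y / max c (S y)" for x y
  have Wcont: "continuous_on UNIV (W x)" for x
    unfolding W_def using c
    by (intro continuous_on_divide continuous_on_mult V contd continuous_on_max contS continuous_intros)
       (auto simp: max_def)
  have Wpos: "0 \<le> W x y" for x y
    unfolding W_def using c V by (intro divide_nonneg_pos mult_nonneg_nonneg) (auto simp: d_def)
  have W0: "W x y = 0" if "y \<notin> K \<inter> cball x (r x)" for x y
    using that K(3) by (auto simp: W_def d_def)
  have "\<exists>f. pushforward_density (W x) F f" if x: "x \<in> I" for x
  proof -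
    have xK: "x \<in> K" using x I by auto
    obtain T g g' where *: "open (U x)" "U x \<subseteq> Q" "open T" "homeomorphism (U x) T F g"
      "\<And>y. y \<in> T \<Longrightarrow> (g has_derivative g' y) (at y)" "\<And>y. y \<in> T \<Longrightarrow> g' y = inv (blinfun_apply (F' (g y)))"
      "\<And>y. y \<in> T \<Longrightarrow> bij (blinfun_apply (F' (g y)))"
      using Ur(3)[OF xK] unfolding chart_def by blast
    show ?thesis
    proof (rule local_pushforward_density[OF *(1,3,4) _ _ *(5,6,7) Wcont Wpos _ _ W0])
      show "compact (K \<inter> cball x (r x))" using K by (intro compact_Int) auto
      show "K \<inter> cball x (r x) \<subseteq> U x" using Ur xK by auto
      show "continuous_on (U x) F'" using cont *(2) continuous_on_subset by blast
    qed (use *(2) der in auto)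
  qed
  then obtain f where f: "\<And>x. x \<in> I \<Longrightarrow> pushforward_density (W x) F (f x)" by metis
  have Vsum: "V y = (\<Sum>x\<in>I. W x y)" for y
  proof (cases "y \<in> K")
    case True
    have "(\<Sum>x\<in>I. W x y) = V y * S y / max c (S y)"
      by (simp add: W_def S_def sum_divide_distrib sum_distrib_left)
    then show ?thesis using c(2)[OF True] Spos[OF True] by (simp add: max_def)
  qed (simp add: W_def K)
  have "pushforward_density V F (\<lambda>y. \<Sum>x\<in>I. f x y)"
    unfolding pushforward_density_def
  proof (intro conjI allI ballI)
    show "continuous_on UNIV (\<lambda>y. \<Sum>x\<in>I. f x y)"
      using f by (intro continuous_on_sum) (auto simp: pushforward_density_def)
    show "0 \<le> (\<Sum>x\<in>I. f x y)" for y
      using f by (intro sum_nonneg) (auto simp: pushforward_density_def)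
    fix A :: "(real^'m::_) set" assume A: "A \<in> sets borel"
    have "(\<integral>\<^sup>+y. ennreal (V y) * indicator A (F y) \<partial>lborel) =
        (\<integral>\<^sup>+y. (\<Sum>x\<in>I. ennreal (W x y) * indicator A (F y)) \<partial>lborel)"
      using Wpos by (simp add: Vsum sum_ennreal sum_distrib_right[symmetric])
    also have "\<dots> = (\<Sum>x\<in>I. \<integral>\<^sup>+y. ennreal (W x y) * indicator A (F y) \<partial>lborel)"
    proof (intro nn_integral_sum)
      fix x
      have "(\<lambda>y. W x y * indicator A (F y)) \<in> borel_measurable borel"
        using W0 K by (intro borel_measurable_weighted_preimage[OF Q contF Wcont _ A]) auto
      then have "(\<lambda>y. ennreal (W x y * indicator A (F y))) \<in> borel_measurable lborel" by simp
      then show "(\<lambda>y. ennreal (W x y) * indicator A (F y)) \<in> borel_measurable lborel"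
        by (simp add: ennreal_mult' Wpos ennreal_indicator)
    qed
    also have "\<dots> = (\<Sum>x\<in>I. \<integral>\<^sup>+y. ennreal (f x y) * indicator A y \<partial>lborel)"
      using f A by (intro sum.cong) (auto simp: pushforward_density_def)
    also have "\<dots> = (\<integral>\<^sup>+y. (\<Sum>x\<in>I. ennreal (f x y) * indicator A y) \<partial>lborel)"
    proof (intro nn_integral_sum[symmetric])
      fix x assume "x \<in> I"
      then have "f x \<in> borel_measurable borel"
        using f borel_measurable_continuous_onI by (auto simp: pushforward_density_def)
      then show "(\<lambda>y. ennreal (f x y) * indicator A y) \<in> borel_measurable lborel" using A by measurable
    qed
    also have "\<dots> = (\<integral>\<^sup>+y. ennreal (\<Sum>x\<in>I. f x y) * indicator A y \<partial>lborel)"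
      using f by (intro nn_integral_cong) (auto simp: pushforward_density_def sum_ennreal sum_distrib_right[symmetric])
    finally show "(\<integral>\<^sup>+y. ennreal (V y) * indicator A (F y) \<partial>lborel) =
      (\<integral>\<^sup>+y. ennreal (\<Sum>x\<in>I. f x y) * indicator A y \<partial>lborel)" .
  qed
  then show ?thesis by blast
qed

text \<open>The change of variables formula behind \<open>local_pushforward_density\<close> needs a
  well-ordered index type. This copy of a finite type is ordered through its enumeration
  \<open>to_nat\<close>.\<close>

typedef 'a wo = "UNIV :: 'a set" ..

instantiation wo :: (finite) "{finite, wellorder}"
begin

definition "x \<le> y \<longleftrightarrow> to_nat (Rep_wo x) \<le> to_nat (Rep_wo y)"
definition "x < y \<longleftrightarrow> to_nat (Rep_wo x) < to_nat (Rep_wo y)"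

instance
proof
  have "range (Abs_wo :: 'a \<Rightarrow> 'a wo) = UNIV"
    using type_definition.Abs_image[OF type_definition_wo] by simp
  then show "finite (UNIV :: 'a wo set)" by (metis finite finite_imageI)
  show "P a" if "\<And>x. (\<And>y. y < x \<Longrightarrow> P y) \<Longrightarrow> P x" for P and a :: "'a wo"
    by (rule measure_induct_rule[of "\<lambda>x. to_nat (Rep_wo x)"]) (use that in \<open>auto simp: less_wo_def\<close>)
qed (auto simp: less_eq_wo_def less_wo_def Rep_wo_inject)

end

definition to_wo :: "real^'d::finite \<Rightarrow> real^'d wo" where
  "to_wo x = (\<chi> i. x $ Rep_wo i)"

definition of_wo :: "real^'d wo \<Rightarrow> real^'d::finite" where
  "of_wo z = (\<chi> i. z $ Abs_wo i)"

lemma to_of_wo [simp]: "to_wo (of_wo z) = z" "of_wo (to_wo x) = x"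
  by (simp_all add: to_wo_def of_wo_def Rep_wo_inverse Abs_wo_inverse vec_eq_iff)

lemma bounded_linear_to_wo: "bounded_linear (to_wo :: real^'d::finite \<Rightarrow> _)"
  unfolding linear_conv_bounded_linear[symmetric] by (rule linearI) (simp_all add: to_wo_def vec_eq_iff)

lemma bounded_linear_of_wo: "bounded_linear (of_wo :: real^'d::finite wo \<Rightarrow> _)"
  unfolding linear_conv_bounded_linear[symmetric] by (rule linearI) (simp_all add: of_wo_def vec_eq_iff)

lemma prod_Basis_vec:
  fixes f :: "real^'n::finite \<Rightarrow> 'c::comm_monoid_mult"
  shows "(\<Prod>b\<in>Basis. f b) = (\<Prod>i\<in>UNIV. f (axis i 1))"
proof -
  have *: "(Basis :: (real^'n) set) = (\<lambda>i. axis i 1) ` UNIV" by (auto simp: Basis_vec_def)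
  show ?thesis by (simp add: prod.reindex inj_on_def axis_eq_axis *)
qed

text \<open>Relabelling the coordinates maps boxes to boxes with the same side lengths, and Lebesgue
  measure is determined by its values on boxes.\<close>

lemma distr_to_wo: "distr lborel borel (to_wo :: real^'d::finite \<Rightarrow> _) = lborel"
proof (rule lborel_eqI[symmetric])
  have [measurable]: "(to_wo :: real^'d::finite \<Rightarrow> _) \<in> borel_measurable borel"
    by (intro borel_measurable_continuous_onI linear_continuous_on bounded_linear_to_wo)
  have bij: "bij (Rep_wo :: 'd wo \<Rightarrow> 'd)"
    by (metis Abs_wo_inverse Rep_wo_inverse UNIV_I bijI')
  fix l u :: "real^'d wo" assume le: "\<And>b. b \<in> Basis \<Longrightarrow> l \<bullet> b \<le> u \<bullet> b"
  have "l $ i \<le> u $ i" for i using le[of "axis i 1"] by (simp add: inner_axis)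
  then have le': "\<And>b. b \<in> Basis \<Longrightarrow> of_wo l \<bullet> b \<le> of_wo u \<bullet> b"
    by (auto simp: Basis_vec_def inner_axis of_wo_def)
  have "emeasure (distr lborel borel to_wo) (box l u) = emeasure lborel (to_wo -` box l u)"
    by (simp add: emeasure_distr)
  also have "to_wo -` box l u = box (of_wo l) (of_wo u)"
    by (auto simp: mem_box_cart to_wo_def of_wo_def) (metis Rep_wo_inverse Abs_wo_inverse UNIV_I)+
  also have "emeasure lborel \<dots> = (\<Prod>b\<in>Basis. (of_wo u - of_wo l) \<bullet> b)"
    using le' by (simp add: emeasure_lborel_box)
  also have "\<dots> = (\<Prod>i\<in>UNIV. u $ Abs_wo i - l $ Abs_wo i)"
    by (simp add: prod_Basis_vec inner_axis of_wo_def)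
  also have "\<dots> = (\<Prod>i\<in>UNIV. u $ i - l $ i)"
    using prod.reindex_bij_betw[OF bij, of "\<lambda>i. u $ Abs_wo i - l $ Abs_wo i"] by (simp add: Rep_wo_inverse)
  also have "\<dots> = (\<Prod>b\<in>Basis. (u - l) \<bullet> b)"
    by (simp add: prod_Basis_vec inner_axis)
  finally show "emeasure (distr lborel borel to_wo) (box l u) = (\<Prod>b\<in>Basis. (u - l) \<bullet> b)" .
qed simp

lemma nn_integral_to_wo:
  assumes "h \<in> borel_measurable borel"
  shows "(\<integral>\<^sup>+x. h (to_wo x) \<partial>lborel) = (\<integral>\<^sup>+z. h z \<partial>lborel)"
proof -
  have [measurable]: "(to_wo :: real^'d::finite \<Rightarrow> _) \<in> borel_measurable borel"
    by (intro borel_measurable_continuous_onI linear_continuous_on bounded_linear_to_wo)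
  have "(\<integral>\<^sup>+z. h z \<partial>lborel) = (\<integral>\<^sup>+z. h z \<partial>distr lborel borel to_wo)" by (simp add: distr_to_wo)
  also have "\<dots> = (\<integral>\<^sup>+x. h (to_wo x) \<partial>lborel)"
    using assms by (subst nn_integral_distr) auto
  finally show ?thesis ..
qed

text \<open>The relabelling is linear and preserves Lebesgue measure, so conjugating
  \<open>F\<close> with it reduces the claim to \<open>pushforward_density_wellorder\<close>; the
  density found there is composed with \<open>to_wo\<close>.\<close>

theorem pushforward_density_exists:
  fixes F :: "real^'d::finite \<Rightarrow> real^'d" and F' :: "real^'d \<Rightarrow> ((real^'d) \<Rightarrow>\<^sub>L (real^'d))"
  assumes Q: "open Q"
    and der: "\<And>x. x \<in> Q \<Longrightarrow> (F has_derivative blinfun_apply (F' x)) (at x)"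
    and cont: "continuous_on Q F'"
    and V: "continuous_on UNIV V" "\<And>y. 0 \<le> V y" and K: "compact K" "K \<subseteq> Q" "\<And>y. y \<notin> K \<Longrightarrow> V y = 0"
    and inj: "\<And>y. y \<in> K \<Longrightarrow> inj (blinfun_apply (F' y))"
  shows "\<exists>f. pushforward_density V F f"
proof -
  note contR = linear_continuous_on[OF bounded_linear_to_wo] and contRi = linear_continuous_on[OF bounded_linear_of_wo]
  have contF: "continuous_on Q F"
    using der by (meson has_derivative_continuous_on has_derivative_at_withinI)
  define G where "G z = to_wo (F (of_wo z))" for z :: "real^'d wo"
  define G' where "G' z = Blinfun to_wo o\<^sub>L F' (of_wo z) o\<^sub>L Blinfun of_wo" for z :: "real^'d wo"
  have G'_apply: "blinfun_apply (G' z) = (\<lambda>v. to_wo (F' (of_wo z) (of_wo v)))" for z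
    by (simp add: G'_def fun_eq_iff bounded_linear_Blinfun_apply bounded_linear_to_wo bounded_linear_of_wo)
  define Q' where "Q' = of_wo -` Q"
  define K' where "K' = to_wo ` K"
  have "\<exists>g. pushforward_density (V \<circ> of_wo) G g"
  proof (rule pushforward_density_wellorder)
    show "open Q'" unfolding Q'_def by (rule open_vimage[OF Q contRi])
    show "(G has_derivative blinfun_apply (G' z)) (at z)" if "z \<in> Q'" for z
    proof -
      have "(F has_derivative blinfun_apply (F' (of_wo z))) (at (of_wo z))" using der that by (auto simp: Q'_def)
      from has_derivative_compose[OF bounded_linear_imp_has_derivative[OF bounded_linear_of_wo] this]
      have "((\<lambda>x. F (of_wo x)) has_derivative (\<lambda>x. F' (of_wo z) (of_wo x))) (at z)" .
      then show ?thesis unfolding G'_apply G_def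
        by (rule bounded_linear.has_derivative[OF bounded_linear_to_wo])
    qed
    show "continuous_on Q' G'" unfolding G'_def
      by (intro continuous_intros continuous_on_compose2[OF cont] contRi) (auto simp: Q'_def)
    show "continuous_on UNIV (V \<circ> of_wo)"
      using V(1) contRi continuous_on_compose2 by (simp add: o_def) blast
    show "compact K'" unfolding K'_def by (rule compact_continuous_image[OF contR K(1)])
    show "K' \<subseteq> Q'" using K(2) by (auto simp: K'_def Q'_def)
    show "(V \<circ> of_wo) z = 0" if "z \<notin> K'" for z
    proof -
      have "of_wo z \<notin> K" using that unfolding K'_def by (metis image_eqI to_of_wo(1))
      then show ?thesis using K(3) by simp
    qed
    show "inj (blinfun_apply (G' z))" if "z \<in> K'" for z
    proof -
      have "of_wo z \<in> K" using that by (auto simp: K'_def)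
      then have inj_F': "inj (blinfun_apply (F' (of_wo z)))" using inj by blast
      show ?thesis unfolding G'_apply
      proof (rule injI)
        fix a b assume "to_wo (F' (of_wo z) (of_wo a)) = to_wo (F' (of_wo z) (of_wo b))"
        then have "F' (of_wo z) (of_wo a) = F' (of_wo z) (of_wo b)" by (metis to_of_wo(2))
        then have "of_wo a = of_wo b" using inj_F' by (simp add: inj_eq)
        then show "a = b" by (metis to_of_wo(1))
      qed
    qed
  qed (simp add: V)
  then obtain g where g: "continuous_on UNIV g" "\<And>x. 0 \<le> g x" and gA: "\<And>A. A \<in> sets borel \<Longrightarrow>
      (\<integral>\<^sup>+z. ennreal (V (of_wo z)) * indicator A (G z) \<partial>lborel) = (\<integral>\<^sup>+x. ennreal (g x) * indicator A x \<partial>lborel)"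
    by (auto simp: pushforward_density_def)
  have "pushforward_density V F (\<lambda>x. g (to_wo x))"
    unfolding pushforward_density_def
  proof (intro conjI allI ballI)
    show "continuous_on UNIV (\<lambda>x. g (to_wo x))"
      by (rule continuous_on_compose2[OF g(1) contR]) simp
    fix A :: "(real^'d) set" assume A: "A \<in> sets borel"
    have [measurable]: "of_wo -` A \<in> sets borel"
      using measurable_sets[OF borel_measurable_continuous_onI[OF contRi] A] by simp
    have [measurable]: "g \<in> borel_measurable borel" using g(1) by (rule borel_measurable_continuous_onI)
    have m: "(\<lambda>z. ennreal (V (of_wo z)) * indicator (of_wo -` A) (G z)) \<in> borel_measurable borel"
    proof -
      have 1: "(\<lambda>y. V y * indicator A (F y)) \<in> borel_measurable borel"
        using K by (intro borel_measurable_weighted_preimage[OF Q contF V(1) _ A]) auto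
      have "(\<lambda>z. ennreal (V (of_wo z) * indicator A (F (of_wo z)))) \<in> borel_measurable borel"
        using measurable_compose[OF borel_measurable_continuous_onI[OF contRi] 1] by simp
      then show ?thesis
        unfolding G_def ennreal_times_indicator by (simp add: indicator_def)
    qed
    have "(\<integral>\<^sup>+y. ennreal (V y) * indicator A (F y) \<partial>lborel) =
        (\<integral>\<^sup>+x. ennreal (V (of_wo (to_wo x))) * indicator (of_wo -` A) (G (to_wo x)) \<partial>lborel)"
      by (simp add: G_def indicator_def)
    also have "\<dots> = (\<integral>\<^sup>+z. ennreal (V (of_wo z)) * indicator (of_wo -` A) (G z) \<partial>lborel)"
      by (rule nn_integral_to_wo[OF m])
    also have "\<dots> = (\<integral>\<^sup>+z. ennreal (g z) * indicator (of_wo -` A) z \<partial>lborel)"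
      by (rule gA) simp
    also have "\<dots> = (\<integral>\<^sup>+x. ennreal (g (to_wo x)) * indicator (of_wo -` A) (to_wo x) \<partial>lborel)"
      by (rule nn_integral_to_wo[symmetric]) simp
    finally show "(\<integral>\<^sup>+y. ennreal (V y) * indicator A (F y) \<partial>lborel) =
      (\<integral>\<^sup>+x. ennreal (g (to_wo x)) * indicator A x \<partial>lborel)" by (simp add: indicator_def)
  qed (rule g)
  then show ?thesis by (rule exI[where x="\<lambda>x. g (to_wo x)"])
qed

section \<open>Morrey's inequality\<close>

text \<open>Beyond \<open>a = s\<close> the factor \<open>(a / s) powr (p - 1)\<close> is at least
  1. The free parameter \<open>s\<close> balances the two terms: on integration the first yields a
  volume and the second a \<open>p\<close>-th moment.\<close>

lemma le_add_powr_mult: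
  fixes a s p :: real
  assumes "0 \<le> a" "0 < s" "1 \<le> p"
  shows "a \<le> s + s powr (1 - p) * a powr p"
proof (cases "a \<le> s")
  case True
  then show ?thesis by (simp add: add_increasing2)
next
  case False
  then have a: "a > 0" "1 \<le> a / s" using assms by auto
  have "1 \<le> (a / s) powr (p - 1)" using a assms by (simp add: ge_one_powr_ge_zero)
  then have "a * 1 \<le> a * (a / s) powr (p - 1)" using a by (intro mult_left_mono) auto
  also have "\<dots> = a powr 1 * (a powr (p - 1) / s powr (p - 1))"
    using a assms by (simp add: powr_divide)
  also have "\<dots> = s powr (1 - p) * a powr p"
    using a assms by (simp add: powr_add[symmetric] powr_minus_divide[symmetric] powr_diff[of a] powr_diff[of s])
  finally show ?thesis using assms by simp
qed

lemma nn_integral_lborel_affine: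
  fixes h :: "'a::euclidean_space \<Rightarrow> ennreal"
  assumes [measurable]: "h \<in> borel_measurable borel" and c: "c > 0"
  shows "(\<integral>\<^sup>+y. h (x + c *\<^sub>R y) \<partial>lborel) = ennreal (c powr (- real DIM('a))) * (\<integral>\<^sup>+z. h z \<partial>lborel)"
proof -
  have "(\<integral>\<^sup>+z. h z \<partial>lborel) = (\<integral>\<^sup>+z. h z \<partial>density (distr lborel borel (\<lambda>y. x + c *\<^sub>R y)) (\<lambda>_. ennreal (\<bar>c\<bar>^DIM('a))))"
    using c by (subst lborel_affine[of c x]) auto
  also have "\<dots> = ennreal (c ^ DIM('a)) * (\<integral>\<^sup>+y. h (x + c *\<^sub>R y) \<partial>lborel)"
    using c by (simp add: nn_integral_density nn_integral_distr nn_integral_cmult)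
  finally have "ennreal (c powr (- real DIM('a))) * (\<integral>\<^sup>+z. h z \<partial>lborel) =
      (ennreal (c powr (- real DIM('a))) * ennreal (c ^ DIM('a))) * (\<integral>\<^sup>+y. h (x + c *\<^sub>R y) \<partial>lborel)"
    by (simp add: mult.assoc)
  also have "ennreal (c powr (- real DIM('a))) * ennreal (c ^ DIM('a)) = 1"
    using c by (simp add: ennreal_mult'[symmetric] powr_minus powr_realpow)
  finally show ?thesis by simp
qed

lemma nn_integral_powr_from_0:
  assumes "-1 < (e::real)"
  shows "(\<integral>\<^sup>+t. ennreal (t powr e) * indicator {0..1} t \<partial>lborel) = ennreal (1 / (e + 1))"
  using nn_integral_has_integral_lebesgue'[OF _ has_integral_powr_from_0[OF assms, of 1]] by simp

text \<open>
  Morrey's inequality: average the increments of \<open>u\<close> over segments from \<open>x\<close>; the substitution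
  \<open>z = x + t (y - x)\<close> costs \<open>t\<^bsup>-d\<^esup>\<close>, and the choice \<open>s = t\<^bsup>-d/p\<^esup>\<close> in
  \<open>le_add_powr_mult\<close> replaces Hoelder's inequality
  and leaves the factor \<open>t\<^bsup>-d/p\<^esup>\<close>, integrable since \<open>p > d\<close>.
\<close>

lemma morrey_segment:
  fixes a :: "real^'d::finite \<Rightarrow> real"
  assumes p: "real CARD('d) < p" and [measurable]: "a \<in> borel_measurable borel"
    and a0: "\<And>y. y \<notin> ball 0 1 \<Longrightarrow> a y = 0" and K: "0 \<le> K"
    and Ka: "(\<integral>\<^sup>+y. ennreal (\<bar>a y\<bar> powr p) * indicator (ball 0 1) y \<partial>lborel) \<le> ennreal K"
  shows "(\<integral>\<^sup>+y. (\<integral>\<^sup>+t. ennreal \<bar>a (x + t *\<^sub>R (y - x))\<bar> * indicator {0..1} t \<partial>lborel) * indicator (ball 0 1) y \<partial>lborel)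
    \<le> ennreal ((measure lborel (ball 0 1 :: (real^'d) set) + K) / (1 - real CARD('d) / p))"
proof -
  let ?B = "ball 0 1 :: (real^'d) set"
  have Bm[measurable]: "?B \<in> sets borel" by simp
  define d where "d = real CARD('d)"
  have d: "1 \<le> d" "d < p" using p by (auto simp: d_def Suc_leI)
  have m: "emeasure lborel ?B = ennreal (measure lborel ?B)"
    using emeasure_bounded_finite[of ?B] by (simp add: emeasure_eq_ennreal_measure)
  have int: "(\<integral>\<^sup>+z. ennreal (\<bar>a z\<bar> powr p) \<partial>lborel) \<le> ennreal K"
  proof -
    have "(\<integral>\<^sup>+z. ennreal (\<bar>a z\<bar> powr p) \<partial>lborel) = (\<integral>\<^sup>+y. ennreal (\<bar>a y\<bar> powr p) * indicator ?B y \<partial>lborel)"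
      using a0 by (intro nn_integral_cong) (auto split: split_indicator)
    with Ka show ?thesis by simp
  qed
  have inner: "(\<integral>\<^sup>+y. ennreal \<bar>a (x + t *\<^sub>R (y - x))\<bar> * indicator ?B y \<partial>lborel)
      \<le> ennreal (t powr (- d / p)) * ennreal (measure lborel ?B + K)" if t: "0 < t" for t
  proof -
    define s where "s = t powr (- d / p)"
    have s: "0 < s" using t by (simp add: s_def)
    have "ennreal \<bar>a (x + t *\<^sub>R (y - x))\<bar> * indicator ?B y \<le>
        ennreal s * indicator ?B y + ennreal (s powr (1 - p)) * ennreal (\<bar>a ((x - t *\<^sub>R x) + t *\<^sub>R y)\<bar> powr p)" for y
    proof -
      have "ennreal \<bar>a (x + t *\<^sub>R (y - x))\<bar> \<le> ennreal (s + s powr (1 - p) * \<bar>a (x + t *\<^sub>R (y - x))\<bar> powr p)"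
        using le_add_powr_mult[OF _ s, of "\<bar>a (x + t *\<^sub>R (y - x))\<bar>" p] d by (intro ennreal_leI) auto
      also have "x + t *\<^sub>R (y - x) = (x - t *\<^sub>R x) + t *\<^sub>R y" by (simp add: algebra_simps)
      finally show ?thesis using s by (auto split: split_indicator simp: ennreal_mult' algebra_simps)
    qed
    then have "(\<integral>\<^sup>+y. ennreal \<bar>a (x + t *\<^sub>R (y - x))\<bar> * indicator ?B y \<partial>lborel) \<le>
      (\<integral>\<^sup>+y. ennreal s * indicator ?B y + ennreal (s powr (1 - p)) * ennreal (\<bar>a ((x - t *\<^sub>R x) + t *\<^sub>R y)\<bar> powr p) \<partial>lborel)"
      by (rule nn_integral_mono)
    also have "\<dots> = ennreal s * emeasure lborel ?B +
        ennreal (s powr (1 - p)) * (\<integral>\<^sup>+y. ennreal (\<bar>a ((x - t *\<^sub>R x) + t *\<^sub>R y)\<bar> powr p) \<partial>lborel)"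
      by (subst nn_integral_add) (auto simp: nn_integral_cmult nn_integral_cmult_indicator)
    also have "(\<integral>\<^sup>+y. ennreal (\<bar>a ((x - t *\<^sub>R x) + t *\<^sub>R y)\<bar> powr p) \<partial>lborel) =
        ennreal (t powr (- d)) * (\<integral>\<^sup>+z. ennreal (\<bar>a z\<bar> powr p) \<partial>lborel)"
      using nn_integral_lborel_affine[OF _ t, of "\<lambda>z. ennreal (\<bar>a z\<bar> powr p)" "x - t *\<^sub>R x"] by (simp add: d_def)
    also have "ennreal s * emeasure lborel ?B + ennreal (s powr (1 - p)) * (ennreal (t powr (- d)) * (\<integral>\<^sup>+z. ennreal (\<bar>a z\<bar> powr p) \<partial>lborel))
        \<le> ennreal s * ennreal (measure lborel ?B) + ennreal (s powr (1 - p)) * (ennreal (t powr (- d)) * ennreal K)"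
      unfolding m by (intro add_mono mult_left_mono int) auto
    also have "\<dots> = ennreal s * ennreal (measure lborel ?B) + ennreal (s powr (1 - p) * t powr (- d)) * ennreal K"
      by (simp add: ennreal_mult' mult.assoc)
    \<comment> \<open>The exponent is \<open>- d / p + d - d\<close>. Both terms thus carry the same
      factor \<open>t powr (- d / p)\<close>, which is the reason for the choice of
      \<open>s\<close>.\<close>
    also have "s powr (1 - p) * t powr (- d) = s"
      using t d unfolding s_def by (simp add: powr_powr powr_add[symmetric]) (simp add: field_simps)
    finally show ?thesis using s K by (simp add: s_def distrib_left)
  qed
  have "(\<integral>\<^sup>+y. (\<integral>\<^sup>+t. ennreal \<bar>a (x + t *\<^sub>R (y - x))\<bar> * indicator {0..1} t \<partial>lborel) * indicator ?B y \<partial>lborel)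
    = (\<integral>\<^sup>+y. (\<integral>\<^sup>+t. ennreal \<bar>a (x + t *\<^sub>R (y - x))\<bar> * indicator {0..1} t * indicator ?B y \<partial>lborel) \<partial>lborel)"
    by (subst nn_integral_multc) auto
  also have "\<dots> = (\<integral>\<^sup>+t. (\<integral>\<^sup>+y. ennreal \<bar>a (x + t *\<^sub>R (y - x))\<bar> * indicator {0..1} t * indicator ?B y \<partial>lborel) \<partial>lborel)"
    by (rule lborel_pair.Fubini') measurable
  also have "\<dots> = (\<integral>\<^sup>+t. (\<integral>\<^sup>+y. ennreal \<bar>a (x + t *\<^sub>R (y - x))\<bar> * indicator ?B y \<partial>lborel) * indicator {0..1} t \<partial>lborel)"
    by (subst nn_integral_multc[symmetric]) (auto simp: ac_simps)
  also have "\<dots> \<le> (\<integral>\<^sup>+t. ennreal (measure lborel ?B + K) * (ennreal (t powr (- d / p)) * indicator {0..1} t) \<partial>lborel)"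
  proof (rule nn_integral_mono_AE)
    have "AE t in lborel. t \<noteq> (0::real)" by (rule AE_lborel_singleton)
    then show "AE t in lborel. (\<integral>\<^sup>+y. ennreal \<bar>a (x + t *\<^sub>R (y - x))\<bar> * indicator ?B y \<partial>lborel) * indicator {0..1} t
       \<le> ennreal (measure lborel ?B + K) * (ennreal (t powr (- d / p)) * indicator {0..1} t)"
    proof eventually_elim
      case (elim t)
      show ?case using elim inner[of t] by (auto split: split_indicator simp: mult.commute)
    qed
  qed
  also have "\<dots> = ennreal (measure lborel ?B + K) * ennreal (1 / (- d / p + 1))"
  proof -
    have "-1 < - d / p" using d by (simp add: field_simps)
    from nn_integral_powr_from_0[OF this] show ?thesis by (subst nn_integral_cmult) auto
  qed
  also have "\<dots> = ennreal ((measure lborel ?B + K) / (1 - d / p))"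
    using K by (subst ennreal_mult'[symmetric]) auto
  finally show ?thesis by (simp add: d_def)
qed

text \<open>Fundamental theorem of calculus along the segment, which stays in the convex ball. The
  factor 2 bounds the coordinates of \<open>y - x\<close>, both points having norm below 1.\<close>

lemma ennreal_abs_diff_le_segment:
  fixes u :: "real^'d::finite \<Rightarrow> real"
  assumes der: "\<And>y. y \<in> ball 0 1 \<Longrightarrow> (u has_derivative (\<lambda>v. \<Sum>j\<in>UNIV. v $ j * a j y)) (at y)"
    and cont: "\<And>j. continuous_on (ball 0 1) (a j)"
    and a0: "\<And>j y. y \<notin> ball 0 1 \<Longrightarrow> a j y = 0"
    and [measurable]: "\<And>j. a j \<in> borel_measurable borel"
    and x: "x \<in> ball 0 1" and y: "y \<in> ball 0 1"
  shows "ennreal \<bar>u y - u x\<bar> \<le> (\<Sum>j\<in>UNIV. 2 * (\<integral>\<^sup>+t. ennreal \<bar>a j (x + t *\<^sub>R (y - x))\<bar> * indicator {0..1} t \<partial>lborel))"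
proof -
  define k where "k t = (\<Sum>j\<in>UNIV. (y - x) $ j * a j (x + t *\<^sub>R (y - x)))" for t
  have seg: "x + t *\<^sub>R (y - x) \<in> ball 0 1" if "t \<in> {0..1}" for t
  proof -
    have "x + t *\<^sub>R (y - x) = (1 - t) *\<^sub>R x + t *\<^sub>R y" by (simp add: algebra_simps)
    then show ?thesis using convexD[OF convex_ball x y, of "1 - t" t] that by simp
  qed
  have hb: "has_bochner_integral lborel (\<lambda>t. indicator {0..1} t *\<^sub>R k t) (u (x + 1 *\<^sub>R (y - x)) - u (x + 0 *\<^sub>R (y - x)))"
  proof (rule has_bochner_integral_FTC_Icc)
    fix t :: real assume t: "0 \<le> t" "t \<le> 1"
    have 1: "((\<lambda>t. x + t *\<^sub>R (y - x)) has_derivative (\<lambda>h. h *\<^sub>R (y - x))) (at t)"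
      by (auto intro!: derivative_eq_intros)
    have "((\<lambda>t. u (x + t *\<^sub>R (y - x))) has_derivative (\<lambda>h. \<Sum>j\<in>UNIV. (h *\<^sub>R (y - x)) $ j * a j (x + t *\<^sub>R (y - x)))) (at t)"
      by (rule has_derivative_compose[OF 1 der]) (use seg t in auto)
    then have "((\<lambda>t. u (x + t *\<^sub>R (y - x))) has_vector_derivative k t) (at t)"
      unfolding has_vector_derivative_def k_def
      by (rule has_derivative_eq_rhs) (simp add: fun_eq_iff sum_distrib_left mult.assoc)
    then show "((\<lambda>t. u (x + t *\<^sub>R (y - x))) has_vector_derivative k t) (at t within {0..1})"
      by (rule has_vector_derivative_at_within)
  next
    show "continuous_on {0..1} k" unfolding k_def
      by (intro continuous_intros continuous_on_compose2[OF cont]) (use seg in auto)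
  qed simp
  then have "ennreal \<bar>u y - u x\<bar> \<le> (\<integral>\<^sup>+t. norm (indicator {0..1} t *\<^sub>R k t) \<partial>lborel)"
    using has_bochner_integral_norm_bound[OF hb] by simp
  also have "\<dots> \<le> (\<integral>\<^sup>+t. (\<Sum>j\<in>UNIV. 2 * (ennreal \<bar>a j (x + t *\<^sub>R (y - x))\<bar> * indicator {0..1} t)) \<partial>lborel)"
  proof (rule nn_integral_mono)
    fix t :: real
    have le2: "\<bar>(y - x) $ j\<bar> \<le> 2" for j
    proof -
      have "\<bar>(y - x) $ j\<bar> \<le> norm (y - x)" by (rule component_le_norm_cart)
      also have "\<dots> \<le> norm y + norm x" by (rule norm_triangle_ineq4)
      finally show ?thesis using x y by simp
    qed
    have "\<bar>k t\<bar> \<le> (\<Sum>j\<in>UNIV. \<bar>(y - x) $ j * a j (x + t *\<^sub>R (y - x))\<bar>)"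
      unfolding k_def by (rule sum_abs)
    also have "\<dots> \<le> (\<Sum>j\<in>UNIV. 2 * \<bar>a j (x + t *\<^sub>R (y - x))\<bar>)"
      by (intro sum_mono) (simp only: abs_mult, intro mult_right_mono le2, simp)
    finally have "ennreal \<bar>k t\<bar> \<le> ennreal (\<Sum>j\<in>UNIV. 2 * \<bar>a j (x + t *\<^sub>R (y - x))\<bar>)"
      by (rule ennreal_leI)
    also have "\<dots> = (\<Sum>j\<in>UNIV. 2 * ennreal \<bar>a j (x + t *\<^sub>R (y - x))\<bar>)"
      by (subst sum_ennreal[symmetric]) (auto simp: ennreal_mult')
    finally show "ennreal (norm (indicator {0..1} t *\<^sub>R k t)) \<le> (\<Sum>j\<in>UNIV. 2 * (ennreal \<bar>a j (x + t *\<^sub>R (y - x))\<bar> * indicator {0..1} t))"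
      by (auto split: split_indicator)
  qed
  also have "\<dots> = (\<Sum>j\<in>UNIV. 2 * (\<integral>\<^sup>+t. ennreal \<bar>a j (x + t *\<^sub>R (y - x))\<bar> * indicator {0..1} t \<partial>lborel))"
    by (subst nn_integral_sum) (auto simp: nn_integral_cmult)
  finally show ?thesis .
qed

text \<open>Average the inequality \<open>|u x| \<le> |u y| + |u y - u x|\<close> over
  \<open>y\<close> in the ball: the first term is controlled by the \<open>p\<close>-th moment of
  \<open>u\<close>, the second by the segment estimate. The constant is chosen before
  \<open>u\<close>, so that one bound serves a whole sequence of functions.\<close>

theorem morrey:
  fixes p K :: real
  assumes p: "real CARD('d::finite) < p" and K: "0 \<le> K"
  shows "\<exists>C. \<forall>(u :: real^'d \<Rightarrow> real) a.
     (\<forall>y\<in>ball 0 1. (u has_derivative (\<lambda>v. \<Sum>j\<in>UNIV. v $ j * a j y)) (at y)) \<longrightarrow>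
     (\<forall>j. continuous_on (ball 0 1) (a j)) \<longrightarrow>
     (\<integral>\<^sup>+y. ennreal (\<bar>u y\<bar> powr p) * indicator (ball 0 1) y \<partial>lborel) \<le> ennreal K \<longrightarrow>
     (\<forall>j. (\<integral>\<^sup>+y. ennreal (\<bar>a j y\<bar> powr p) * indicator (ball 0 1) y \<partial>lborel) \<le> ennreal K) \<longrightarrow>
     (\<forall>x\<in>ball 0 1. \<bar>u x\<bar> \<le> C)"
proof -
  let ?B = "ball 0 1 :: (real^'d) set"
  have Bm[measurable]: "?B \<in> sets borel" by simp
  define m where "m = measure lborel ?B"
  define E where "E = (m + K) / (1 - real CARD('d) / p)"
  define C where "C = ((m + K) + real CARD('d) * (2 * E)) / m"
  have em: "emeasure lborel ?B = ennreal m"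
    using emeasure_bounded_finite[of ?B] by (simp add: m_def emeasure_eq_ennreal_measure)
  have m: "m > 0"
    unfolding m_def by (rule content_ball_pos) simp
  have d: "1 \<le> real CARD('d)" by (simp add: Suc_leI)
  have E: "E \<ge> 0" unfolding E_def using p d K m by (intro divide_nonneg_nonneg) (auto simp: field_simps)
  have main: "\<bar>u x\<bar> \<le> C"
    if der: "\<And>y. y \<in> ?B \<Longrightarrow> (u has_derivative (\<lambda>v. \<Sum>j\<in>UNIV. v $ j * a j y)) (at y)"
    and cont: "\<And>j. continuous_on ?B (a j)"
    and Ku: "(\<integral>\<^sup>+y. ennreal (\<bar>u y\<bar> powr p) * indicator ?B y \<partial>lborel) \<le> ennreal K"
    and Ka: "\<And>j. (\<integral>\<^sup>+y. ennreal (\<bar>a j y\<bar> powr p) * indicator ?B y \<partial>lborel) \<le> ennreal K"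
    and x: "x \<in> ?B"
    for u :: "real^'d \<Rightarrow> real" and a x
  proof -
    \<comment> \<open>The derivative is cut off outside the ball, where nothing is known about it.
      This makes it Borel and allows the substitution in \<open>morrey_segment\<close> to run over
      the whole space.\<close>
    define b where "b j y = (if y \<in> ?B then a j y else 0)" for j y
    have ext: "(\<lambda>y. if y \<in> ?B then f y else 0) \<in> borel_measurable borel" if "continuous_on ?B f" for f :: "real^'d \<Rightarrow> real"
      by (rule measurable_restrict_space_iff[THEN iffD1])
         (use that borel_measurable_continuous_on_restrict in auto)
    have bm[measurable]: "b j \<in> borel_measurable borel" for j
      unfolding b_def by (rule ext[OF cont])
    have contu: "continuous_on ?B u"
      using der by (meson has_derivative_continuous_on has_derivative_at_withinI)
    have um: "(\<lambda>y. if y \<in> ?B then u y else 0) \<in> borel_measurable borel" by (rule ext[OF contu])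
    define g1 where "g1 y = ennreal (\<bar>u y\<bar> powr p) * indicator ?B y" for y
    have [measurable]: "g1 \<in> borel_measurable borel"
    proof -
      have "(\<lambda>y. ennreal (\<bar>if y \<in> ?B then u y else 0\<bar> powr p)) \<in> borel_measurable borel"
        using um by measurable
      also have "(\<lambda>y. ennreal (\<bar>if y \<in> ?B then u y else 0\<bar> powr p)) = g1"
        by (auto simp: fun_eq_iff g1_def split: split_indicator)
      finally show ?thesis .
    qed
    define g2 where "g2 j y = (\<integral>\<^sup>+t. ennreal \<bar>b j (x + t *\<^sub>R (y - x))\<bar> * indicator {0..1} t \<partial>lborel) * indicator ?B y" for j y
    have [measurable]: "g2 j \<in> borel_measurable borel" for j
      unfolding g2_def by measurable
    have seg: "ennreal \<bar>u y - u x\<bar> \<le> (\<Sum>j\<in>UNIV. 2 * (\<integral>\<^sup>+t. ennreal \<bar>b j (x + t *\<^sub>R (y - x))\<bar> * indicator {0..1} t \<partial>lborel))"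
      if "y \<in> ?B" for y
    proof (rule ennreal_abs_diff_le_segment[OF _ _ _ _ x that])
      show "(u has_derivative (\<lambda>v. \<Sum>j\<in>UNIV. v $ j * b j y)) (at y)" if "y \<in> ?B" for y
        using der[OF that] that by (simp add: b_def)
      show "continuous_on ?B (b j)" for j
        using cont[of j] by (rule continuous_on_cong[THEN iffD1, rotated -1]) (auto simp: b_def)
      show "b j y = 0" if "y \<notin> ?B" for j y using that by (simp add: b_def)
    qed (rule bm)
    have pw: "ennreal \<bar>u x\<bar> * indicator ?B y \<le> (indicator ?B y + g1 y) + (\<Sum>j\<in>UNIV. 2 * g2 j y)" for y
    proof (cases "y \<in> ?B")
      case True
      have "\<bar>u x\<bar> \<le> \<bar>u y\<bar> + \<bar>u y - u x\<bar>" by simp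
      moreover have "\<bar>u y\<bar> \<le> 1 + \<bar>u y\<bar> powr p"
        using le_add_powr_mult[of "\<bar>u y\<bar>" 1 p] p d by simp
      ultimately have "\<bar>u x\<bar> \<le> (1 + \<bar>u y\<bar> powr p) + \<bar>u y - u x\<bar>" by simp
      then have "ennreal \<bar>u x\<bar> \<le> ennreal ((1 + \<bar>u y\<bar> powr p) + \<bar>u y - u x\<bar>)" by (rule ennreal_leI)
      also have "\<dots> = (1 + ennreal (\<bar>u y\<bar> powr p)) + ennreal \<bar>u y - u x\<bar>" by (simp add: ennreal_plus)
      also have "\<dots> \<le> (1 + ennreal (\<bar>u y\<bar> powr p)) +
         (\<Sum>j\<in>UNIV. 2 * (\<integral>\<^sup>+t. ennreal \<bar>b j (x + t *\<^sub>R (y - x))\<bar> * indicator {0..1} t \<partial>lborel))"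
        by (intro add_left_mono seg True)
      finally show ?thesis using True by (simp add: g1_def g2_def)
    qed simp
    have "ennreal \<bar>u x\<bar> * ennreal m = (\<integral>\<^sup>+y. ennreal \<bar>u x\<bar> * indicator ?B y \<partial>lborel)"
      by (simp add: nn_integral_cmult_indicator em)
    also have "\<dots> \<le> (\<integral>\<^sup>+y. (indicator ?B y + g1 y) + (\<Sum>j\<in>UNIV. 2 * g2 j y) \<partial>lborel)"
      by (rule nn_integral_mono) (rule pw)
    also have "\<dots> = (ennreal m + (\<integral>\<^sup>+y. g1 y \<partial>lborel)) + (\<Sum>j\<in>UNIV. 2 * (\<integral>\<^sup>+y. g2 j y \<partial>lborel))"
      by (simp add: nn_integral_add nn_integral_sum nn_integral_cmult em)
    also have "\<dots> \<le> (ennreal m + ennreal K) + (\<Sum>j\<in>(UNIV :: 'd set). 2 * ennreal E)"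
    proof (intro add_mono sum_mono mult_left_mono order_refl)
      show "(\<integral>\<^sup>+y. g1 y \<partial>lborel) \<le> ennreal K" using Ku by (simp add: g1_def)
      fix j
      have "(\<integral>\<^sup>+y. ennreal (\<bar>b j y\<bar> powr p) * indicator ?B y \<partial>lborel) = (\<integral>\<^sup>+y. ennreal (\<bar>a j y\<bar> powr p) * indicator ?B y \<partial>lborel)"
        by (intro nn_integral_cong) (auto simp: b_def split: split_indicator)
      then have "(\<integral>\<^sup>+y. ennreal (\<bar>b j y\<bar> powr p) * indicator ?B y \<partial>lborel) \<le> ennreal K" using Ka by simp
      from morrey_segment[OF p bm _ K this, of x]
      show "(\<integral>\<^sup>+y. g2 j y \<partial>lborel) \<le> ennreal E"
        unfolding g2_def by (simp add: E_def m_def b_def)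
    qed simp
    also have "\<dots> = ennreal ((m + K) + real CARD('d) * (2 * E))"
      using m K E by (simp add: ennreal_plus ennreal_mult' ennreal_of_nat_eq_real_of_nat)
    finally have "ennreal (\<bar>u x\<bar> * m) \<le> ennreal ((m + K) + real CARD('d) * (2 * E))"
      using m by (simp add: ennreal_mult')
    then have "\<bar>u x\<bar> * m \<le> (m + K) + real CARD('d) * (2 * E)"
      using m K E by (subst (asm) ennreal_le_iff) auto
    then show ?thesis using m by (simp add: C_def pos_le_divide_eq)
  qed
  show ?thesis using main by (intro exI[of _ C]) blast
qed

text \<open>The factor \<open>2 ^ m\<close> turns a bound uniform in \<open>m\<close> into
  geometrically small increments, to which the Weierstrass test applies. The limit is written with
  \<open>lim\<close> so that it agrees with a function defined without reference to
  \<open>B\<close>.\<close>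

lemma uniform_limit_geometric_increments:
  fixes u :: "nat \<Rightarrow> 'a::topological_space \<Rightarrow> real"
  assumes inc: "\<And>m y. y \<in> B \<Longrightarrow> \<bar>2 ^ m * (u (Suc m) y - u m y)\<bar> \<le> C"
  shows "uniform_limit B u (\<lambda>y. lim (\<lambda>m. u m y)) sequentially"
proof -
  have "\<bar>u (Suc m) y - u m y\<bar> \<le> C * (1/2) ^ m" if "y \<in> B" for m y
    using inc[OF that, of m] unfolding abs_mult by (simp add: field_simps power_divide)
  moreover have "summable (\<lambda>m. C * (1/2::real) ^ m)"
    by (intro summable_mult summable_geometric) simp
  ultimately have "uniform_limit B (\<lambda>n y. \<Sum>m<n. u (Suc m) y - u m y) (\<lambda>y. \<Sum>m. u (Suc m) y - u m y) sequentially"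
    by (intro Weierstrass_m_test) auto
  moreover have "(\<Sum>m<n. u (Suc m) y - u m y) = u n y - u 0 y" for n y
    by (rule sum_lessThan_telescope)
  ultimately have "uniform_limit B (\<lambda>n y. u n y - u 0 y) (\<lambda>y. \<Sum>m. u (Suc m) y - u m y) sequentially"
    by (simp only:)
  moreover have "uniform_limit B (\<lambda>_. u 0) (u 0) sequentially" by (rule uniform_limit_const)
  ultimately have "uniform_limit B (\<lambda>n y. u n y - u 0 y + u 0 y) (\<lambda>y. (\<Sum>m. u (Suc m) y - u m y) + u 0 y) sequentially"
    by (rule uniform_limit_add)
  then
  have *: "uniform_limit B u (\<lambda>y. (\<Sum>m. u (Suc m) y - u m y) + u 0 y) sequentially" by simp
  have eq: "(\<Sum>m. u (Suc m) y - u m y) + u 0 y = lim (\<lambda>m. u m y)" if "y \<in> B" for y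
    using tendsto_uniform_limitI[OF * that] by (rule limI[symmetric])
  show ?thesis
    by (rule iffD1[OF uniform_limit_cong' *]) (simp_all add: eq)
qed

text \<open>Uniform convergence of the partial derivatives is uniform convergence of the derivative
  as a linear map, which is what differentiation of a limit requires.\<close>

lemma has_derivative_uniform_limit:
  fixes u :: "nat \<Rightarrow> real^'d::finite \<Rightarrow> real"
  assumes B: "open B" "convex B"
    and der: "\<And>m y. y \<in> B \<Longrightarrow> (u m has_derivative (\<lambda>v. \<Sum>j\<in>UNIV. v $ j * a m j y)) (at y)"
    and u: "\<And>y. y \<in> B \<Longrightarrow> (\<lambda>m. u m y) \<longlonglongrightarrow> l y"
    and a: "\<And>j. uniform_limit B (\<lambda>m. a m j) (b j) sequentially"
    and y: "y \<in> B"
  shows "(l has_derivative (\<lambda>v. \<Sum>j\<in>UNIV. v $ j * b j y)) (at y)"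
proof -
  have "\<exists>g. \<forall>x\<in>B. (\<lambda>n. u n x) \<longlonglongrightarrow> g x \<and> (g has_derivative (\<lambda>v. \<Sum>j\<in>UNIV. v $ j * b j x)) (at x within B)"
  proof (rule has_derivative_sequence[where f = u and f' = "\<lambda>n x v. \<Sum>j\<in>UNIV. v $ j * a n j x", OF B(2) _ _ y u[OF y]])
    show "(u n has_derivative (\<lambda>v. \<Sum>j\<in>UNIV. v $ j * a n j x)) (at x within B)" if "x \<in> B" for n x
      using der[OF that] by (rule has_derivative_at_withinI)
    fix e :: real assume e: "e > 0"
    \<comment> \<open>An error \<open>e'\<close> in each of the \<open>CARD('d)\<close> partial
      derivatives adds up to \<open>e\<close> in the derivative.\<close>
    define e' where "e' = e / real CARD('d)"
    have e': "e' > 0" using e by (simp add: e'_def)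
    have "\<forall>\<^sub>F n in sequentially. \<forall>j\<in>UNIV. \<forall>x\<in>B. dist (a n j x) (b j x) < e'"
    proof (rule eventually_ball_finite)
      show "\<forall>j\<in>UNIV. \<forall>\<^sub>F n in sequentially. \<forall>x\<in>B. dist (a n j x) (b j x) < e'"
        using a e' by (simp add: uniform_limit_iff)
    qed simp
    then show "\<forall>\<^sub>F n in sequentially. \<forall>x\<in>B. \<forall>h. norm ((\<Sum>j\<in>UNIV. h $ j * a n j x) - (\<Sum>j\<in>UNIV. h $ j * b j x)) \<le> e * norm h"
    proof (eventually_elim, intro ballI allI)
      case (elim n)
      fix x h assume x: "x \<in> B"
      have "norm ((\<Sum>j\<in>UNIV. h $ j * a n j x) - (\<Sum>j\<in>UNIV. h $ j * b j x)) = \<bar>\<Sum>j\<in>UNIV. h $ j * (a n j x - b j x)\<bar>"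
        by (simp add: sum_subtractf right_diff_distrib)
      also have "\<dots> \<le> (\<Sum>j\<in>UNIV. \<bar>h $ j * (a n j x - b j x)\<bar>)" by (rule sum_abs)
      also have "\<dots> \<le> (\<Sum>j\<in>(UNIV::'d set). norm h * e')"
      proof (intro sum_mono)
        fix j
        have "dist (a n j x) (b j x) < e'" using elim x by blast
        then show "\<bar>h $ j * (a n j x - b j x)\<bar> \<le> norm h * e'"
          unfolding abs_mult by (intro mult_mono component_le_norm_cart) (auto simp: dist_real_def)
      qed
      also have "\<dots> = e * norm h" by (simp add: e'_def)
      finally show "norm ((\<Sum>j\<in>UNIV. h $ j * a n j x) - (\<Sum>j\<in>UNIV. h $ j * b j x)) \<le> e * norm h" .
    qed
  qed
  then obtain g where g: "\<And>x. x \<in> B \<Longrightarrow> (\<lambda>n. u n x) \<longlonglongrightarrow> g x"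
    "\<And>x. x \<in> B \<Longrightarrow> (g has_derivative (\<lambda>v. \<Sum>j\<in>UNIV. v $ j * b j x)) (at x within B)" by blast
  have gl: "g x = l x" if "x \<in> B" for x using LIMSEQ_unique[OF g(1) u] that by blast
  have "(g has_derivative (\<lambda>v. \<Sum>j\<in>UNIV. v $ j * b j y)) (at y)"
    using g(2)[OF y] at_within_open[OF y B(1)] by simp
  then show ?thesis
    by (rule has_derivative_transform_within_open[OF _ B(1) y gl])
qed

section \<open>Lower semi-continuous densities of mixtures\<close>

lemma lower_semicontinuous_iff:
  "lower_semicontinuous f \<longleftrightarrow> (\<forall>x y. y < f x \<longrightarrow> (\<forall>\<^sub>F z in at x. y < f z))"
  by (auto simp: lower_semicontinuous_def le_Liminf_iff)

lemma lower_semicontinuous_ennreal: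
  assumes "continuous_on UNIV f"
  shows "lower_semicontinuous (\<lambda>x. ennreal (f x))"
  unfolding lower_semicontinuous_iff
proof (intro allI impI)
  fix x y assume y: "y < ennreal (f x)"
  have "(f \<longlongrightarrow> f x) (at x)" using assms by (simp add: continuous_on_def)
  then have "((\<lambda>z. ennreal (f z)) \<longlongrightarrow> ennreal (f x)) (at x)" by (rule tendsto_ennrealI)
  then show "\<forall>\<^sub>F z in at x. y < ennreal (f z)" using y by (rule order_tendstoD)
qed

text \<open>Fatou's lemma along sequences, which suffice to test the filter \<open>at x\<close> in a
  first countable space. Fatou gives an inequality only, so even continuous integrands yield no more
  than lower semi-continuity here.\<close>

lemma lower_semicontinuous_nn_integral:
  fixes f :: "'a \<Rightarrow> 'b::first_countable_topology \<Rightarrow> ennreal"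
  assumes [measurable]: "\<And>x. (\<lambda>\<omega>. f \<omega> x) \<in> borel_measurable M"
    and lsc: "AE \<omega> in M. lower_semicontinuous (f \<omega>)"
  shows "lower_semicontinuous (\<lambda>x. \<integral>\<^sup>+\<omega>. f \<omega> x \<partial>M)"
  unfolding lower_semicontinuous_iff
proof (intro allI impI sequentially_imp_eventually_within)
  fix x y and xs :: "nat \<Rightarrow> 'b"
  assume y: "y < (\<integral>\<^sup>+\<omega>. f \<omega> x \<partial>M)" and xs: "(\<forall>n. xs n \<in> UNIV \<and> xs n \<noteq> x) \<and> xs \<longlonglongrightarrow> x"
  then have flim: "filterlim xs (at x) sequentially" by (simp add: filterlim_at)
  have "(\<integral>\<^sup>+\<omega>. f \<omega> x \<partial>M) \<le> (\<integral>\<^sup>+\<omega>. liminf (\<lambda>n. f \<omega> (xs n)) \<partial>M)"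
  proof (rule nn_integral_mono_AE)
    show "AE \<omega> in M. f \<omega> x \<le> liminf (\<lambda>n. f \<omega> (xs n))"
      using lsc
    proof eventually_elim
      case (elim \<omega>)
      then show ?case unfolding le_Liminf_iff lower_semicontinuous_iff
        using flim eventually_compose_filterlim by blast
    qed
  qed
  also have "\<dots> \<le> liminf (\<lambda>n. \<integral>\<^sup>+\<omega>. f \<omega> (xs n) \<partial>M)"
    by (rule nn_integral_liminf) measurable
  finally have "y < liminf (\<lambda>n. \<integral>\<^sup>+\<omega>. f \<omega> (xs n) \<partial>M)" using y by simp
  then show "\<forall>\<^sub>F n in sequentially. y < (\<integral>\<^sup>+\<omega>. f \<omega> (xs n) \<partial>M)"
    by (rule less_LiminfD)
qed

text \<open>A series is an integral over the counting measure.\<close>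

lemma lower_semicontinuous_suminf:
  fixes f :: "nat \<Rightarrow> 'b::first_countable_topology \<Rightarrow> ennreal"
  assumes "\<And>n. lower_semicontinuous (f n)"
  shows "lower_semicontinuous (\<lambda>x. \<Sum>n. f n x)"
  using lower_semicontinuous_nn_integral[of f "count_space UNIV"] assms
  by (simp add: nn_integral_count_space_nat)

lemma tendsto_ball_average:
  fixes f :: "'a::euclidean_space \<Rightarrow> real"
  assumes f: "continuous_on UNIV f" "\<And>x. 0 \<le> f x"
  shows "(\<lambda>n. (\<integral>\<^sup>+z. ennreal (f z) * indicator (ball x (1 / Suc n)) z \<partial>lborel) / emeasure lborel (ball x (1 / Suc n)))
     \<longlonglongrightarrow> ennreal (f x)"
proof -
  define A where "A n = (\<integral>\<^sup>+z. ennreal (f z) * indicator (ball x (1 / Suc n)) z \<partial>lborel) / emeasure lborel (ball x (1 / Suc n))" for n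
  have m: "emeasure lborel (ball x (1 / Suc n)) \<noteq> 0" "emeasure lborel (ball x (1 / Suc n)) \<noteq> \<top>" for n
  proof -
    have "0 < measure lborel (ball x (1 / real (Suc n)))" by (intro content_ball_pos) simp
    then show "emeasure lborel (ball x (1 / Suc n)) \<noteq> 0" by (auto simp: measure_def)
    show "emeasure lborel (ball x (1 / Suc n)) \<noteq> \<top>" using emeasure_bounded_finite[OF bounded_ball[of x "1 / Suc n"]] by simp
  qed
  have ev: "\<forall>\<^sub>F n in sequentially. ennreal (f x - e) \<le> A n \<and> A n \<le> ennreal (f x + e)" if e: "e > 0" for e
  proof -
    obtain d where d: "d > 0" "\<And>z. dist z x < d \<Longrightarrow> dist (f z) (f x) < e"
      using f(1) e unfolding continuous_on_iff by (metis UNIV_I)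
    have "\<forall>\<^sub>F n in sequentially. 1 / real (Suc n) < d"
      using order_tendstoD(2)[OF LIMSEQ_Suc[OF lim_1_over_n] d(1)] by simp
    then show ?thesis
    proof eventually_elim
      case (elim n)
      let ?B = "ball x (1 / Suc n)"
      have *: "f x - e \<le> f z" "f z \<le> f x + e" if "z \<in> ?B" for z
        using d(2)[of z] that elim by (auto simp: dist_commute dist_real_def)
      have "(\<integral>\<^sup>+z. ennreal (f x - e) * indicator ?B z \<partial>lborel) \<le> (\<integral>\<^sup>+z. ennreal (f z) * indicator ?B z \<partial>lborel)"
        by (intro nn_integral_mono) (use * in \<open>auto split: split_indicator intro!: ennreal_leI\<close>)
      moreover have "(\<integral>\<^sup>+z. ennreal (f z) * indicator ?B z \<partial>lborel) \<le> (\<integral>\<^sup>+z. ennreal (f x + e) * indicator ?B z \<partial>lborel)"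
        by (intro nn_integral_mono) (use * in \<open>auto split: split_indicator intro!: ennreal_leI\<close>)
      ultimately have "ennreal (f x - e) * emeasure lborel ?B / emeasure lborel ?B \<le> A n"
        "A n \<le> ennreal (f x + e) * emeasure lborel ?B / emeasure lborel ?B"
        unfolding A_def by (auto simp: nn_integral_cmult_indicator intro!: divide_right_mono_ennreal)
      then show ?case using m[of n] by (simp add: ennreal_mult_divide_eq)
    qed
  qed
  have "A \<longlonglongrightarrow> ennreal (f x)"
  proof (rule order_tendstoI)
    fix a assume a: "a < ennreal (f x)"
    then obtain r where r: "a = ennreal r" "0 \<le> r" by (cases a) auto
    then have "r < f x" using a f(2)[of x] by (simp add: ennreal_less_iff)
    then obtain e where "e > 0" "r < f x - e" by (metis diff_gt_0_iff_gt less_diff_eq add.commute dense)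
    from ev[OF this(1)] show "\<forall>\<^sub>F n in sequentially. a < A n"
    proof eventually_elim
      case (elim n)
      have "a < ennreal (f x - e)" using r \<open>r < f x - e\<close> by (simp add: ennreal_less_iff)
      then show ?case using elim by (blast intro: less_le_trans)
    qed
  next
    fix a assume a: "ennreal (f x) < a"
    then obtain r where r: "ennreal (f x) < ennreal r" "ennreal r < a" "0 \<le> r"
      by (metis dense ennreal_cases less_top order_less_trans top.extremum_strict)
    then have "f x < r" using f(2)[of x] by (simp add: ennreal_less_iff)
    then have "r - f x > 0" by simp
    from ev[OF this] show "\<forall>\<^sub>F n in sequentially. A n < a"
    proof eventually_elim
      case (elim n)
      then show ?case using r by (auto elim: le_less_trans)
    qed
  qed
  then show ?thesis unfolding A_def .
qed

text \<open>
  The density of each fibre is continuous, hence the limit of its averages over balls; this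
  recovers it as a jointly measurable function of the fibre and the point.
\<close>

theorem mixture_lower_semicontinuous_density:
  fixes V :: "'a \<Rightarrow> 'b::euclidean_space \<Rightarrow> real" and G :: "'a \<Rightarrow> 'b \<Rightarrow> 'c::euclidean_space"
  assumes "sigma_finite_measure M"
    and V[measurable]: "case_prod V \<in> borel_measurable (M \<Otimes>\<^sub>M borel)"
    and G[measurable]: "case_prod G \<in> borel_measurable (M \<Otimes>\<^sub>M borel)"
    and dens: "AE \<omega> in M. \<exists>f. pushforward_density (V \<omega>) (G \<omega>) f"
  shows "\<exists>g. g \<in> borel_measurable borel \<and> lower_semicontinuous g \<and> (\<forall>A\<in>sets borel.
     (\<integral>\<^sup>+\<omega>. (\<integral>\<^sup>+y. ennreal (V \<omega> y) * indicator A (G \<omega> y) \<partial>lborel) \<partial>M) = (\<integral>\<^sup>+x. g x * indicator A x \<partial>lborel))"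
proof -
  interpret M: sigma_finite_measure M by fact
  define h where "h \<omega> x n = (\<integral>\<^sup>+y. ennreal (V \<omega> y) * indicator (ball x (1 / Suc n)) (G \<omega> y) \<partial>lborel) / emeasure lborel (ball x (1 / Suc n))" for \<omega> x and n :: nat
  \<comment> \<open>The \<open>liminf\<close> makes sense at every \<omega>, so joint measurability
    needs no removal of the exceptional set on which there is no continuous density.\<close>
  define f where "f \<omega> x = liminf (\<lambda>n. h \<omega> x n)" for \<omega> x
  have hm: "(\<lambda>(\<omega>, x). h \<omega> x n) \<in> borel_measurable (M \<Otimes>\<^sub>M borel)" for n
  proof -
    have 1: "(\<lambda>((\<omega>, x), y). V \<omega> y) \<in> borel_measurable ((M \<Otimes>\<^sub>M (borel :: 'c measure)) \<Otimes>\<^sub>M lborel)"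
      using measurable_compose[OF _ V, of "\<lambda>((\<omega>, x), y). (\<omega>, y)" "(M \<Otimes>\<^sub>M (borel :: 'c measure)) \<Otimes>\<^sub>M lborel"]
      by (simp add: split_beta')
    have 2: "(\<lambda>((\<omega>, x), y). G \<omega> y) \<in> borel_measurable ((M \<Otimes>\<^sub>M (borel :: 'c measure)) \<Otimes>\<^sub>M lborel)"
      using measurable_compose[OF _ G, of "\<lambda>((\<omega>, x), y). (\<omega>, y)" "(M \<Otimes>\<^sub>M (borel :: 'c measure)) \<Otimes>\<^sub>M lborel"]
      by (simp add: split_beta')
    have 3: "(\<lambda>(z, y). ennreal (V (fst z) y) * (if dist (snd z) (G (fst z) y) < 1 / Suc n then 1 else 0)) \<in> borel_measurable ((M \<Otimes>\<^sub>M (borel :: 'c measure)) \<Otimes>\<^sub>M lborel)"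
      using 1 2 unfolding split_beta' by measurable
    have eq: "(if dist x z < r then 1 else 0) = (indicator (ball x r) z :: ennreal)" for x z :: 'c and r
      by (simp add: indicator_def)
    \<comment> \<open>By translation invariance the denominator does not depend on \<open>x\<close>,
      so only the numerator needs an argument for joint measurability.\<close>
    have vol: "emeasure lborel (ball x r) = emeasure lborel (ball (0::'c) r)" for x :: 'c and r
    proof -
      have "emeasure lborel (ball x r) = emeasure (distr lborel borel ((+) x)) (ball x r)"
        by (simp add: lborel_distr_plus)
      also have "\<dots> = emeasure lborel ((+) x -` ball x r)" by (simp add: emeasure_distr)
      also have "(+) x -` ball x r = ball 0 r" by (auto simp: dist_norm)
      finally show ?thesis .
    qed
    have "(\<lambda>z. (\<integral>\<^sup>+y. ennreal (V (fst z) y) * (if dist (snd z) (G (fst z) y) < 1 / Suc n then 1 else 0) \<partial>lborel) /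
        emeasure lborel (ball (0::'c) (1 / Suc n))) \<in> borel_measurable (M \<Otimes>\<^sub>M (borel :: 'c measure))"
      using lborel.borel_measurable_nn_integral[OF 3] by measurable
    also have "(\<lambda>z. (\<integral>\<^sup>+y. ennreal (V (fst z) y) * (if dist (snd z) (G (fst z) y) < 1 / Suc n then 1 else 0) \<partial>lborel) /
        emeasure lborel (ball (0::'c) (1 / Suc n))) = (\<lambda>(\<omega>, x). h \<omega> x n)"
      (is "?l = ?r")
    proof
      show "?l z = ?r z" for z by (simp add: h_def eq split_beta vol[of "snd z"] del: of_nat_Suc)
    qed
    finally show ?thesis .
  qed
  have fm[measurable]: "case_prod f \<in> borel_measurable (M \<Otimes>\<^sub>M borel)"
  proof -
    have "(\<lambda>z. liminf (\<lambda>n. case z of (\<omega>, x) \<Rightarrow> h \<omega> x n)) \<in> borel_measurable (M \<Otimes>\<^sub>M borel)"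
      using hm by (rule borel_measurable_liminf)
    then show ?thesis by (simp add: f_def split_beta')
  qed
  have good: "AE \<omega> in M. \<exists>c. pushforward_density (V \<omega>) (G \<omega>) c \<and> f \<omega> = (\<lambda>x. ennreal (c x))"
    using dens
  proof eventually_elim
    case (elim \<omega>)
    then obtain c where c: "pushforward_density (V \<omega>) (G \<omega>) c" by blast
    have "(\<lambda>n. h \<omega> x n) \<longlonglongrightarrow> ennreal (c x)" for x
    proof -
      have "h \<omega> x n = (\<integral>\<^sup>+z. ennreal (c z) * indicator (ball x (1 / Suc n)) z \<partial>lborel) / emeasure lborel (ball x (1 / Suc n))" for n
        using c by (simp add: h_def pushforward_density_def)
      then show ?thesis using tendsto_ball_average[of c x] c by (simp add: pushforward_density_def)
    qed
    then have "f \<omega> = (\<lambda>x. ennreal (c x))"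
      unfolding f_def by (intro ext lim_imp_Liminf) auto
    with c show ?case by blast
  qed
  define g where "g x = (\<integral>\<^sup>+\<omega>. f \<omega> x \<partial>M)" for x
  have "g \<in> borel_measurable borel"
  proof -
    have "(\<lambda>(x, \<omega>). f \<omega> x) \<in> borel_measurable (borel \<Otimes>\<^sub>M M)"
      using measurable_pair_swap[OF fm] by (simp add: split_beta')
    then show ?thesis unfolding g_def by (rule M.borel_measurable_nn_integral)
  qed
  moreover have "lower_semicontinuous g"
    unfolding g_def
  proof (rule lower_semicontinuous_nn_integral)
    show "(\<lambda>\<omega>. f \<omega> x) \<in> borel_measurable M" for x by measurable
    show "AE \<omega> in M. lower_semicontinuous (f \<omega>)"
      using good by eventually_elim (auto simp: pushforward_density_def intro!: lower_semicontinuous_ennreal)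
  qed
  moreover have "(\<integral>\<^sup>+\<omega>. (\<integral>\<^sup>+y. ennreal (V \<omega> y) * indicator A (G \<omega> y) \<partial>lborel) \<partial>M) = (\<integral>\<^sup>+x. g x * indicator A x \<partial>lborel)"
    if A[measurable]: "A \<in> sets borel" for A
  proof -
    interpret P': pair_sigma_finite M "lborel :: 'c measure" ..
    have "(\<integral>\<^sup>+\<omega>. (\<integral>\<^sup>+y. ennreal (V \<omega> y) * indicator A (G \<omega> y) \<partial>lborel) \<partial>M) = (\<integral>\<^sup>+\<omega>. (\<integral>\<^sup>+x. f \<omega> x * indicator A x \<partial>lborel) \<partial>M)"
    proof (rule nn_integral_cong_AE)
      show "AE \<omega> in M. (\<integral>\<^sup>+y. ennreal (V \<omega> y) * indicator A (G \<omega> y) \<partial>lborel) = (\<integral>\<^sup>+x. f \<omega> x * indicator A x \<partial>lborel)"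
        using good by eventually_elim (auto simp: pushforward_density_def A)
    qed
    also have "\<dots> = (\<integral>\<^sup>+x. (\<integral>\<^sup>+\<omega>. f \<omega> x * indicator A x \<partial>M) \<partial>lborel)"
      by (rule P'.Fubini'[symmetric]) measurable
    also have "\<dots> = (\<integral>\<^sup>+x. g x * indicator A x \<partial>lborel)"
      unfolding g_def by (intro nn_integral_cong nn_integral_multc) measurable
    finally show ?thesis .
  qed
  ultimately show ?thesis by (intro exI[of _ g]) blast
qed

section \<open>Shifted Brownian paths and Girsanov weights\<close>

abbreviation path_measure :: "('n \<times> real \<Rightarrow> real) measure" where
  "path_measure \<equiv> (\<Pi>\<^sub>M z\<in>UNIV \<times> {0..1}. borel)"

text \<open>
  \<open>shifted_path W J y \<omega>\<close> is the path of \<open>W\<close> translated by \<open>\<Sum>\<^sub>j y\<^sub>j h\<^sub>j\<close>, where \<open>h\<^sub>j\<close> is the Cameron--Martin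
  path with derivative \<open>1\<^bsub>(0,b]\<^esub>\<close> in the \<open>k\<close>-th component for \<open>J j = (k, b)\<close>;
  \<open>shift_weight\<close> is the corresponding Girsanov density.
\<close>

definition overlap :: "'n \<times> real \<Rightarrow> 'n \<times> real \<Rightarrow> real" where
  "overlap z z' = (if fst z = fst z' then min (snd z) (snd z') else 0)"

definition shifted_path ::
  "('n \<Rightarrow> real \<Rightarrow> 'a \<Rightarrow> real) \<Rightarrow> ('d \<Rightarrow> 'n \<times> real) \<Rightarrow> real^'d::finite \<Rightarrow> 'a \<Rightarrow> 'n \<times> real \<Rightarrow> real" where
  "shifted_path W J y \<omega> = (\<lambda>z\<in>UNIV \<times> {0..1}.
     W (fst z) (snd z) \<omega> - W (fst z) 0 \<omega> + (\<Sum>j\<in>UNIV. y $ j * overlap (J j) z))"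

definition shift_weight ::
  "('n \<Rightarrow> real \<Rightarrow> 'a \<Rightarrow> real) \<Rightarrow> ('d \<Rightarrow> 'n \<times> real) \<Rightarrow> real^'d::finite \<Rightarrow> 'a \<Rightarrow> real" where
  "shift_weight W J y \<omega> = exp (- (\<Sum>j\<in>UNIV. y $ j * (W (fst (J j)) (snd (J j)) \<omega> - W (fst (J j)) 0 \<omega>))
     - (\<Sum>i\<in>UNIV. \<Sum>j\<in>UNIV. y $ i * y $ j * overlap (J i) (J j)) / 2)"

text \<open>Completing the square: the exponential weight moves the mean of the Gaussian by
  \<open>- s * \<sigma>\<^sup>2\<close>, and the translation of the argument moves it back. This is
  the Cameron-Martin formula in dimension one.\<close>

lemma normal_density_shift:
  assumes \<sigma>: "0 < \<sigma>" and A[measurable]: "A \<in> sets borel"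
  shows "(\<integral>\<^sup>+x. ennreal (exp (- s * x - s\<^sup>2 * \<sigma>\<^sup>2 / 2)) * indicator A (x + s * \<sigma>\<^sup>2) \<partial>density lborel (\<lambda>x. ennreal (normal_density 0 \<sigma> x)))
    = emeasure (density lborel (\<lambda>x. ennreal (normal_density 0 \<sigma> x))) A"
proof -
  have eq: "normal_density 0 \<sigma> x * exp (- s * x - s\<^sup>2 * \<sigma>\<^sup>2 / 2) = normal_density 0 \<sigma> (s * \<sigma>\<^sup>2 + 1 * x)" for x
  proof -
    have "- x\<^sup>2 / (2 * \<sigma>\<^sup>2) + (- s * x - s\<^sup>2 * \<sigma>\<^sup>2 / 2) = - (s * \<sigma>\<^sup>2 + x)\<^sup>2 / (2 * \<sigma>\<^sup>2)"
      using \<sigma> by (simp add: field_simps power2_eq_square)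
    then show ?thesis
      by (simp add: normal_density_def exp_add[symmetric])
  qed
  have "(\<integral>\<^sup>+x. ennreal (exp (- s * x - s\<^sup>2 * \<sigma>\<^sup>2 / 2)) * indicator A (x + s * \<sigma>\<^sup>2) \<partial>density lborel (\<lambda>x. ennreal (normal_density 0 \<sigma> x)))
    = (\<integral>\<^sup>+x. ennreal (normal_density 0 \<sigma> (s * \<sigma>\<^sup>2 + 1 * x)) * indicator A (s * \<sigma>\<^sup>2 + 1 * x) \<partial>lborel)"
  proof (subst nn_integral_density)
    show "(\<integral>\<^sup>+x. ennreal (normal_density 0 \<sigma> x) * (ennreal (exp (- s * x - s\<^sup>2 * \<sigma>\<^sup>2 / 2)) * indicator A (x + s * \<sigma>\<^sup>2)) \<partial>lborel)
      = (\<integral>\<^sup>+x. ennreal (normal_density 0 \<sigma> (s * \<sigma>\<^sup>2 + 1 * x)) * indicator A (s * \<sigma>\<^sup>2 + 1 * x) \<partial>lborel)"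
      unfolding mult.assoc[symmetric] ennreal_mult'[OF normal_density_nonneg, symmetric] eq by (simp add: add.commute)
  qed auto
  also have "\<dots> = (\<integral>\<^sup>+x. ennreal (normal_density 0 \<sigma> x) * indicator A x \<partial>lborel)"
    by (subst nn_integral_real_affine[where c = 1 and t = "s * \<sigma>\<^sup>2"]) auto
  also have "\<dots> = emeasure (density lborel (\<lambda>x. ennreal (normal_density 0 \<sigma> x))) A"
    by (simp add: emeasure_density)
  finally show ?thesis .
qed

text \<open>Independence turns the joint law into a product measure, on which weight and translation
  both factorise. It is therefore enough to compare measures of rectangles, where
  \<open>normal_density_shift\<close> applies factor by factor.\<close>

lemma (in prob_space) independent_normal_shift:
  fixes \<xi> :: "'c \<Rightarrow> 'a \<Rightarrow> real"
  assumes C: "finite C" "C \<noteq> {}"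
    and indep: "indep_vars (\<lambda>_. borel) \<xi> C"
    and \<sigma>: "\<And>c. c \<in> C \<Longrightarrow> 0 < \<sigma> c"
    and normal: "\<And>c. c \<in> C \<Longrightarrow> distributed M lborel (\<xi> c) (\<lambda>x. ennreal (normal_density 0 (\<sigma> c) x))"
    and \<Phi>[measurable]: "\<Phi> \<in> borel_measurable (\<Pi>\<^sub>M c\<in>C. borel)"
  shows "(\<integral>\<^sup>+\<omega>. ennreal (\<Prod>c\<in>C. exp (- s c * \<xi> c \<omega> - (s c)\<^sup>2 * (\<sigma> c)\<^sup>2 / 2)) * \<Phi> (\<lambda>c\<in>C. \<xi> c \<omega> + s c * (\<sigma> c)\<^sup>2) \<partial>M)
    = (\<integral>\<^sup>+\<omega>. \<Phi> (\<lambda>c\<in>C. \<xi> c \<omega>) \<partial>M)"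
proof -
  \<comment> \<open>The product measure construction wants a probability measure at every index,
    hence the Dirac mass outside \<open>C\<close>.\<close>
  define N where "N c = (if c \<in> C then density lborel (\<lambda>x. ennreal (normal_density 0 (\<sigma> c) x)) else return borel 0)" for c
  have Nprob: "prob_space (N c)" for c
    using \<sigma> by (auto simp: N_def intro!: prob_space_normal_density prob_space_return)
  interpret N: product_prob_space N C
    by (rule product_prob_spaceI) (rule Nprob)
  interpret N': product_sigma_finite N ..
  have setsN[simp, measurable_cong]: "sets (N c) = sets borel" for c by (simp add: N_def)
  have setsP[measurable_cong]: "sets (Pi\<^sub>M C N) = sets (\<Pi>\<^sub>M c\<in>C. borel)" by (intro sets_PiM_cong) simp_all
  have \<xi>m[measurable]: "\<xi> c \<in> borel_measurable M" if "c \<in> C" for c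
    using normal[OF that] by (simp add: distributed_def)
  have law: "distr M (\<Pi>\<^sub>M c\<in>C. borel) (\<lambda>\<omega>. \<lambda>c\<in>C. \<xi> c \<omega>) = Pi\<^sub>M C N"
  proof -
    have "distr M (\<Pi>\<^sub>M c\<in>C. borel) (\<lambda>\<omega>. \<lambda>c\<in>C. \<xi> c \<omega>) = (\<Pi>\<^sub>M c\<in>C. distr M borel (\<xi> c))"
      using indep by (subst (asm) indep_vars_iff_distr_eq_PiM'[OF C(2)]) auto
    also have "\<dots> = Pi\<^sub>M C N"
    proof (intro PiM_cong refl)
      fix c assume c: "c \<in> C"
      have "distr M borel (\<xi> c) = distr M lborel (\<xi> c)" by (rule distr_cong) auto
      then show "distr M borel (\<xi> c) = N c" using normal[OF c] c by (simp add: distributed_def N_def)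
    qed
    finally show ?thesis .
  qed
  have [measurable]: "(\<lambda>\<omega>. \<lambda>c\<in>C. \<xi> c \<omega>) \<in> measurable M (\<Pi>\<^sub>M c\<in>C. borel)"
    by (intro measurable_restrict) auto
  define w where "w x = ennreal (\<Prod>c\<in>C. exp (- s c * x c - (s c)\<^sup>2 * (\<sigma> c)\<^sup>2 / 2))" for x
  define sh where "sh x = (\<lambda>c\<in>C. x c + s c * (\<sigma> c)\<^sup>2)" for x
  have wm[measurable]: "w \<in> borel_measurable (\<Pi>\<^sub>M c\<in>C. borel)"
    unfolding w_def by measurable
  have shm[measurable]: "sh \<in> measurable (\<Pi>\<^sub>M c\<in>C. borel) (\<Pi>\<^sub>M c\<in>C. borel)"
    unfolding sh_def by measurable
  have shift: "distr (density (Pi\<^sub>M C N) w) (\<Pi>\<^sub>M c\<in>C. borel) sh = Pi\<^sub>M C N"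
  proof (rule N.PiM_eqI)
    show "sets (distr (density (Pi\<^sub>M C N) w) (\<Pi>\<^sub>M c\<in>C. borel) sh) = sets (Pi\<^sub>M C N)" by (simp add: setsP)
    fix A assume "\<And>i. i \<in> C \<Longrightarrow> A i \<in> sets (N i)"
    then have A[measurable]: "\<And>i. i \<in> C \<Longrightarrow> A i \<in> sets borel" by simp
    have AE[measurable]: "Pi\<^sub>E C A \<in> sets (\<Pi>\<^sub>M c\<in>C. borel)" using C A by (intro sets_PiM_I_finite) auto
    have "emeasure (distr (density (Pi\<^sub>M C N) w) (\<Pi>\<^sub>M c\<in>C. borel) sh) (Pi\<^sub>E C A)
      = (\<integral>\<^sup>+x. indicator (Pi\<^sub>E C A) x \<partial>distr (density (Pi\<^sub>M C N) w) (\<Pi>\<^sub>M c\<in>C. borel) sh)"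
      by simp
    also have "\<dots> = (\<integral>\<^sup>+x. indicator (Pi\<^sub>E C A) (sh x) \<partial>density (Pi\<^sub>M C N) w)"
      by (subst nn_integral_distr) auto
    also have "\<dots> = (\<integral>\<^sup>+x. w x * indicator (Pi\<^sub>E C A) (sh x) \<partial>Pi\<^sub>M C N)"
      by (subst nn_integral_density) auto
    also have "\<dots> = (\<integral>\<^sup>+x. (\<Prod>c\<in>C. ennreal (exp (- s c * x c - (s c)\<^sup>2 * (\<sigma> c)\<^sup>2 / 2)) * indicator (A c) (x c + s c * (\<sigma> c)\<^sup>2)) \<partial>Pi\<^sub>M C N)"
    proof (intro nn_integral_cong)
      fix x
      have "indicator (Pi\<^sub>E C A) (sh x) = (\<Prod>c\<in>C. indicator (A c) (x c + s c * (\<sigma> c)\<^sup>2) :: ennreal)"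
      proof (cases "\<forall>c\<in>C. x c + s c * (\<sigma> c)\<^sup>2 \<in> A c")
        case True
        then show ?thesis by (simp add: sh_def indicator_def PiE_iff)
      next
        case False
        then obtain c where c: "c \<in> C" "x c + s c * (\<sigma> c)\<^sup>2 \<notin> A c" by blast
        then have "(\<Prod>c\<in>C. indicator (A c) (x c + s c * (\<sigma> c)\<^sup>2) :: ennreal) = 0"
          using C(1) by (intro prod_zero bexI[of _ c]) auto
        moreover have "sh x \<notin> Pi\<^sub>E C A" using c by (auto simp: sh_def PiE_iff)
        ultimately show ?thesis by simp
      qed
      moreover have "w x = (\<Prod>c\<in>C. ennreal (exp (- s c * x c - (s c)\<^sup>2 * (\<sigma> c)\<^sup>2 / 2)))"
        unfolding w_def by (rule prod_ennreal[symmetric]) simp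
      ultimately show "w x * indicator (Pi\<^sub>E C A) (sh x) =
        (\<Prod>c\<in>C. ennreal (exp (- s c * x c - (s c)\<^sup>2 * (\<sigma> c)\<^sup>2 / 2)) * indicator (A c) (x c + s c * (\<sigma> c)\<^sup>2))"
        by (simp add: prod.distrib)
    qed
    also have "\<dots> = (\<Prod>c\<in>C. \<integral>\<^sup>+x. ennreal (exp (- s c * x - (s c)\<^sup>2 * (\<sigma> c)\<^sup>2 / 2)) * indicator (A c) (x + s c * (\<sigma> c)\<^sup>2) \<partial>N c)"
      by (rule N.product_nn_integral_prod[OF C(1)]) measurable
    also have "\<dots> = (\<Prod>c\<in>C. emeasure (N c) (A c))"
    proof (intro prod.cong refl)
      fix c assume c: "c \<in> C"
      show "(\<integral>\<^sup>+x. ennreal (exp (- s c * x - (s c)\<^sup>2 * (\<sigma> c)\<^sup>2 / 2)) * indicator (A c) (x + s c * (\<sigma> c)\<^sup>2) \<partial>N c) = emeasure (N c) (A c)"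
        using normal_density_shift[OF \<sigma>[OF c] A[OF c], of "s c"] c by (simp add: N_def)
    qed
    finally show "emeasure (distr (density (Pi\<^sub>M C N) w) (\<Pi>\<^sub>M c\<in>C. borel) sh) (Pi\<^sub>E C A) = (\<Prod>i\<in>C. emeasure (N i) (A i))" .
  qed (rule C)
  have "(\<integral>\<^sup>+\<omega>. ennreal (\<Prod>c\<in>C. exp (- s c * \<xi> c \<omega> - (s c)\<^sup>2 * (\<sigma> c)\<^sup>2 / 2)) * \<Phi> (\<lambda>c\<in>C. \<xi> c \<omega> + s c * (\<sigma> c)\<^sup>2) \<partial>M)
      = (\<integral>\<^sup>+\<omega>. w (\<lambda>c\<in>C. \<xi> c \<omega>) * \<Phi> (sh (\<lambda>c\<in>C. \<xi> c \<omega>)) \<partial>M)"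
    unfolding w_def sh_def by (intro nn_integral_cong arg_cong2[where f = "(*)"] arg_cong[where f = \<Phi>] arg_cong[where f = ennreal] prod.cong) auto
  also have "\<dots> = (\<integral>\<^sup>+x. w x * \<Phi> (sh x) \<partial>Pi\<^sub>M C N)"
    unfolding law[symmetric] by (subst nn_integral_distr) auto
  also have "\<dots> = (\<integral>\<^sup>+x. \<Phi> x \<partial>distr (density (Pi\<^sub>M C N) w) (\<Pi>\<^sub>M c\<in>C. borel) sh)"
    by (subst nn_integral_distr) (auto simp: nn_integral_density)
  also have "\<dots> = (\<integral>\<^sup>+x. \<Phi> x \<partial>Pi\<^sub>M C N)" by (simp add: shift)
  also have "\<dots> = (\<integral>\<^sup>+\<omega>. \<Phi> (\<lambda>c\<in>C. \<xi> c \<omega>) \<partial>M)"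
    unfolding law[symmetric] by (subst nn_integral_distr) auto
  finally show ?thesis .
qed

text \<open>Selecting increments by \<open>of_bool\<close> keeps the index range the same for all
  \<open>b\<close>, so that path values at different times become linear functions of one common
  family of increments.\<close>

lemma sum_grid_telescope:
  fixes g :: "real \<Rightarrow> real"
  assumes t: "strict_mono_on {..m} t" and b: "b \<in> t ` {..m}"
  shows "(\<Sum>i<m. of_bool (t (Suc i) \<le> b) * (g (t (Suc i)) - g (t i))) = g b - g (t 0)"
proof -
  obtain e where e: "e \<le> m" "b = t e" using b by auto
  have iff: "t (Suc i) \<le> b \<longleftrightarrow> i < e" if "i < m" for i
    using strict_mono_on_leD[OF t] strict_mono_onD[OF t] e that
    by (metis Suc_leI atMost_iff leD linorder_not_less less_Suc_eq_le)
  have "(\<Sum>i<m. of_bool (t (Suc i) \<le> b) * (g (t (Suc i)) - g (t i))) = (\<Sum>i\<in>{..<m}. if i \<in> {..<e} then g (t (Suc i)) - g (t i) else 0)"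
    using iff by (intro sum.cong) auto
  also have "\<dots> = (\<Sum>i<e. g (t (Suc i)) - g (t i))"
    using e by (subst sum.inter_restrict[symmetric]) (auto intro!: sum.cong)
  also have "\<dots> = g b - g (t 0)" using sum_lessThan_telescope[of "\<lambda>i. g (t i)" e] e by simp
  finally show ?thesis .
qed

text \<open>List \<open>T\<close> in increasing order. The first element is 0 since \<open>T\<close>
  lies in the unit interval, and the presence of both 0 and 1 guarantees at least one grid
  cell.\<close>

lemma ex_increasing_grid:
  fixes T :: "real set"
  assumes T: "finite T" "0 \<in> T" "1 \<in> T" "T \<subseteq> {0..1}"
  obtains m :: nat and t :: "nat \<Rightarrow> real" where "0 < m" "strict_mono_on {..m} t" "t ` {..m} = T" "t 0 = 0"
proof -
  obtain h where h: "bij_betw h {..<card T} T" "strict_mono_on {..<card T} h"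
  proof
    let ?h = "\<lambda>i. sorted_list_of_set T ! i"
    show "bij_betw ?h {..<card T} T"
      using bij_betw_nth[of "sorted_list_of_set T" "{..<card T}" T] T(1) by simp
    show "strict_mono_on {..<card T} ?h"
      using T(1) sorted_wrt_nth_less[OF strict_sorted_list_of_set] by (intro strict_mono_onI) simp
  qed
  have c: "1 < card T"
  proof -
    have "card {0::real, 1} \<le> card T" using T by (intro card_mono) auto
    then show ?thesis by simp
  qed
  have eq: "{..card T - Suc 0} = {..<card T}" using c by auto
  have "h 0 \<in> T" using h(1) c by (auto simp: bij_betw_def)
  moreover obtain e where "e < card T" "h e = 0" using h(1) T(2) by (metis (no_types, lifting) bij_betw_def imageE lessThan_iff)
  ultimately have "h 0 = 0"
    using strict_mono_on_leD[OF h(2), of 0 e] T(4) c by fastforce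
  with h c show ?thesis by (intro that[of "card T - 1" h]) (auto simp: eq bij_betw_def)
qed

lemma borel_measurable_snd_nth: "(\<lambda>x. snd x $ j :: real) \<in> borel_measurable (M \<Otimes>\<^sub>M borel)"
proof -
  have "(\<lambda>y. y $ j :: real) \<in> borel_measurable borel"
    by (intro borel_measurable_continuous_onI continuous_intros)
  from measurable_compose[OF measurable_snd this] show ?thesis .
qed

locale brownian =
  fixes M :: "'a measure" and W :: "'n::finite \<Rightarrow> real \<Rightarrow> 'a \<Rightarrow> real"
  assumes bm: "brownian_motion M W"

sublocale brownian \<subseteq> prob_space M
  using bm by (simp add: brownian_motion_def)

context brownian
begin

lemma W_measurable [measurable]: "t \<in> {0..1} \<Longrightarrow> W k t \<in> borel_measurable M"
  using bm by (simp add: brownian_motion_def)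

lemma W_measurable_fst: "t \<in> {0..1} \<Longrightarrow> (\<lambda>x. W k t (fst x)) \<in> borel_measurable (M \<Otimes>\<^sub>M N)"
  by (rule measurable_compose[OF measurable_fst W_measurable])

lemma shifted_path_measurable:
  "(\<lambda>(\<omega>, y). shifted_path W J y \<omega>) \<in> measurable (M \<Otimes>\<^sub>M borel) path_measure"
  unfolding shifted_path_def split_beta'
  by (intro measurable_restrict borel_measurable_add borel_measurable_diff borel_measurable_sum
    borel_measurable_times W_measurable_fst borel_measurable_snd_nth borel_measurable_const) auto

lemma shifted_path_measurable' [measurable]: "shifted_path W J y \<in> measurable M path_measure"
  using measurable_compose[OF _ shifted_path_measurable[of J], of "\<lambda>\<omega>. (\<omega>, y)" M] by simp

lemma shift_weight_measurable:
  assumes "\<And>j. snd (J j) \<in> {0..1}"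
  shows "(\<lambda>(\<omega>, y). shift_weight W J y \<omega>) \<in> borel_measurable (M \<Otimes>\<^sub>M borel)"
  unfolding shift_weight_def split_beta' using assms
  by (intro measurable_compose[OF _ borel_measurable_exp] borel_measurable_diff borel_measurable_uminus
    borel_measurable_sum borel_measurable_times borel_measurable_divide W_measurable_fst
    borel_measurable_snd_nth borel_measurable_const) auto

lemma shift_weight_measurable':
  assumes "\<And>j. snd (J j) \<in> {0..1}"
  shows "shift_weight W J y \<in> borel_measurable M"
  using measurable_compose[OF _ shift_weight_measurable[OF assms], of "\<lambda>\<omega>. (\<omega>, y)" M] by simp

text \<open>Cameron-Martin theorem. A finite measure on path space is determined by its
  finite-dimensional marginals, and each marginal is a function of finitely many independent
  Gaussian increments, to which \<open>independent_normal_shift\<close> applies. Paths are taken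
  relative to \<open>W k 0\<close>, so the identities between path values and increments hold at
  every sample point.\<close>

theorem distr_shifted_path:
  assumes J: "\<And>j. snd (J j) \<in> {0..1}"
  shows "distr (density M (\<lambda>\<omega>. ennreal (shift_weight W J y \<omega>))) path_measure (shifted_path W J y)
    = distr M path_measure (shifted_path W J 0)"
proof (rule measure_eqI_PiM_infinite[symmetric])
  note [measurable] = shift_weight_measurable'[OF J]
  show "finite_measure (distr M path_measure (shifted_path W J 0))"
    by (intro prob_space.finite_measure prob_space_distr shifted_path_measurable')
  fix A :: "'n \<times> real \<Rightarrow> real set" and L
  assume L: "finite L" "L \<subseteq> UNIV \<times> {0..1}" and A: "\<And>i. i \<in> L \<Longrightarrow> A i \<in> sets borel"
  \<comment> \<open>The grid contains the times of the marginal and the end points of all shift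
    directions, so that the derivative of the shift is constant on each grid cell.\<close>
  define T where "T = {0, 1} \<union> snd ` L \<union> range (snd \<circ> J)"
  have "finite T" "0 \<in> T" "1 \<in> T" "T \<subseteq> {0..1}" using L J by (auto simp: T_def image_subset_iff)
  then obtain m :: nat and t :: "nat \<Rightarrow> real" where m: "0 < m" and t: "strict_mono_on {..m} t" "t ` {..m} = T" "t 0 = 0"
    by (rule ex_increasing_grid)
  define C where "C = (UNIV :: 'n set) \<times> {..<m}"
  have C: "finite C" "C \<noteq> {}" using m by (auto simp: C_def)
  define \<xi> where "\<xi> = (\<lambda>(k, i) \<omega>. W k (t (Suc i)) \<omega> - W k (t i) \<omega>)"
  define \<sigma> where "\<sigma> = (\<lambda>(k :: 'n, i). sqrt (t (Suc i) - t i))"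
  have tT: "t i \<in> {0..1}" if "i \<le> m" for i using that t(2) \<open>T \<subseteq> {0..1}\<close> by blast
  have tless: "t i < t (Suc i)" if "i < m" for i using t(1) that by (auto simp: strict_mono_on_def)
  have \<sigma>: "0 < \<sigma> c" "(\<sigma> c)\<^sup>2 = t (Suc (snd c)) - t (snd c)" if "c \<in> C" for c
    using that tless[of "snd c"] by (auto simp: C_def \<sigma>_def split_beta)
  have indep: "indep_vars (\<lambda>_. borel) \<xi> C"
    using bm t \<open>T \<subseteq> {0..1}\<close> unfolding \<xi>_def C_def brownian_motion_def by blast
  have normal: "distributed M lborel (\<xi> c) (\<lambda>x. ennreal (normal_density 0 (\<sigma> c) x))" if "c \<in> C" for c
  proof -
    obtain k i where c: "c = (k, i)" "i < m" using \<open>c \<in> C\<close> by (auto simp: C_def)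
    then show ?thesis using bm tless[of i] tT[of i] tT[of "Suc i"]
      by (simp add: brownian_motion_def \<xi>_def \<sigma>_def)
  qed
  \<comment> \<open>The value on grid cell \<open>(k, i)\<close> of the derivative of the shift;
    times the cell length \<open>(\<sigma> c)\<^sup>2\<close> it is the increment of the
    shift.\<close>
  define s where "s = (\<lambda>(k, i). \<Sum>j\<in>UNIV. y $ j * (of_bool (fst (J j) = k) * of_bool (t (Suc i) \<le> snd (J j))))"
  \<comment> \<open>Rebuilds the path value at \<open>z\<close> from the increments; fed with
    translated increments it returns the shifted path.\<close>
  define R where "R x z = (\<Sum>i<m. of_bool (t (Suc i) \<le> snd z) * x (fst z, i))" for x :: "'n \<times> nat \<Rightarrow> real" and z :: "'n \<times> real"
  define \<Phi> where "\<Phi> x = (\<Prod>z\<in>L. indicator (A z) (R x z) :: ennreal)" for x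
  have Rm: "(\<lambda>x. R x z) \<in> borel_measurable (\<Pi>\<^sub>M c\<in>C. borel)" for z
    unfolding R_def by (intro borel_measurable_sum borel_measurable_times measurable_component_singleton) (auto simp: C_def)
  have \<Phi>m: "\<Phi> \<in> borel_measurable (\<Pi>\<^sub>M c\<in>C. borel)"
    unfolding \<Phi>_def
  proof (intro borel_measurable_prod_ennreal)
    fix z assume "z \<in> L"
    then have "indicator (A z) \<in> borel_measurable borel" using A by simp
    from measurable_compose[OF Rm this]
    show "(\<lambda>x. indicator (A z) (R x z) :: ennreal) \<in> borel_measurable (\<Pi>\<^sub>M c\<in>C. borel)" .
  qed
  \<comment> \<open>The inner product of the indicators of two initial intervals is the smaller end
    point, computed here cell by cell; different components are orthogonal.\<close>
  have overlap_sum: "(\<Sum>i<m. of_bool (t (Suc i) \<le> snd z) * (of_bool (fst z' = fst z) * of_bool (t (Suc i) \<le> snd z')) * (t (Suc i) - t i)) = overlap z' z"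
    if z: "snd z \<in> T" "snd z' \<in> T" for z z' :: "'n \<times> real"
  proof -
    have "min (snd z') (snd z) \<in> t ` {..m}" using z by (simp add: t min_def)
    from sum_grid_telescope[OF t(1) this, of "\<lambda>x. x"]
    have "(\<Sum>i<m. of_bool (t (Suc i) \<le> min (snd z') (snd z)) * (t (Suc i) - t i)) = min (snd z') (snd z)" by (simp add: t)
    moreover have "(\<Sum>i<m. of_bool (t (Suc i) \<le> snd z) * (of_bool (fst z' = fst z) * of_bool (t (Suc i) \<le> snd z')) * (t (Suc i) - t i)) =
       of_bool (fst z' = fst z) * (\<Sum>i<m. of_bool (t (Suc i) \<le> min (snd z') (snd z)) * (t (Suc i) - t i))"
      unfolding sum_distrib_left by (intro sum.cong) (auto simp: of_bool_def)
    ultimately show ?thesis by (simp add: overlap_def)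
  qed
  have JT: "snd (J j) \<in> T" for j by (auto simp: T_def)
  have LT: "snd z \<in> T" if "z \<in> L" for z using that by (auto simp: T_def)
  have W_sum: "(\<Sum>i<m. of_bool (t (Suc i) \<le> snd z) * \<xi> (fst z, i) \<omega>) = W (fst z) (snd z) \<omega> - W (fst z) 0 \<omega>" if "snd z \<in> T" for z \<omega>
    using sum_grid_telescope[OF t(1), of "snd z" "\<lambda>a. W (fst z) a \<omega>"] that by (simp add: t \<xi>_def)
  have R_shift: "R (\<lambda>c\<in>C. \<xi> c \<omega> + s c * (\<sigma> c)\<^sup>2) z = shifted_path W J y \<omega> z" if z: "z \<in> L" for \<omega> z
  proof -
    have "R (\<lambda>c\<in>C. \<xi> c \<omega> + s c * (\<sigma> c)\<^sup>2) z = (\<Sum>i<m. of_bool (t (Suc i) \<le> snd z) * \<xi> (fst z, i) \<omega>) +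
        (\<Sum>i<m. \<Sum>j\<in>UNIV. y $ j * (of_bool (t (Suc i) \<le> snd z) * (of_bool (fst (J j) = fst z) * of_bool (t (Suc i) \<le> snd (J j))) * (t (Suc i) - t i)))"
      unfolding R_def sum.distrib[symmetric]
      by (intro sum.cong) (auto simp: C_def \<sigma> s_def sum_distrib_left sum_distrib_right algebra_simps intro!: sum.cong)
    also have "\<dots> = (W (fst z) (snd z) \<omega> - W (fst z) 0 \<omega>) + (\<Sum>j\<in>UNIV. y $ j * overlap (J j) z)"
      by (subst sum.swap) (simp add: W_sum[OF LT[OF z]] sum_distrib_left[symmetric] overlap_sum[OF LT[OF z] JT])
    finally show ?thesis using z L by (auto simp: shifted_path_def)
  qed
  have R_0: "R (\<lambda>c\<in>C. \<xi> c \<omega>) z = shifted_path W J 0 \<omega> z" if z: "z \<in> L" for \<omega> z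
  proof -
    have "R (\<lambda>c\<in>C. \<xi> c \<omega>) z = (\<Sum>i<m. of_bool (t (Suc i) \<le> snd z) * \<xi> (fst z, i) \<omega>)"
      unfolding R_def by (intro sum.cong) (auto simp: C_def)
    then show ?thesis using z L by (auto simp: shifted_path_def W_sum[OF LT[OF z]])
  qed
  \<comment> \<open>In the exponent, the linear part is the Wiener integral of the derivative of the
    shift, and the quadratic part is half the squared norm of that derivative.\<close>
  have weight: "(\<Prod>c\<in>C. exp (- s c * \<xi> c \<omega> - (s c)\<^sup>2 * (\<sigma> c)\<^sup>2 / 2)) = shift_weight W J y \<omega>" for \<omega>
  proof -
    have 1: "(\<Sum>c\<in>C. s c * \<xi> c \<omega>) = (\<Sum>j\<in>UNIV. y $ j * (W (fst (J j)) (snd (J j)) \<omega> - W (fst (J j)) 0 \<omega>))"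
    proof -
      have "(\<Sum>c\<in>C. s c * \<xi> c \<omega>) = (\<Sum>c\<in>C. \<Sum>j\<in>UNIV. y $ j * (of_bool (fst (J j) = fst c) * (of_bool (t (Suc (snd c)) \<le> snd (J j)) * \<xi> c \<omega>)))"
        by (simp add: s_def split_beta sum_distrib_right mult.assoc)
      also have "\<dots> = (\<Sum>j\<in>UNIV. y $ j * (\<Sum>c\<in>C. of_bool (fst (J j) = fst c) * (of_bool (t (Suc (snd c)) \<le> snd (J j)) * \<xi> c \<omega>)))"
        by (subst sum.swap) (simp add: sum_distrib_left)
      finally have "(\<Sum>c\<in>C. s c * \<xi> c \<omega>) = (\<Sum>j\<in>UNIV. y $ j * (\<Sum>c\<in>C. of_bool (fst (J j) = fst c) * (of_bool (t (Suc (snd c)) \<le> snd (J j)) * \<xi> c \<omega>)))" .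
      moreover have "(\<Sum>c\<in>C. of_bool (fst (J j) = fst c) * (of_bool (t (Suc (snd c)) \<le> snd (J j)) * \<xi> c \<omega>)) =
          W (fst (J j)) (snd (J j)) \<omega> - W (fst (J j)) 0 \<omega>" for j
      proof -
        have "(\<Sum>c\<in>C. of_bool (fst (J j) = fst c) * (of_bool (t (Suc (snd c)) \<le> snd (J j)) * \<xi> c \<omega>)) =
           (\<Sum>k\<in>UNIV. \<Sum>i<m. of_bool (fst (J j) = k) * (of_bool (t (Suc i) \<le> snd (J j)) * \<xi> (k, i) \<omega>))"
          unfolding C_def sum.cartesian_product by (rule sum.cong) (simp_all add: split_beta)
        also have "\<dots> = (\<Sum>k\<in>UNIV. if fst (J j) = k then (\<Sum>i<m. of_bool (t (Suc i) \<le> snd (J j)) * \<xi> (k, i) \<omega>) else 0)"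
          by (intro sum.cong) auto
        also have "\<dots> = (\<Sum>i<m. of_bool (t (Suc i) \<le> snd (J j)) * \<xi> (fst (J j), i) \<omega>)" by simp
        finally show ?thesis by (simp add: W_sum[OF JT])
      qed
      ultimately show ?thesis by simp
    qed
    have 2: "(\<Sum>c\<in>C. (s c)\<^sup>2 * (\<sigma> c)\<^sup>2) = (\<Sum>i\<in>UNIV. \<Sum>j\<in>UNIV. y $ i * y $ j * overlap (J i) (J j))"
    proof -
      \<comment> \<open>Indicates that the grid cell \<open>c\<close> lies in the support of
        direction \<open>j\<close>; expanding the square of \<open>s c\<close> then gives a double
        sum of overlaps.\<close>
      define e where "e j c = of_bool (fst (J j) = fst c) * (of_bool (t (Suc (snd c)) \<le> snd (J j)) :: real)" for j and c :: "'n \<times> nat"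
      have "(\<Sum>c\<in>C. (s c)\<^sup>2 * (\<sigma> c)\<^sup>2) = (\<Sum>c\<in>C. \<Sum>i\<in>UNIV. \<Sum>j\<in>UNIV. y $ i * y $ j * (e i c * e j c * (t (Suc (snd c)) - t (snd c))))"
      proof (intro sum.cong refl)
        fix c assume c: "c \<in> C"
        have "s c = (\<Sum>j\<in>UNIV. y $ j * e j c)" by (simp add: s_def e_def split_beta)
        then have "(s c)\<^sup>2 = (\<Sum>i\<in>UNIV. \<Sum>j\<in>UNIV. (y $ i * e i c) * (y $ j * e j c))"
          by (simp add: power2_eq_square sum_product)
        then show "(s c)\<^sup>2 * (\<sigma> c)\<^sup>2 = (\<Sum>i\<in>UNIV. \<Sum>j\<in>UNIV. y $ i * y $ j * (e i c * e j c * (t (Suc (snd c)) - t (snd c))))"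
          using \<sigma>(2)[OF c] by (simp add: sum_distrib_left sum_distrib_right mult_ac)
      qed
      also have "\<dots> = (\<Sum>i\<in>UNIV. \<Sum>j\<in>UNIV. y $ i * y $ j * (\<Sum>c\<in>C. e i c * e j c * (t (Suc (snd c)) - t (snd c))))"
        unfolding sum_distrib_left by (subst sum.swap, intro sum.cong refl, rule sum.swap)
      finally have "(\<Sum>c\<in>C. (s c)\<^sup>2 * (\<sigma> c)\<^sup>2) = (\<Sum>i\<in>UNIV. \<Sum>j\<in>UNIV. y $ i * y $ j * (\<Sum>c\<in>C. e i c * e j c * (t (Suc (snd c)) - t (snd c))))" .
      moreover have "(\<Sum>c\<in>C. e i c * e j c * (t (Suc (snd c)) - t (snd c))) = overlap (J i) (J j)" for i j
      proof -
        have "(\<Sum>c\<in>C. e i c * e j c * (t (Suc (snd c)) - t (snd c))) =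
           (\<Sum>k\<in>UNIV. \<Sum>l<m. e i (k, l) * e j (k, l) * (t (Suc l) - t l))"
          unfolding C_def by (simp add: sum.cartesian_product split_beta)
        also have "\<dots> = (\<Sum>k\<in>UNIV. if fst (J j) = k then (\<Sum>l<m. of_bool (t (Suc l) \<le> snd (J j)) * (of_bool (fst (J i) = fst (J j)) * of_bool (t (Suc l) \<le> snd (J i))) * (t (Suc l) - t l)) else 0)"
          by (intro sum.cong refl) (auto simp: e_def intro!: sum.cong)
        also have "\<dots> = overlap (J i) (J j)" using overlap_sum[OF JT[of j] JT[of i]] by simp
        finally show ?thesis .
      qed
      ultimately show ?thesis by simp
    qed
    have "(\<Prod>c\<in>C. exp (- s c * \<xi> c \<omega> - (s c)\<^sup>2 * (\<sigma> c)\<^sup>2 / 2)) = exp (\<Sum>c\<in>C. - s c * \<xi> c \<omega> - (s c)\<^sup>2 * (\<sigma> c)\<^sup>2 / 2)"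
      by (rule exp_sum[OF C(1), symmetric])
    also have "(\<Sum>c\<in>C. - s c * \<xi> c \<omega> - (s c)\<^sup>2 * (\<sigma> c)\<^sup>2 / 2) = - (\<Sum>c\<in>C. s c * \<xi> c \<omega>) - (\<Sum>c\<in>C. (s c)\<^sup>2 * (\<sigma> c)\<^sup>2) / 2"
      by (simp add: sum_subtractf sum_negf sum_divide_distrib)
    finally show ?thesis by (simp add: 1 2 shift_weight_def)
  qed
  let ?E = "prod_emb (UNIV \<times> {0..1}) (\<lambda>_. borel) L (Pi\<^sub>E L A)"
  have E[measurable]: "?E \<in> sets path_measure" using L A by (intro sets_PiM_I) auto
  have ind: "indicator ?E (shifted_path W J y' \<omega>) = (\<Prod>z\<in>L. indicator (A z) (shifted_path W J y' \<omega> z) :: ennreal)" for y' \<omega>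
  proof -
    have "shifted_path W J y' \<omega> \<in> ?E \<longleftrightarrow> (\<forall>z\<in>L. shifted_path W J y' \<omega> z \<in> A z)"
      using L(2) by (auto simp: prod_emb_def shifted_path_def PiE_iff space_PiM)
    then show ?thesis using L(1) by (auto simp: indicator_def prod_zero_iff split: if_splits)
  qed
  have "emeasure (distr (density M (\<lambda>\<omega>. ennreal (shift_weight W J y \<omega>))) path_measure (shifted_path W J y)) ?E
     = (\<integral>\<^sup>+x. indicator ?E x \<partial>distr (density M (\<lambda>\<omega>. ennreal (shift_weight W J y \<omega>))) path_measure (shifted_path W J y))"
    by simp
  also have "\<dots> = (\<integral>\<^sup>+\<omega>. ennreal (shift_weight W J y \<omega>) * indicator ?E (shifted_path W J y \<omega>) \<partial>M)"
    by (subst nn_integral_distr) (auto simp: nn_integral_density)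
  also have "\<dots> = (\<integral>\<^sup>+\<omega>. ennreal (\<Prod>c\<in>C. exp (- s c * \<xi> c \<omega> - (s c)\<^sup>2 * (\<sigma> c)\<^sup>2 / 2)) * \<Phi> (\<lambda>c\<in>C. \<xi> c \<omega> + s c * (\<sigma> c)\<^sup>2) \<partial>M)"
    unfolding weight ind \<Phi>_def by (simp add: R_shift)
  also have "\<dots> = (\<integral>\<^sup>+\<omega>. \<Phi> (\<lambda>c\<in>C. \<xi> c \<omega>) \<partial>M)"
    by (rule independent_normal_shift[OF C indep \<sigma>(1) normal \<Phi>m])
  also have "\<dots> = (\<integral>\<^sup>+\<omega>. indicator ?E (shifted_path W J 0 \<omega>) \<partial>M)"
    unfolding ind \<Phi>_def by (simp add: R_0)
  also have "\<dots> = (\<integral>\<^sup>+x. indicator ?E x \<partial>distr M path_measure (shifted_path W J 0))"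
    by (subst nn_integral_distr) auto
  also have "\<dots> = emeasure (distr M path_measure (shifted_path W J 0)) ?E"
    by simp
  finally show "emeasure (distr M path_measure (shifted_path W J 0)) ?E =
     emeasure (distr (density M (\<lambda>\<omega>. ennreal (shift_weight W J y \<omega>))) path_measure (shifted_path W J y)) ?E" ..
qed simp_all

text \<open>The right-hand side does not depend on \<open>y\<close>. Integrating the identity over
  \<open>y\<close> therefore transfers moments at the unshifted path to whole fibres.\<close>

corollary nn_integral_shifted_path:
  assumes J: "\<And>j. snd (J j) \<in> {0..1}" and [measurable]: "\<Phi> \<in> borel_measurable path_measure"
  shows "(\<integral>\<^sup>+\<omega>. ennreal (shift_weight W J y \<omega>) * \<Phi> (shifted_path W J y \<omega>) \<partial>M) = (\<integral>\<^sup>+\<omega>. \<Phi> (shifted_path W J 0 \<omega>) \<partial>M)"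
proof -
  note [measurable] = shift_weight_measurable'[OF J]
  have "(\<integral>\<^sup>+\<omega>. ennreal (shift_weight W J y \<omega>) * \<Phi> (shifted_path W J y \<omega>) \<partial>M)
    = (\<integral>\<^sup>+x. \<Phi> x \<partial>distr (density M (\<lambda>\<omega>. ennreal (shift_weight W J y \<omega>))) path_measure (shifted_path W J y))"
    by (subst nn_integral_distr) (auto simp: nn_integral_density)
  also have "\<dots> = (\<integral>\<^sup>+\<omega>. \<Phi> (shifted_path W J 0 \<omega>) \<partial>M)"
    unfolding distr_shifted_path[OF J] by (subst nn_integral_distr) auto
  finally show ?thesis .
qed

end

lemma integrable_mult_indicator_L2:
  fixes u :: "'b \<Rightarrow> real"
  assumes "finite_measure N" and [measurable]: "u \<in> borel_measurable N" "A \<in> sets N"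
    and u: "integrable N (\<lambda>z. (u z)\<^sup>2)"
  shows "integrable N (\<lambda>z. u z * indicator A z)"
proof -
  interpret finite_measure N by fact
  have "integrable N (\<lambda>z. 1 + (u z)\<^sup>2)" using u by simp
  then show ?thesis
  proof (rule Bochner_Integration.integrable_bound)
    show "AE z in N. norm (u z * indicator A z) \<le> norm (1 + (u z)\<^sup>2)"
    proof (rule AE_I2)
      fix z
      have "\<bar>u z\<bar> \<le> 1 + (u z)\<^sup>2"
        using zero_le_power2[of "\<bar>u z\<bar> - 1"] by (simp add: power2_diff)
      then show "norm (u z * indicator A z) \<le> norm (1 + (u z)\<^sup>2)"
        by (auto split: split_indicator)
    qed
  qed simp
qed

text \<open>Cauchy-Schwarz without dividing by norms: expand the non-negative integral of the square
  of \<open>u - c * indicator A\<close>, with \<open>c\<close> the integral to be bounded. The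
  measure of \<open>A\<close> being at most 1 gives the constant 1.\<close>

lemma integral_indicator_le_L2_norm:
  fixes u :: "'b \<Rightarrow> real"
  assumes "finite_measure N" and [measurable]: "u \<in> borel_measurable N" "A \<in> sets N"
    and u: "integrable N (\<lambda>z. (u z)\<^sup>2)" and A: "measure N A \<le> 1"
  shows "\<bar>\<integral>z. u z * indicator A z \<partial>N\<bar> \<le> L2_norm N u"
proof -
  interpret finite_measure N by fact
  define c where "c = (\<integral>z. u z * indicator A z \<partial>N)"
  have i: "integrable N (\<lambda>z. u z * indicator A z)"
    by (rule integrable_mult_indicator_L2) (use assms in auto)
  have iA: "integrable N (\<lambda>z. indicator A z :: real)"
    by (rule integrable_real_indicator) (simp_all add: less_top[symmetric])
  have eq: "(u z - c * indicator A z)\<^sup>2 = (u z)\<^sup>2 - 2 * c * (u z * indicator A z) + c\<^sup>2 * indicator A z" for z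
    by (auto simp: power2_eq_square algebra_simps split: split_indicator)
  have "0 \<le> (\<integral>z. (u z - c * indicator A z)\<^sup>2 \<partial>N)" by simp
  also have "\<dots> = (\<integral>z. (u z)\<^sup>2 \<partial>N) - 2 * c * c + c\<^sup>2 * measure N A"
    unfolding eq using i iA u by (simp add: c_def)
  also have "\<dots> \<le> (\<integral>z. (u z)\<^sup>2 \<partial>N) - 2 * c * c + c\<^sup>2 * 1"
    using A by (intro add_left_mono mult_left_mono) auto
  finally have "c\<^sup>2 \<le> (\<integral>z. (u z)\<^sup>2 \<partial>N)" by (simp add: power2_eq_square)
  then show ?thesis unfolding L2_norm_def c_def[symmetric] by (simp add: real_le_rsqrt)
qed

text \<open>The expectation of the sum is finite, so the sum is finite almost surely. Later uses
  extract from it that the terms tend to zero, or that they are bounded.\<close>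

lemma AE_summable_of_geometric:
  fixes f :: "nat \<Rightarrow> 'a \<Rightarrow> ennreal"
  assumes [measurable]: "\<And>m. f m \<in> borel_measurable M"
    and le: "\<And>m. (\<integral>\<^sup>+\<omega>. f m \<omega> \<partial>M) \<le> ennreal (c * (1/2) ^ m)" and c: "0 \<le> c"
  shows "AE \<omega> in M. (\<Sum>m. f m \<omega>) < \<top>"
proof -
  have "(\<integral>\<^sup>+\<omega>. (\<Sum>m. f m \<omega>) \<partial>M) = (\<Sum>m. \<integral>\<^sup>+\<omega>. f m \<omega> \<partial>M)"
    by (rule nn_integral_suminf) measurable
  also have "\<dots> \<le> (\<Sum>m. ennreal (c * (1/2) ^ m))" by (intro suminf_le le) auto
  also have "\<dots> = ennreal (\<Sum>m. c * (1/2) ^ m)"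
    using c by (intro suminf_ennreal2) (auto intro!: summable_mult summable_geometric)
  also have "\<dots> < \<top>" by simp
  finally have "(\<integral>\<^sup>+\<omega>. (\<Sum>m. f m \<omega>) \<partial>M) \<noteq> \<infinity>" by simp
  then have "AE \<omega> in M. (\<Sum>m. f m \<omega>) \<noteq> \<infinity>"
    by (intro nn_integral_noteq_infinite) auto
  then show ?thesis by eventually_elim (simp add: less_top)
qed

lemma le_suminf_ennreal: "f m \<le> (\<Sum>m. f m :: ennreal)"
  using sum_le_suminf[of f "{m}"] by (simp add: summableI)

section \<open>The Hilbert space of the noise\<close>

definition cell :: "'n \<times> real \<Rightarrow> ('n \<times> real) set" where
  "cell I = {fst I} \<times> {0<..snd I}"

text \<open>The inner product of \<open>u\<close> with the indicator of \<open>cell I\<close>. For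
  \<open>u = DF \<omega>\<close> it is the derivative of the functional in the Cameron-Martin
  direction \<open>I\<close>.\<close>

definition pairing :: "('n::finite \<times> real \<Rightarrow> real) \<Rightarrow> 'n \<times> real \<Rightarrow> real" where
  "pairing u I = (\<integral>z. u z * indicator (cell I) z \<partial>noise)"

definition pairing2 :: "(('n::finite \<times> real) \<times> ('n \<times> real) \<Rightarrow> real) \<Rightarrow> 'n \<times> real \<Rightarrow> 'n \<times> real \<Rightarrow> real" where
  "pairing2 u I I' = (\<integral>z. u z * indicator (cell I \<times> cell I') z \<partial>(noise \<Otimes>\<^sub>M noise))"

lemma space_noise: "space (noise :: ('n::finite \<times> real) measure) = UNIV \<times> {0..1}"
  by (simp add: noise_def space_pair_measure space_restrict_space)

lemma finite_measure_unit: "finite_measure (restrict_space lborel {0..1::real})"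
  by (rule finite_measureI) (simp add: emeasure_restrict_space space_restrict_space)

lemma finite_measure_count: "finite_measure (count_space (UNIV :: 'n::finite set))"
  by (rule finite_measureI) simp

lemma sigma_finite_unit: "sigma_finite_measure (restrict_space lborel {0..1::real})"
  using finite_measure_unit by (simp add: finite_measure_def)

lemma finite_measure_noise: "finite_measure (noise :: ('n::finite \<times> real) measure)"
proof (rule finite_measureI)
  interpret finite_measure "restrict_space lborel {0..1::real}" by (rule finite_measure_unit)
  have "emeasure (noise :: ('n \<times> real) measure) (UNIV \<times> {0..1}) =
     emeasure (count_space (UNIV :: 'n set)) UNIV * emeasure (restrict_space lborel {0..1::real}) {0..1}"
    unfolding noise_def by (rule emeasure_pair_measure_Times) (auto simp: sets_restrict_space)
  then show "emeasure (noise :: ('n \<times> real) measure) (space noise) \<noteq> \<infinity>"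
    by (simp add: space_noise emeasure_restrict_space ennreal_mult_eq_top_iff)
qed

interpretation noise: finite_measure "noise :: ('n::finite \<times> real) measure"
  by (rule finite_measure_noise)

interpretation noise2: pair_sigma_finite "noise :: ('n::finite \<times> real) measure" "noise :: ('n \<times> real) measure" ..

lemma emeasure_noise_strip:
  assumes "0 \<le> a" "b \<le> 1"
  shows "{k} \<times> {a<..b} \<in> sets (noise :: ('n::finite \<times> real) measure)"
    and "emeasure (noise :: ('n \<times> real) measure) ({k} \<times> {a<..b}) = ennreal (max 0 (b - a))"
proof -
  interpret U: sigma_finite_measure "restrict_space lborel {0..1::real}" by (rule sigma_finite_unit)
  have sub: "{a<..b} \<subseteq> {0..1}" using assms by auto
  then have s: "{a<..b} \<in> sets (restrict_space lborel {0..1})" by (auto simp: sets_restrict_space_iff)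
  then show "{k} \<times> {a<..b} \<in> sets (noise :: ('n \<times> real) measure)"
    unfolding noise_def by (intro pair_measureI) auto
  have "emeasure (noise :: ('n \<times> real) measure) ({k} \<times> {a<..b}) =
     emeasure (count_space UNIV) {k} * emeasure (restrict_space lborel {0..1::real}) {a<..b}"
    unfolding noise_def using s by (intro U.emeasure_pair_measure_Times) auto
  also have "\<dots> = ennreal (max 0 (b - a))"
    using sub by (cases "a \<le> b") (auto simp: emeasure_restrict_space)
  finally show "emeasure (noise :: ('n \<times> real) measure) ({k} \<times> {a<..b}) = ennreal (max 0 (b - a))" .
qed

lemma sets_cell [measurable]: "snd I \<in> {0..1} \<Longrightarrow> cell I \<in> sets (noise :: ('n::finite \<times> real) measure)"
  unfolding cell_def by (rule emeasure_noise_strip) auto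

lemma measure_cell_le: "snd I \<in> {0..1} \<Longrightarrow> measure (noise :: ('n::finite \<times> real) measure) (cell I) \<le> 1"
  unfolding cell_def measure_def by (subst emeasure_noise_strip) auto

lemma sets_cell2 [measurable]:
  "snd I \<in> {0..1} \<Longrightarrow> snd I' \<in> {0..1} \<Longrightarrow> cell I \<times> cell I' \<in> sets ((noise :: ('n::finite \<times> real) measure) \<Otimes>\<^sub>M noise)"
  by (intro pair_measureI sets_cell)

lemma finite_measure_noise2: "finite_measure ((noise :: ('n::finite \<times> real) measure) \<Otimes>\<^sub>M noise)"
  by (rule finite_measureI)
    (simp add: space_pair_measure noise.emeasure_pair_measure_Times ennreal_mult_eq_top_iff noise.emeasure_eq_measure)

lemma measure_cell2_le:
  assumes "snd I \<in> {0..1}" "snd I' \<in> {0..1}"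
  shows "measure ((noise :: ('n::finite \<times> real) measure) \<Otimes>\<^sub>M noise) (cell I \<times> cell I') \<le> 1"
proof -
  have "measure ((noise :: ('n \<times> real) measure) \<Otimes>\<^sub>M noise) (cell I \<times> cell I') = measure noise (cell I) * measure noise (cell I')"
    unfolding measure_def using assms
    by (simp add: noise.emeasure_pair_measure_Times enn2real_mult)
  also have "\<dots> \<le> 1 * 1" using assms by (intro mult_mono measure_cell_le) auto
  finally show ?thesis by simp
qed

lemma abs_pairing_le:
  fixes u :: "'n::finite \<times> real \<Rightarrow> real"
  assumes "u \<in> borel_measurable noise" "integrable noise (\<lambda>z. (u z)\<^sup>2)" "snd I \<in> {0..1}"
  shows "\<bar>pairing u I\<bar> \<le> L2_norm noise u"
  unfolding pairing_def using assms
  by (intro integral_indicator_le_L2_norm finite_measure_noise measure_cell_le) auto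

lemma abs_pairing2_le:
  fixes u :: "('n::finite \<times> real) \<times> ('n \<times> real) \<Rightarrow> real"
  assumes "u \<in> borel_measurable (noise \<Otimes>\<^sub>M noise)" "integrable (noise \<Otimes>\<^sub>M noise) (\<lambda>z. (u z)\<^sup>2)"
    "snd I \<in> {0..1}" "snd I' \<in> {0..1}"
  shows "\<bar>pairing2 u I I'\<bar> \<le> L2_norm (noise \<Otimes>\<^sub>M noise) u"
  unfolding pairing2_def using assms
  by (intro integral_indicator_le_L2_norm finite_measure_noise2 measure_cell2_le) auto

lemma integrable_pairing:
  fixes u :: "'n::finite \<times> real \<Rightarrow> real"
  assumes "u \<in> borel_measurable noise" "integrable noise (\<lambda>z. (u z)\<^sup>2)" "snd I \<in> {0..1}"
  shows "integrable noise (\<lambda>z. u z * indicator (cell I) z)"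
  using assms by (intro integrable_mult_indicator_L2 finite_measure_noise) auto

lemma integrable_square_diff:
  fixes u v :: "'b \<Rightarrow> real"
  assumes [measurable]: "u \<in> borel_measurable N" "v \<in> borel_measurable N"
    and "integrable N (\<lambda>z. (u z)\<^sup>2)" "integrable N (\<lambda>z. (v z)\<^sup>2)"
  shows "integrable N (\<lambda>z. (u z - v z)\<^sup>2)"
proof (rule Bochner_Integration.integrable_bound)
  show "integrable N (\<lambda>z. 2 * (u z)\<^sup>2 + 2 * (v z)\<^sup>2)" using assms by simp
  show "AE z in N. norm ((u z - v z)\<^sup>2) \<le> norm (2 * (u z)\<^sup>2 + 2 * (v z)\<^sup>2)"
  proof (rule AE_I2)
    fix z
    have "0 \<le> (u z + v z)\<^sup>2" by simp
    then have "(u z - v z)\<^sup>2 \<le> 2 * (u z)\<^sup>2 + 2 * (v z)\<^sup>2"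
      by (simp add: power2_eq_square algebra_simps)
    then show "norm ((u z - v z)\<^sup>2) \<le> norm (2 * (u z)\<^sup>2 + 2 * (v z)\<^sup>2)" by simp
  qed
qed simp

lemma abs_pairing_diff_le:
  fixes u v :: "'n::finite \<times> real \<Rightarrow> real"
  assumes "u \<in> borel_measurable noise" "integrable noise (\<lambda>z. (u z)\<^sup>2)"
    "v \<in> borel_measurable noise" "integrable noise (\<lambda>z. (v z)\<^sup>2)" "snd I \<in> {0..1}"
  shows "\<bar>pairing u I - pairing v I\<bar> \<le> L2_norm noise (\<lambda>z. u z - v z)"
proof -
  have "pairing u I - pairing v I = pairing (\<lambda>z. u z - v z) I"
    unfolding pairing_def left_diff_distrib using assms
    by (intro Bochner_Integration.integral_diff[symmetric] integrable_pairing) auto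
  then show ?thesis using assms by (simp add: abs_pairing_le integrable_square_diff)
qed

lemma abs_pairing2_diff_le:
  fixes u v :: "('n::finite \<times> real) \<times> ('n \<times> real) \<Rightarrow> real"
  assumes "u \<in> borel_measurable (noise \<Otimes>\<^sub>M noise)" "integrable (noise \<Otimes>\<^sub>M noise) (\<lambda>z. (u z)\<^sup>2)"
    "v \<in> borel_measurable (noise \<Otimes>\<^sub>M noise)" "integrable (noise \<Otimes>\<^sub>M noise) (\<lambda>z. (v z)\<^sup>2)"
    "snd I \<in> {0..1}" "snd I' \<in> {0..1}"
  shows "\<bar>pairing2 u I I' - pairing2 v I I'\<bar> \<le> L2_norm (noise \<Otimes>\<^sub>M noise) (\<lambda>z. u z - v z)"
proof -
  have "pairing2 u I I' - pairing2 v I I' = pairing2 (\<lambda>z. u z - v z) I I'"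
    unfolding pairing2_def left_diff_distrib using assms
    by (intro Bochner_Integration.integral_diff[symmetric] integrable_mult_indicator_L2 finite_measure_noise2) auto
  then show ?thesis using assms by (simp add: abs_pairing2_le integrable_square_diff)
qed

lemma has_bochner_integral_product:
  fixes g h :: "'n::finite \<times> real \<Rightarrow> real"
  assumes g: "integrable noise g" and h: "integrable noise h"
  shows "has_bochner_integral (noise \<Otimes>\<^sub>M noise) (\<lambda>z. g (fst z) * h (snd z)) ((\<integral>z. g z \<partial>noise) * (\<integral>z. h z \<partial>noise))"
proof -
  have [measurable]: "g \<in> borel_measurable noise" "h \<in> borel_measurable noise" using g h by auto
  have i: "integrable (noise \<Otimes>\<^sub>M noise) (\<lambda>z. g (fst z) * h (snd z))"
  proof (rule noise2.Fubini_integrable)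
    show "integrable noise (\<lambda>x. \<integral>y. norm (g (fst (x, y)) * h (snd (x, y))) \<partial>noise)"
      using g by (simp add: abs_mult integrable_abs)
  qed (use h in auto)
  then show ?thesis
    using noise2.integral_fst'[OF i] by (simp add: has_bochner_integral_iff)
qed

section \<open>Step functions and Wiener integrals\<close>

lemma step_fun_Cons: "step_fun ((c, k, a, b) # xs) = (\<lambda>z. c * indicator ({k} \<times> {a<..b}) z + step_fun xs z)"
  by (auto simp: step_fun_def fun_eq_iff indicator_def)

lemma step_fun_Nil: "step_fun [] = (\<lambda>_. 0)"
  by (auto simp: step_fun_def)

definition admissible :: "(real \<times> 'n \<times> real \<times> real) list \<Rightarrow> bool" where
  "admissible xs \<longleftrightarrow> (\<forall>(c, k, a, b)\<in>set xs. 0 \<le> a \<and> a \<le> b \<and> b \<le> 1)"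

lemma admissible_induct [consumes 1, case_names Nil Cons]:
  assumes "admissible xs" "P []"
    "\<And>c k a b xs. 0 \<le> a \<Longrightarrow> a \<le> b \<Longrightarrow> b \<le> 1 \<Longrightarrow> admissible xs \<Longrightarrow> P xs \<Longrightarrow> P ((c, k, a, b) # xs)"
  shows "P xs"
  using assms(1)
proof (induction xs)
  case (Cons x xs)
  obtain c k a b where x: "x = (c, k, a, b)" by (cases x)
  show ?case using Cons unfolding x by (intro assms(3)) (auto simp: admissible_def)
qed (rule assms(2))

lemma step_fun_measurable:
  "admissible xs \<Longrightarrow> step_fun xs \<in> borel_measurable (noise :: ('n::finite \<times> real) measure)"
proof (induction rule: admissible_induct)
  case (Cons c k a b xs)
  then have [measurable]: "{k} \<times> {a<..b} \<in> sets (noise :: ('n \<times> real) measure)" by (intro emeasure_noise_strip) auto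
  show ?case unfolding step_fun_Cons using Cons by measurable
qed (simp add: step_fun_Nil)

lemma step_fun_bounded: "\<exists>B. \<forall>z. \<bar>step_fun xs z\<bar> \<le> B"
proof (induction xs)
  case (Cons x xs)
  obtain c k a b where x: "x = (c, k, a, b)" by (cases x)
  from Cons obtain B where B: "\<And>z. \<bar>step_fun xs z\<bar> \<le> B" by blast
  have "\<bar>step_fun (x # xs) z\<bar> \<le> \<bar>c\<bar> + B" for z
    using B[of z] unfolding x step_fun_Cons by (auto split: split_indicator)
  then show ?case by blast
qed (auto simp: step_fun_Nil)

lemma step_fun_L2:
  assumes "admissible xs"
  shows "integrable (noise :: ('n::finite \<times> real) measure) (\<lambda>z. (step_fun xs z)\<^sup>2)"
proof -
  obtain B where B: "\<And>z. \<bar>step_fun xs z\<bar> \<le> B" using step_fun_bounded by blast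
  note [measurable] = step_fun_measurable[OF assms]
  show ?thesis
  proof (rule noise.integrable_const_bound[of _ "B\<^sup>2"])
    show "AE z in noise. norm ((step_fun xs z)\<^sup>2) \<le> B\<^sup>2"
    proof (rule AE_I2)
      fix z
      show "norm ((step_fun xs z)\<^sup>2) \<le> B\<^sup>2" using power_mono[OF B[of z], of 2] by simp
    qed
  qed measurable
qed

text \<open>Counterpart of \<open>step_integral\<close> as a function of the path instead of the
  sample point, so that it can be evaluated at shifted paths.\<close>

definition path_integral :: "(real \<times> 'n \<times> real \<times> real) list \<Rightarrow> ('n \<times> real \<Rightarrow> real) \<Rightarrow> real" where
  "path_integral xs \<pi> = (\<Sum>(c, k, a, b)\<leftarrow>xs. c * (\<pi> (k, b) - \<pi> (k, a)))"

lemma path_integral_measurable: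
  "admissible xs \<Longrightarrow> path_integral xs \<in> borel_measurable path_measure"
proof (induction rule: admissible_induct)
  case (Cons c k a b xs)
  have "(\<lambda>\<pi>. c * (\<pi> (k, b) - \<pi> (k, a)) + path_integral xs \<pi>) \<in> borel_measurable path_measure"
    using Cons by (intro borel_measurable_add borel_measurable_times borel_measurable_diff measurable_component_singleton) auto
  then show ?case by (simp add: path_integral_def)
qed (simp add: path_integral_def)

text \<open>In its second argument \<open>overlap I\<close> is the Cameron-Martin path whose
  derivative is the indicator of \<open>cell I\<close>; its increment over a strip is the measure of
  the part of the strip inside the cell.\<close>

lemma pairing_strip:
  fixes I :: "'n::finite \<times> real"
  assumes "0 \<le> a" "a \<le> b" "b \<le> 1" and I: "snd I \<in> {0..1}"
  shows "has_bochner_integral noise (\<lambda>z. indicator ({k} \<times> {a<..b}) z * indicator (cell I) z) (overlap I (k, b) - overlap I (k, a))"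
proof -
  let ?A = "if fst I = k then {k} \<times> {a<..min b (snd I)} else {}"
  have eq: "indicator ({k} \<times> {a<..b}) z * indicator (cell I) z = (indicator ?A z :: real)" for z
    using assms by (cases z) (auto simp: cell_def indicator_def)
  have A: "?A \<in> sets noise" using emeasure_noise_strip(1)[of a "min b (snd I)" k] assms by auto
  have "measure noise ?A = overlap I (k, b) - overlap I (k, a)"
    unfolding measure_def using emeasure_noise_strip(2)[of a "min b (snd I)" k] assms
    by (auto simp: overlap_def max_def min_def)
  moreover have "has_bochner_integral noise (indicator ?A :: _ \<Rightarrow> real) (measure noise ?A)"
    using A by (rule has_bochner_integral_real_indicator) (simp add: less_top[symmetric])
  ultimately show ?thesis unfolding eq by simp
qed

text \<open>By linearity in the steps: a shift adds to the integral the inner product of the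
  integrand with the derivative of the shift, which is deterministic.\<close>

lemma path_integral_shifted_path:
  fixes J :: "'d::finite \<Rightarrow> 'n::finite \<times> real"
  assumes xs: "admissible xs" and J: "\<And>j. snd (J j) \<in> {0..1}"
  shows "path_integral xs (shifted_path W J y \<omega>) = step_integral W xs \<omega> + (\<Sum>j\<in>UNIV. y $ j * pairing (step_fun xs) (J j))"
  using xs
proof (induction rule: admissible_induct)
  case Nil
  then show ?case by (simp add: path_integral_def step_integral_def step_fun_Nil pairing_def)
next
  case (Cons c k a b xs)
  have "pairing (step_fun ((c, k, a, b) # xs)) (J j) = c * (overlap (J j) (k, b) - overlap (J j) (k, a)) + pairing (step_fun xs) (J j)" for j
  proof -
    have "pairing (step_fun ((c, k, a, b) # xs)) (J j) =
      (\<integral>z. c * (indicator ({k} \<times> {a<..b}) z * indicator (cell (J j)) z) + step_fun xs z * indicator (cell (J j)) z \<partial>noise)"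
      by (simp add: pairing_def step_fun_Cons distrib_right mult.assoc)
    also have "\<dots> = c * (\<integral>z. indicator ({k} \<times> {a<..b}) z * indicator (cell (J j)) z \<partial>noise) + pairing (step_fun xs) (J j)"
      unfolding pairing_def
      using pairing_strip[OF Cons(1-3) J, of k j] integrable_pairing[OF step_fun_measurable step_fun_L2 J, OF Cons(4) Cons(4)]
      by (subst Bochner_Integration.integral_add) (auto simp: has_bochner_integral_iff)
    finally show ?thesis
      using pairing_strip[OF Cons(1-3) J, of k j] by (simp add: has_bochner_integral_iff)
  qed
  moreover have "shifted_path W J y \<omega> (k, b) - shifted_path W J y \<omega> (k, a) =
     (W k b \<omega> - W k a \<omega>) + (\<Sum>j\<in>UNIV. y $ j * (overlap (J j) (k, b) - overlap (J j) (k, a)))"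
    using Cons by (simp add: shifted_path_def sum_subtractf right_diff_distrib)
  ultimately show ?case using Cons.IH
    by (simp add: path_integral_def step_integral_def distrib_left sum.distrib sum_distrib_left mult_ac)
qed

context brownian
begin

text \<open>A rapidly convergent subsequence of the step integrals converges almost surely, and its
  limit can be formed on path space. The contribution of the shift does not involve the sample point
  and converges separately, so one null set serves all \<open>J\<close> and \<open>y\<close>, and
  the Wiener integral is affine along fibres.\<close>

lemma wiener_integral_path:
  assumes X: "is_wiener_integral M W h X"
  shows "\<exists>\<Xi> \<in> borel_measurable path_measure. AE \<omega> in M. \<forall>(J :: 'd::finite \<Rightarrow> _) y.
     (\<forall>j. snd (J j) \<in> {0..1}) \<longrightarrow> \<Xi> (shifted_path W J y \<omega>) = X \<omega> + (\<Sum>j\<in>UNIV. y $ j * pairing h (J j))"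
proof -
  have h[measurable]: "h \<in> borel_measurable noise" and hL2: "integrable noise (\<lambda>z. (h z)\<^sup>2)"
    and Xm[measurable]: "X \<in> borel_measurable M"
    using X by (simp_all add: is_wiener_integral_def)
  obtain xs where xs0: "\<forall>m. \<forall>(c, k, a, b)\<in>set (xs m). 0 \<le> a \<and> a \<le> b \<and> b \<le> 1"
    and hlim: "(\<lambda>m. L2_norm noise (\<lambda>z. step_fun (xs m) z - h z)) \<longlonglongrightarrow> 0"
    and Xlim: "(\<lambda>m. \<integral>\<^sup>+\<omega>. ennreal ((step_integral W (xs m) \<omega> - X \<omega>)\<^sup>2) \<partial>M) \<longlonglongrightarrow> 0"
    using X unfolding is_wiener_integral_def by blast
  have xs: "admissible (xs m)" for m using xs0 by (simp add: admissible_def)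
  \<comment> \<open>The bound by powers of 1/2 yields almost sure convergence; the condition
    \<open>n \<ge> m\<close> makes the subsequence tend to infinity, as the convergence of the
    pairings requires.\<close>
  have "\<exists>n\<ge>m. (\<integral>\<^sup>+\<omega>. ennreal ((step_integral W (xs n) \<omega> - X \<omega>)\<^sup>2) \<partial>M) \<le> ennreal (1 * (1/2) ^ m)" for m
  proof -
    have "\<forall>\<^sub>F n in sequentially. (\<integral>\<^sup>+\<omega>. ennreal ((step_integral W (xs n) \<omega> - X \<omega>)\<^sup>2) \<partial>M) < ennreal (1 * (1/2) ^ m)"
      by (rule order_tendstoD(2)[OF Xlim]) simp
    then obtain N where "\<And>n. n \<ge> N \<Longrightarrow> (\<integral>\<^sup>+\<omega>. ennreal ((step_integral W (xs n) \<omega> - X \<omega>)\<^sup>2) \<partial>M) < ennreal (1 * (1/2) ^ m)"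
      by (auto simp: eventually_sequentially)
    from this[of "max N m"] show ?thesis by (intro exI[of _ "max N m"]) auto
  qed
  then obtain r where r: "\<And>m. m \<le> r m"
    "\<And>m. (\<integral>\<^sup>+\<omega>. ennreal ((step_integral W (xs (r m)) \<omega> - X \<omega>)\<^sup>2) \<partial>M) \<le> ennreal (1 * (1/2) ^ m)" by metis
  have rlim: "filterlim r sequentially sequentially"
    using r(1) by (rule filterlim_at_top_mono[OF filterlim_ident always_eventually, rule_format])
  have Sm[measurable]: "step_integral W (xs m) \<in> borel_measurable M" for m
    using xs[of m]
  proof (induction rule: admissible_induct)
    case (Cons c k a b ys)
    have "(\<lambda>\<omega>. c * (W k b \<omega> - W k a \<omega>) + step_integral W ys \<omega>) \<in> borel_measurable M"
      using Cons by (intro borel_measurable_add borel_measurable_times borel_measurable_diff W_measurable) auto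
    then show ?case by (simp add: step_integral_def)
  qed (simp add: step_integral_def)
  have "AE \<omega> in M. (\<Sum>m. ennreal ((step_integral W (xs (r m)) \<omega> - X \<omega>)\<^sup>2)) < \<top>"
    by (rule AE_summable_of_geometric[OF _ r(2)]) simp_all
  then have Xconv: "AE \<omega> in M. (\<lambda>m. step_integral W (xs (r m)) \<omega>) \<longlonglongrightarrow> X \<omega>"
  proof eventually_elim
    case (elim \<omega>)
    then have "summable (\<lambda>m. (step_integral W (xs (r m)) \<omega> - X \<omega>)\<^sup>2)"
      by (intro summable_suminf_not_top) auto
    then have "(\<lambda>m. (step_integral W (xs (r m)) \<omega> - X \<omega>)\<^sup>2) \<longlonglongrightarrow> 0" by (rule summable_LIMSEQ_zero)
    then have "(\<lambda>m. sqrt ((step_integral W (xs (r m)) \<omega> - X \<omega>)\<^sup>2)) \<longlonglongrightarrow> sqrt 0" by (rule tendsto_real_sqrt)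
    then have "(\<lambda>m. step_integral W (xs (r m)) \<omega> - X \<omega>) \<longlonglongrightarrow> 0" by (simp add: tendsto_rabs_zero_iff)
    then show ?case by (rule LIM_zero_cancel)
  qed
  have hconv: "(\<lambda>m. pairing (step_fun (xs (r m))) I) \<longlonglongrightarrow> pairing h I" if I: "snd I \<in> {0..1}" for I
  proof -
    have "(\<lambda>m. pairing (step_fun (xs m)) I - pairing h I) \<longlonglongrightarrow> 0"
    proof (rule Lim_null_comparison[OF always_eventually hlim], rule allI)
      show "norm (pairing (step_fun (xs m)) I - pairing h I) \<le> L2_norm noise (\<lambda>z. step_fun (xs m) z - h z)" for m
        using abs_pairing_diff_le[OF step_fun_measurable[OF xs] step_fun_L2[OF xs] h hL2 I] by simp
    qed
    then have "(\<lambda>m. pairing (step_fun (xs m)) I) \<longlonglongrightarrow> pairing h I" by (rule LIM_zero_cancel)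
    then show ?thesis using rlim by (rule filterlim_compose)
  qed
  define \<Xi> where "\<Xi> = (\<lambda>\<pi>. lim (\<lambda>m. path_integral (xs (r m)) \<pi>))"
  have "\<Xi> \<in> borel_measurable path_measure"
    unfolding \<Xi>_def
    by (rule borel_measurable_lim_metric[where f = "\<lambda>m. path_integral (xs (r m))"], rule path_integral_measurable, rule xs)
  moreover have "AE \<omega> in M. \<forall>(J :: 'd \<Rightarrow> _) y. (\<forall>j. snd (J j) \<in> {0..1}) \<longrightarrow>
      \<Xi> (shifted_path W J y \<omega>) = X \<omega> + (\<Sum>j\<in>UNIV. y $ j * pairing h (J j))"
    using Xconv
  proof (eventually_elim, intro allI impI)
    case (elim \<omega>)
    fix J :: "'d \<Rightarrow> 'n \<times> real" and y :: "real^'d" assume J: "\<forall>j. snd (J j) \<in> {0..1}"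
    have "(\<lambda>m. step_integral W (xs (r m)) \<omega> + (\<Sum>j\<in>UNIV. y $ j * pairing (step_fun (xs (r m))) (J j)))
        \<longlonglongrightarrow> X \<omega> + (\<Sum>j\<in>UNIV. y $ j * pairing h (J j))"
      using J by (intro tendsto_add tendsto_sum tendsto_mult tendsto_const elim hconv) auto
    moreover have "path_integral (xs (r m)) (shifted_path W J y \<omega>) =
        step_integral W (xs (r m)) \<omega> + (\<Sum>j\<in>UNIV. y $ j * pairing (step_fun (xs (r m))) (J j))" for m
      using J by (intro path_integral_shifted_path xs) auto
    ultimately have "(\<lambda>m. path_integral (xs (r m)) (shifted_path W J y \<omega>)) \<longlonglongrightarrow> X \<omega> + (\<Sum>j\<in>UNIV. y $ j * pairing h (J j))"
      by simp
    then show "\<Xi> (shifted_path W J y \<omega>) = X \<omega> + (\<Sum>j\<in>UNIV. y $ j * pairing h (J j))"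
      unfolding \<Xi>_def by (rule limI)
  qed
  ultimately show ?thesis by blast
qed

end

section \<open>Smooth functionals along fibres\<close>

lemma has_derivative_partials_coordinates:
  fixes g :: "(nat \<Rightarrow> real) \<Rightarrow> real" and L :: "nat \<Rightarrow> 'e::real_normed_vector \<Rightarrow> real"
  assumes cont: "\<And>i. i < n \<Longrightarrow> continuous_on UNIV (part_deriv i g)"
    and diff: "\<And>i x. i < n \<Longrightarrow> (\<lambda>t. g (x(i := t))) differentiable (at (x i))"
    and L: "\<And>i y. i < n \<Longrightarrow> (L i has_derivative L' i y) (at y)"
  shows "((\<lambda>y. g (\<lambda>i. if i < n then L i y else z i)) has_derivative
     (\<lambda>v. \<Sum>i<n. part_deriv i g (\<lambda>i. if i < n then L i y else z i) * L' i y v)) (at y)"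
  using assms
proof (induction n arbitrary: z y)
  case 0
  then show ?case by simp
next
  case (Suc n)
  define X where "X y t = (\<lambda>i. if i < n then L i y else (z(n := t)) i)" for y t
  have X_upd: "(X y t)(n := t') = X y t'" for y t t' by (auto simp: X_def)
  have X_Suc: "(\<lambda>i. if i < Suc n then L i y else z i) = X y (L n y)" for y
    by (auto simp: X_def fun_eq_iff less_Suc_eq)
  have IH: "((\<lambda>y. g (X y t)) has_derivative (\<lambda>v. \<Sum>i<n. part_deriv i g (X y t) * L' i y v)) (at y)" for t y
    unfolding X_def by (rule Suc.IH) (use Suc.prems in auto)
  \<comment> \<open>The partial derivative in the last coordinate as a bounded linear map, the form
    in which \<open>has_derivative_partialsI\<close> takes it.\<close>
  define fy where "fy y t = part_deriv n g (X y t) *\<^sub>R (id_blinfun :: real \<Rightarrow>\<^sub>L real)" for y t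
  have fy: "((\<lambda>t. g (X y t)) has_derivative blinfun_apply (fy y t)) (at t)" for y t
  proof -
    have "(\<lambda>s. g ((X y t)(n := s))) differentiable (at ((X y t) n))"
      by (rule Suc.prems(2)) simp
    then have "(\<lambda>s. g (X y s)) differentiable (at t)" by (simp add: X_upd) (simp add: X_def)
    then obtain D where D: "((\<lambda>s. g (X y s)) has_field_derivative D) (at t)"
      by (auto simp: real_differentiable_def)
    then have "part_deriv n g (X y t) = D"
      unfolding part_deriv_def X_upd using DERIV_imp_deriv by (simp add: X_def)
    with D show ?thesis by (simp add: fy_def has_field_derivative_def scaleR_blinfun.rep_eq)
  qed
  have contX: "continuous_on UNIV (\<lambda>(y, t). X y t)"
  proof (rule continuous_on_coordinatewise_then_product)
    fix i
    have contL: "continuous_on UNIV (L i)" if "i < n"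
      using Suc.prems(3)[of i] that by (meson has_derivative_continuous_on has_derivative_at_withinI less_SucI)
    consider "i < n" | "i = n" | "i > n" by linarith
    then show "continuous_on UNIV (\<lambda>x. (case x of (y, t) \<Rightarrow> X y t) i)"
    proof cases
      case 1
      then have eq: "(\<lambda>x. (case x of (y, t) \<Rightarrow> X y t) i) = (\<lambda>x. L i (fst x))" by (auto simp: X_def)
      show ?thesis unfolding eq
        by (rule continuous_on_compose2[OF contL[OF 1] continuous_on_fst[OF continuous_on_id]]) simp
    next
      case 2
      then have eq: "(\<lambda>x. (case x of (y, t) \<Rightarrow> X y t) i) = snd" by (auto simp: X_def fun_eq_iff)
      show ?thesis unfolding eq by (intro continuous_on_snd[OF continuous_on_id, unfolded id_def] continuous_intros)
    next
      case 3
      then have eq: "(\<lambda>x. (case x of (y, t) \<Rightarrow> X y t) i) = (\<lambda>_. z i)" by (auto simp: X_def fun_eq_iff)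
      show ?thesis unfolding eq by (rule continuous_on_const)
    qed
  qed
  have "continuous_on UNIV (\<lambda>x. part_deriv n g ((\<lambda>(y, t). X y t) x))"
    by (rule continuous_on_compose2[OF Suc.prems(1) contX]) auto
  then have contfy: "continuous_on UNIV (\<lambda>(y, t). fy y t)"
    unfolding fy_def split_beta' by (intro continuous_intros) (simp add: split_beta')
  have "((\<lambda>(y, t). g (X y t)) has_derivative
      (\<lambda>(v, s). (\<Sum>i<n. part_deriv i g (X y (L n y)) * L' i y v) + fy y (L n y) s)) (at (y, L n y) within UNIV \<times> UNIV)"
  proof (rule has_derivative_partialsI)
    show "continuous (at (y, L n y) within UNIV \<times> UNIV) (\<lambda>(y, t). fy y t)"
      using contfy by (simp add: continuous_on_eq_continuous_at)
  qed (use IH fy in auto)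
  then have D: "((\<lambda>(y, t). g (X y t)) has_derivative
      (\<lambda>(v, s). (\<Sum>i<n. part_deriv i g (X y (L n y)) * L' i y v) + fy y (L n y) s)) (at (y, L n y))"
    by simp
  have "((\<lambda>y. (y, L n y)) has_derivative (\<lambda>v. (v, L' n y v))) (at y)"
    using Suc.prems(3)[of n] by (intro has_derivative_Pair has_derivative_ident) auto
  from has_derivative_compose[OF this D]
  have "((\<lambda>y. g (X y (L n y))) has_derivative
     (\<lambda>v. (\<Sum>i<n. part_deriv i g (X y (L n y)) * L' i y v) + fy y (L n y) (L' n y v))) (at y)" by simp
  then show ?case unfolding X_Suc by (simp add: fy_def scaleR_blinfun.rep_eq)
qed

lemma part_deriv_local:
  assumes "\<And>x y. (\<forall>i<n. x i = y i) \<Longrightarrow> f x = f y" "\<forall>i<n. x i = y i" "i < n"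
  shows "part_deriv i f x = part_deriv i f y"
proof -
  have "f (x(i := t)) = f (y(i := t))" for t using assms(2) by (intro assms(1)) auto
  then have "(\<lambda>t. f (x(i := t))) = (\<lambda>t. f (y(i := t)))" by (rule ext)
  moreover have "x i = y i" using assms by blast
  ultimately show ?thesis unfolding part_deriv_def by (simp only:)
qed

text \<open>The derivatives along a fibre are again functionals of the shifted path:
  \<open>\<Gamma>1 I\<close> differentiates in direction \<open>I\<close>, and
  \<open>\<Gamma>2 I' I\<close> differentiates \<open>\<Gamma>1 I\<close> in direction
  \<open>I'\<close>. In this form \<open>nn_integral_shifted_path\<close> controls them as it
  controls the functional itself.\<close>

definition fibre_smooth ::
  "('n \<Rightarrow> real \<Rightarrow> 'a \<Rightarrow> real) \<Rightarrow> ('d::finite \<Rightarrow> 'n \<times> real) \<Rightarrow> (('n \<times> real \<Rightarrow> real) \<Rightarrow> real) \<Rightarrow>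
   ('n \<times> real \<Rightarrow> ('n \<times> real \<Rightarrow> real) \<Rightarrow> real) \<Rightarrow>
   ('n \<times> real \<Rightarrow> 'n \<times> real \<Rightarrow> ('n \<times> real \<Rightarrow> real) \<Rightarrow> real) \<Rightarrow> 'a \<Rightarrow> bool" where
  "fibre_smooth W J \<Gamma>0 \<Gamma>1 \<Gamma>2 \<omega> \<longleftrightarrow>
      (\<forall>y. ((\<lambda>y. \<Gamma>0 (shifted_path W J y \<omega>)) has_derivative
         (\<lambda>v. \<Sum>j\<in>UNIV. v $ j * \<Gamma>1 (J j) (shifted_path W J y \<omega>))) (at y)) \<and>
      (\<forall>I y. ((\<lambda>y. \<Gamma>1 I (shifted_path W J y \<omega>)) has_derivative
         (\<lambda>v. \<Sum>j\<in>UNIV. v $ j * \<Gamma>2 (J j) I (shifted_path W J y \<omega>))) (at y)) \<and>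
      (\<forall>I I'. continuous_on UNIV (\<lambda>y. \<Gamma>2 I I' (shifted_path W J y \<omega>)))"

context brownian
begin

text \<open>Each Wiener integral is affine in \<open>y\<close> along a fibre, so the chain rule
  applies to a smooth function of them and reproduces the pairings with \<open>DG\<close> and
  \<open>D2G\<close>. The lifted functionals are the same for all \<open>J\<close>.\<close>

lemma smooth_functional_path:
  fixes \<iota> :: "'d::finite itself"
  assumes "smooth_functional M W G DG D2G"
  shows "\<exists>\<Gamma>0 \<Gamma>1 \<Gamma>2. \<Gamma>0 \<in> borel_measurable path_measure \<and>
    (\<forall>I. \<Gamma>1 I \<in> borel_measurable path_measure) \<and>
    (\<forall>I I'. \<Gamma>2 I I' \<in> borel_measurable path_measure) \<and>
    (\<forall>\<omega>. DG \<omega> \<in> borel_measurable noise \<and> integrable noise (\<lambda>z. (DG \<omega> z)\<^sup>2)) \<and>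
    (\<forall>\<omega>. D2G \<omega> \<in> borel_measurable (noise \<Otimes>\<^sub>M noise) \<and> integrable (noise \<Otimes>\<^sub>M noise) (\<lambda>z. (D2G \<omega> z)\<^sup>2)) \<and>
    (AE \<omega> in M. \<forall>J :: 'd \<Rightarrow> 'n \<times> real. (\<forall>j. snd (J j) \<in> {0..1}) \<longrightarrow>
      \<Gamma>0 (shifted_path W J 0 \<omega>) = G \<omega> \<and>
      (\<forall>I. snd I \<in> {0..1} \<longrightarrow> \<Gamma>1 I (shifted_path W J 0 \<omega>) = pairing (DG \<omega>) I) \<and>
      (\<forall>I I'. snd I \<in> {0..1} \<longrightarrow> snd I' \<in> {0..1} \<longrightarrow> \<Gamma>2 I I' (shifted_path W J 0 \<omega>) = pairing2 (D2G \<omega>) I I') \<and>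
      fibre_smooth W J \<Gamma>0 \<Gamma>1 \<Gamma>2 \<omega>)"
proof -
  obtain n f h X where sm: "smooth_poly_growth n f" and X: "\<And>i. i < n \<Longrightarrow> is_wiener_integral M W (h i) (X i)"
    and G: "G = (\<lambda>\<omega>. f (\<lambda>i. X i \<omega>))"
    and DG: "DG = (\<lambda>\<omega> z. \<Sum>i<n. part_deriv i f (\<lambda>i. X i \<omega>) * h i z)"
    and D2G: "D2G = (\<lambda>\<omega> (z, z'). \<Sum>i<n. \<Sum>j<n. part_deriv i (part_deriv j f) (\<lambda>i. X i \<omega>) * h i z * h j z')"
    using assms unfolding smooth_functional_def by blast
  have h: "h i \<in> borel_measurable noise" "integrable noise (\<lambda>z. (h i z)\<^sup>2)" if "i < n" for i
    using X[OF that] by (auto simp: is_wiener_integral_def)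
  have loc: "f x = f y" if "\<forall>i<n. x i = y i" for x y
    using sm that unfolding smooth_poly_growth_def by blast
  define lifts where "lifts i \<Xi> \<longleftrightarrow> \<Xi> \<in> borel_measurable path_measure \<and> (AE \<omega> in M. \<forall>(J :: 'd \<Rightarrow> _) y.
     (\<forall>j. snd (J j) \<in> {0..1}) \<longrightarrow> \<Xi> (shifted_path W J y \<omega>) = X i \<omega> + (\<Sum>j\<in>UNIV. y $ j * pairing (h i) (J j)))" for i \<Xi>
  have "\<exists>\<Xi>. lifts i \<Xi>" if "i < n" for i
    using wiener_integral_path[OF X[OF that]] unfolding lifts_def by blast
  then obtain \<Xi> where lifts: "\<And>i. i < n \<Longrightarrow> lifts i (\<Xi> i)"
    by metis
  have \<Xi>m: "\<Xi> i \<in> borel_measurable path_measure"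
    and \<Xi>: "AE \<omega> in M. \<forall>(J :: 'd \<Rightarrow> _) y.
     (\<forall>j. snd (J j) \<in> {0..1}) \<longrightarrow> \<Xi> i (shifted_path W J y \<omega>) = X i \<omega> + (\<Sum>j\<in>UNIV. y $ j * pairing (h i) (J j))"
    if "i < n" for i
    using lifts[OF that] by (simp_all add: lifts_def)
  have sm': "let g = foldr part_deriv is f in continuous_on UNIV g \<and> (\<forall>i<n. \<forall>x. (\<lambda>t. g (x(i := t))) differentiable (at (x i)))"
    if "set is \<subseteq> {..<n}" for "is"
    using sm that unfolding smooth_poly_growth_def Let_def lists_eq_set by blast
  have cont0: "continuous_on UNIV f" and diff0: "\<And>i x. i < n \<Longrightarrow> (\<lambda>t. f (x(i := t))) differentiable (at (x i))"
    using sm'[of "[]"] by (auto simp: Let_def)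
  have cont1: "continuous_on UNIV (part_deriv i f)"
    and diff1: "\<And>j x. j < n \<Longrightarrow> (\<lambda>t. part_deriv i f (x(j := t))) differentiable (at (x j))" if "i < n" for i
    using sm'[of "[i]"] that by (auto simp: Let_def)
  have cont2: "continuous_on UNIV (part_deriv i (part_deriv j f))" if "i < n" "j < n" for i j
    using sm'[of "[i, j]"] that by (auto simp: Let_def)
  have loc1: "part_deriv i f x = part_deriv i f y" if "\<forall>i<n. x i = y i" "i < n" for x y i
    using loc that by (rule part_deriv_local)
  have loc2: "part_deriv i (part_deriv j f) x = part_deriv i (part_deriv j f) y" if "\<forall>i<n. x i = y i" "i < n" "j < n" for x y i j
    using part_deriv_local[of n "part_deriv j f" x y i] loc1 that by blast
  \<comment> \<open>Coordinates from \<open>n\<close> on are set to 0, whereas \<open>X i\<close> is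
    arbitrary there; \<open>f\<close> and its partial derivatives depend on the first
    \<open>n\<close> coordinates only and do not see the difference.\<close>
  define Y where "Y \<pi> = (\<lambda>i. if i < n then \<Xi> i \<pi> else 0)" for \<pi>
  have Ym: "Y \<in> measurable path_measure borel"
    unfolding Y_def
  proof (rule measurable_coordinatewise_then_product)
    show "(\<lambda>\<pi>. if i < n then \<Xi> i \<pi> else 0) \<in> borel_measurable path_measure" for i
      using \<Xi>m by (cases "i < n") auto
  qed
  define \<Gamma>0 where "\<Gamma>0 = (\<lambda>\<pi>. f (Y \<pi>))"
  define \<Gamma>1 where "\<Gamma>1 = (\<lambda>I \<pi>. \<Sum>i<n. part_deriv i f (Y \<pi>) * pairing (h i) I)"
  define \<Gamma>2 where "\<Gamma>2 = (\<lambda>I I' \<pi>. \<Sum>i<n. \<Sum>j<n. part_deriv i (part_deriv j f) (Y \<pi>) * pairing (h i) I * pairing (h j) I')"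
  have m0: "\<Gamma>0 \<in> borel_measurable path_measure"
    unfolding \<Gamma>0_def by (rule measurable_compose[OF Ym borel_measurable_continuous_onI[OF cont0]])
  have m1: "\<Gamma>1 I \<in> borel_measurable path_measure" for I
    unfolding \<Gamma>1_def
    by (intro borel_measurable_sum borel_measurable_times borel_measurable_const
        measurable_compose[OF Ym borel_measurable_continuous_onI[OF cont1]]) auto
  have m2: "\<Gamma>2 I I' \<in> borel_measurable path_measure" for I I'
    unfolding \<Gamma>2_def
    by (intro borel_measurable_sum borel_measurable_times borel_measurable_const
        measurable_compose[OF Ym borel_measurable_continuous_onI[OF cont2]]) auto
  have sq: "integrable N (\<lambda>z. (\<Sum>i\<in>A. u i z)\<^sup>2)"
    if A: "finite A" and u: "\<And>i. i \<in> A \<Longrightarrow> u i \<in> borel_measurable N" "\<And>i. i \<in> A \<Longrightarrow> integrable N (\<lambda>z. (u i z)\<^sup>2)"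
    for A :: "'i set" and u :: "'i \<Rightarrow> 'b \<Rightarrow> real" and N
    using A u
  proof (induction A rule: finite_induct)
    case (insert i A)
    have [measurable]: "u i \<in> borel_measurable N" "\<And>i. i \<in> A \<Longrightarrow> u i \<in> borel_measurable N" using insert by auto
    have "integrable N (\<lambda>z. (u i z - (- (\<Sum>i\<in>A. u i z)))\<^sup>2)"
      using insert by (intro integrable_square_diff) auto
    then show ?case using insert by simp
  qed simp
  have DGm: "DG \<omega> \<in> borel_measurable noise" "integrable noise (\<lambda>z. (DG \<omega> z)\<^sup>2)" for \<omega>
  proof -
    have *: "(\<lambda>z. part_deriv i f (\<lambda>i. X i \<omega>) * h i z) \<in> borel_measurable noise"
      "integrable noise (\<lambda>z. (part_deriv i f (\<lambda>i. X i \<omega>) * h i z)\<^sup>2)" if "i < n" for i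
      using h[OF that] by (auto simp: power_mult_distrib)
    show "DG \<omega> \<in> borel_measurable noise" unfolding DG by (intro borel_measurable_sum *) auto
    show "integrable noise (\<lambda>z. (DG \<omega> z)\<^sup>2)" unfolding DG by (intro sq *) auto
  qed
  have D2G': "D2G \<omega> = (\<lambda>z. \<Sum>i<n. \<Sum>j<n. part_deriv i (part_deriv j f) (\<lambda>i. X i \<omega>) * (h i (fst z) * h j (snd z)))" for \<omega>
    by (auto simp: D2G fun_eq_iff mult.assoc)
  have hm2: "(\<lambda>z. h i (fst z) * h j (snd z)) \<in> borel_measurable (noise \<Otimes>\<^sub>M noise)" if "i < n" "j < n" for i j
    using h(1)[OF that(1)] h(1)[OF that(2)] by measurable
  have D2Gm: "D2G \<omega> \<in> borel_measurable (noise \<Otimes>\<^sub>M noise)" "integrable (noise \<Otimes>\<^sub>M noise) (\<lambda>z. (D2G \<omega> z)\<^sup>2)" for \<omega>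
  proof -
    have *: "(\<lambda>z. part_deriv i (part_deriv j f) (\<lambda>i. X i \<omega>) * (h i (fst z) * h j (snd z))) \<in> borel_measurable (noise \<Otimes>\<^sub>M noise)"
      if "i < n" "j < n" for i j by (intro borel_measurable_times borel_measurable_const hm2 that)
    have **: "integrable (noise \<Otimes>\<^sub>M noise) (\<lambda>z. (part_deriv i (part_deriv j f) (\<lambda>i. X i \<omega>) * (h i (fst z) * h j (snd z)))\<^sup>2)"
      if "i < n" "j < n" for i j
    proof -
      have "integrable (noise \<Otimes>\<^sub>M noise) (\<lambda>z. (h i (fst z))\<^sup>2 * (h j (snd z))\<^sup>2)"
        using has_bochner_integral_product[OF h(2)[OF that(1)] h(2)[OF that(2)]] by (simp add: has_bochner_integral_iff)
      then show ?thesis by (simp add: power_mult_distrib)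
    qed
    show "D2G \<omega> \<in> borel_measurable (noise \<Otimes>\<^sub>M noise)" unfolding D2G' by (intro borel_measurable_sum *) auto
    show "integrable (noise \<Otimes>\<^sub>M noise) (\<lambda>z. (D2G \<omega> z)\<^sup>2)"
      unfolding D2G' by (intro sq borel_measurable_sum * **) auto
  qed
  have pair1: "pairing (DG \<omega>) I = (\<Sum>i<n. part_deriv i f (\<lambda>i. X i \<omega>) * pairing (h i) I)" if "snd I \<in> {0..1}" for I \<omega>
  proof -
    have "integrable noise (\<lambda>z. h i z * indicator (cell I) z)" if "i < n" for i
      using h[OF that] \<open>snd I \<in> {0..1}\<close> by (rule integrable_pairing)
    then show ?thesis
      unfolding pairing_def DG sum_distrib_right mult.assoc
      by (subst Bochner_Integration.integral_sum) auto
  qed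
  have pair2: "pairing2 (D2G \<omega>) I I' = (\<Sum>i<n. \<Sum>j<n. part_deriv i (part_deriv j f) (\<lambda>i. X i \<omega>) * pairing (h i) I * pairing (h j) I')"
    if I: "snd I \<in> {0..1}" "snd I' \<in> {0..1}" for I I' \<omega>
  proof -
    have hb: "has_bochner_integral (noise \<Otimes>\<^sub>M noise) (\<lambda>z. (h i (fst z) * h j (snd z)) * indicator (cell I \<times> cell I') z) (pairing (h i) I * pairing (h j) I')"
      if "i < n" "j < n" for i j
    proof -
      have "(h i (fst z) * h j (snd z)) * indicator (cell I \<times> cell I') z =
        (h i (fst z) * indicator (cell I) (fst z)) * (h j (snd z) * indicator (cell I') (snd z))" for z
        by (cases z) (simp add: indicator_times)
      then show ?thesis unfolding pairing_def
        using has_bochner_integral_product[OF integrable_pairing[OF h[OF that(1)] I(1)] integrable_pairing[OF h[OF that(2)] I(2)]]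
        by (simp only:)
    qed
    have "has_bochner_integral (noise \<Otimes>\<^sub>M noise) (\<lambda>z. D2G \<omega> z * indicator (cell I \<times> cell I') z)
      (\<Sum>i<n. \<Sum>j<n. part_deriv i (part_deriv j f) (\<lambda>i. X i \<omega>) * (pairing (h i) I * pairing (h j) I'))"
      unfolding D2G' sum_distrib_right mult.assoc[of "part_deriv _ _ _" "h _ _ * _"]
      by (intro has_bochner_integral_sum has_bochner_integral_mult_right hb) auto
    then show ?thesis by (simp add: pairing2_def has_bochner_integral_iff mult.assoc)
  qed
  have "AE \<omega> in M. \<forall>i\<in>{..<n}. \<forall>(J :: 'd::finite \<Rightarrow> _) y.
     (\<forall>j. snd (J j) \<in> {0..1}) \<longrightarrow> \<Xi> i (shifted_path W J y \<omega>) = X i \<omega> + (\<Sum>j\<in>UNIV. y $ j * pairing (h i) (J j))"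
    using \<Xi> by (intro AE_finite_allI) auto
  then have AE: "AE \<omega> in M. \<forall>J :: 'd \<Rightarrow> 'n \<times> real. (\<forall>j. snd (J j) \<in> {0..1}) \<longrightarrow>
      \<Gamma>0 (shifted_path W J 0 \<omega>) = G \<omega> \<and>
      (\<forall>I. snd I \<in> {0..1} \<longrightarrow> \<Gamma>1 I (shifted_path W J 0 \<omega>) = pairing (DG \<omega>) I) \<and>
      (\<forall>I I'. snd I \<in> {0..1} \<longrightarrow> snd I' \<in> {0..1} \<longrightarrow> \<Gamma>2 I I' (shifted_path W J 0 \<omega>) = pairing2 (D2G \<omega>) I I') \<and>
      fibre_smooth W J \<Gamma>0 \<Gamma>1 \<Gamma>2 \<omega>"
  proof (eventually_elim, intro allI impI)
    case (elim \<omega>)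
    fix J :: "'d \<Rightarrow> 'n \<times> real" assume J: "\<forall>j. snd (J j) \<in> {0..1}"
    define L where "L i y = X i \<omega> + (\<Sum>j\<in>UNIV. y $ j * pairing (h i) (J j))" for i and y :: "real^'d"
    define L' where "L' i v = (\<Sum>j\<in>UNIV. v $ j * pairing (h i) (J j))" for i and v :: "real^'d"
    have Y_L: "Y (shifted_path W J y \<omega>) = (\<lambda>i. if i < n then L i y else 0)" for y
      using elim J by (auto simp: Y_def L_def fun_eq_iff)
    have L: "(L i has_derivative L' i) (at y)" for i y
      unfolding L_def L'_def
      by (auto intro!: derivative_eq_intros bounded_linear_imp_has_derivative[OF bounded_linear_vec_nth])
    have Y0: "\<forall>i<n. Y (shifted_path W J 0 \<omega>) i = X i \<omega>"
      by (simp add: Y_L L_def)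
    have contY: "continuous_on UNIV (\<lambda>y. Y (shifted_path W J y \<omega>))"
      unfolding Y_L
    proof (rule continuous_on_coordinatewise_then_product)
      show "continuous_on UNIV (\<lambda>y. if i < n then L i y else 0)" for i
        by (cases "i < n") (auto simp: L_def intro!: continuous_intros)
    qed
    show "\<Gamma>0 (shifted_path W J 0 \<omega>) = G \<omega> \<and>
      (\<forall>I. snd I \<in> {0..1} \<longrightarrow> \<Gamma>1 I (shifted_path W J 0 \<omega>) = pairing (DG \<omega>) I) \<and>
      (\<forall>I I'. snd I \<in> {0..1} \<longrightarrow> snd I' \<in> {0..1} \<longrightarrow> \<Gamma>2 I I' (shifted_path W J 0 \<omega>) = pairing2 (D2G \<omega>) I I') \<and>
      fibre_smooth W J \<Gamma>0 \<Gamma>1 \<Gamma>2 \<omega>"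
      unfolding fibre_smooth_def
    proof (intro conjI allI impI)
      show "\<Gamma>0 (shifted_path W J 0 \<omega>) = G \<omega>"
        unfolding \<Gamma>0_def G by (rule loc) (rule Y0)
      show "\<Gamma>1 I (shifted_path W J 0 \<omega>) = pairing (DG \<omega>) I" if "snd I \<in> {0..1}" for I
        unfolding \<Gamma>1_def pair1[OF that] by (intro sum.cong refl arg_cong2[where f = "(*)"] loc1 Y0) auto
      show "\<Gamma>2 I I' (shifted_path W J 0 \<omega>) = pairing2 (D2G \<omega>) I I'" if "snd I \<in> {0..1}" "snd I' \<in> {0..1}" for I I'
        unfolding \<Gamma>2_def pair2[OF that] by (intro sum.cong refl arg_cong2[where f = "(*)"] loc2 Y0) auto
      show "((\<lambda>y. \<Gamma>0 (shifted_path W J y \<omega>)) has_derivative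
         (\<lambda>v. \<Sum>j\<in>UNIV. v $ j * \<Gamma>1 (J j) (shifted_path W J y \<omega>))) (at y)" for y
      proof -
        have "((\<lambda>y. f (\<lambda>i. if i < n then L i y else 0)) has_derivative
          (\<lambda>v. \<Sum>i<n. part_deriv i f (\<lambda>i. if i < n then L i y else 0) * L' i v)) (at y)"
          by (rule has_derivative_partials_coordinates[OF cont1 diff0 L])
        moreover have "(\<Sum>i<n. part_deriv i f (\<lambda>i. if i < n then L i y else 0) * L' i v) =
           (\<Sum>j\<in>UNIV. v $ j * \<Gamma>1 (J j) (shifted_path W J y \<omega>))" for v
          unfolding \<Gamma>1_def Y_L L'_def sum_distrib_left by (subst sum.swap) (simp add: mult_ac)
        ultimately show ?thesis unfolding \<Gamma>0_def Y_L by simp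
      qed
      show "((\<lambda>y. \<Gamma>1 I (shifted_path W J y \<omega>)) has_derivative
         (\<lambda>v. \<Sum>j\<in>UNIV. v $ j * \<Gamma>2 (J j) I (shifted_path W J y \<omega>))) (at y)" for I y
      proof -
        have "((\<lambda>y. \<Sum>k<n. part_deriv k f (\<lambda>i. if i < n then L i y else 0) * pairing (h k) I) has_derivative
          (\<lambda>v. \<Sum>k<n. (\<Sum>i<n. part_deriv i (part_deriv k f) (\<lambda>i. if i < n then L i y else 0) * L' i v) * pairing (h k) I)) (at y)"
          by (intro has_derivative_sum has_derivative_mult_left has_derivative_partials_coordinates cont2 diff1 L) auto
        moreover have "(\<Sum>k<n. (\<Sum>i<n. part_deriv i (part_deriv k f) (\<lambda>i. if i < n then L i y else 0) * L' i v) * pairing (h k) I) =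
           (\<Sum>j\<in>UNIV. v $ j * \<Gamma>2 (J j) I (shifted_path W J y \<omega>))" for v
        proof -
          have "(\<Sum>k<n. (\<Sum>i<n. part_deriv i (part_deriv k f) (\<lambda>i. if i < n then L i y else 0) * L' i v) * pairing (h k) I) =
            (\<Sum>k<n. \<Sum>i<n. \<Sum>j\<in>UNIV. v $ j * (part_deriv i (part_deriv k f) (\<lambda>i. if i < n then L i y else 0) * pairing (h i) (J j) * pairing (h k) I))"
            unfolding L'_def sum_distrib_left sum_distrib_right by (simp add: mult_ac)
          also have "\<dots> = (\<Sum>i<n. \<Sum>k<n. \<Sum>j\<in>UNIV. v $ j * (part_deriv i (part_deriv k f) (\<lambda>i. if i < n then L i y else 0) * pairing (h i) (J j) * pairing (h k) I))"
            by (rule sum.swap)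
          also have "\<dots> = (\<Sum>i<n. \<Sum>j\<in>UNIV. \<Sum>k<n. v $ j * (part_deriv i (part_deriv k f) (\<lambda>i. if i < n then L i y else 0) * pairing (h i) (J j) * pairing (h k) I))"
            by (intro sum.cong refl sum.swap)
          also have "\<dots> = (\<Sum>j\<in>UNIV. \<Sum>i<n. \<Sum>k<n. v $ j * (part_deriv i (part_deriv k f) (\<lambda>i. if i < n then L i y else 0) * pairing (h i) (J j) * pairing (h k) I))"
            by (rule sum.swap)
          finally show ?thesis unfolding \<Gamma>2_def Y_L by (simp add: sum_distrib_left)
        qed
        ultimately show ?thesis unfolding \<Gamma>1_def Y_L by simp
      qed
      show "continuous_on UNIV (\<lambda>y. \<Gamma>2 I I' (shifted_path W J y \<omega>))" for I I'
        unfolding \<Gamma>2_def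
        by (intro continuous_on_sum continuous_on_mult continuous_on_const continuous_on_compose2[OF cont2 contY]) auto
    qed
  qed
  from m0 m1 m2 DGm D2Gm AE show ?thesis
    by (intro exI[of _ \<Gamma>0] exI[of _ \<Gamma>1] exI[of _ \<Gamma>2] conjI allI)
qed

end

section \<open>Malliavin differentiable functionals along fibres\<close>

lemma powr_add_le:
  fixes a b p :: real
  assumes "0 \<le> a" "0 \<le> b" "0 \<le> p"
  shows "(a + b) powr p \<le> 2 powr p * (a powr p + b powr p)"
proof -
  have "(a + b) powr p \<le> (2 * max a b) powr p" using assms by (intro powr_mono2) auto
  also have "\<dots> = 2 powr p * (max a b) powr p" using assms by (simp add: powr_mult)
  also have "(max a b) powr p \<le> a powr p + b powr p" by (auto simp: max_def)
  finally show ?thesis by simp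
qed

text \<open>Chosen so that multiplying the increments by \<open>2 ^ m\<close> before taking
  \<open>p\<close>-th powers still leaves the summable bound \<open>(1/2) ^ m\<close>.\<close>

definition path_error :: "real \<Rightarrow> nat \<Rightarrow> real" where
  "path_error p m = (1/2) ^ m * (2 ^ m) powr (- p)"

lemma path_error_pos: "0 < path_error p m"
  by (simp add: path_error_def)

context brownian
begin

text \<open>At \<open>y = 0\<close> the directions drop out, so statements at the unshifted path can
  be shared between different \<open>J\<close>.\<close>

lemma shifted_path_0: "shifted_path W J 0 = shifted_path W J' 0"
  by (simp add: shifted_path_def fun_eq_iff)

lemma shift_weight_pos: "0 < shift_weight W J y \<omega>"
  by (simp add: shift_weight_def)

lemma continuous_on_shift_weight: "continuous_on UNIV (\<lambda>y. shift_weight W J y \<omega>)"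
  unfolding shift_weight_def by (intro continuous_intros) auto

text \<open>The \<open>p\<close>-th moments of the errors are summable, hence the errors tend to
  zero almost surely. This identifies the limits taken on path space with the given random
  variables.\<close>

lemma AE_tendsto_of_error:
  assumes p: "0 < p" and [measurable]: "\<And>m. X m \<in> borel_measurable M" "u \<in> borel_measurable M"
    and err: "\<And>m. (\<integral>\<^sup>+\<omega>. ennreal (\<bar>X m \<omega> - u \<omega>\<bar> powr p) \<partial>M) \<le> ennreal (path_error p m)"
  shows "AE \<omega> in M. (\<lambda>m. X m \<omega>) \<longlonglongrightarrow> u \<omega>"
proof -
  have "AE \<omega> in M. (\<Sum>m. ennreal (\<bar>X m \<omega> - u \<omega>\<bar> powr p)) < \<top>"
  proof (rule AE_summable_of_geometric[where c = 1])
    fix m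
    have "path_error p m \<le> 1 * (1/2) ^ m"
    proof -
      have "(2 ^ m) powr (- p) \<le> (1 :: real)"
        using p ge_one_powr_ge_zero[of "2 ^ m" p] by (simp add: powr_minus inverse_le_1_iff)
      then show ?thesis unfolding path_error_def by (simp add: mult_left_le)
    qed
    then show "(\<integral>\<^sup>+\<omega>. ennreal (\<bar>X m \<omega> - u \<omega>\<bar> powr p) \<partial>M) \<le> ennreal (1 * (1/2) ^ m)"
      using err[of m] by (meson ennreal_leI order_trans)
  qed simp_all
  then show ?thesis
  proof eventually_elim
    case (elim \<omega>)
    then have "summable (\<lambda>m. \<bar>X m \<omega> - u \<omega>\<bar> powr p)"
      by (intro summable_suminf_not_top) auto
    then have "(\<lambda>m. \<bar>X m \<omega> - u \<omega>\<bar> powr p) \<longlonglongrightarrow> 0" by (rule summable_LIMSEQ_zero)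
    then have "(\<lambda>m. (\<bar>X m \<omega> - u \<omega>\<bar> powr p) powr (1 / p)) \<longlonglongrightarrow> 0"
      by (rule tendsto_zero_powrI[OF _ tendsto_const]) (use p in auto)
    moreover have "(\<bar>X m \<omega> - u \<omega>\<bar> powr p) powr (1 / p) = \<bar>X m \<omega> - u \<omega>\<bar>" for m
      using p by (simp add: powr_powr)
    ultimately have "(\<lambda>m. \<bar>X m \<omega> - u \<omega>\<bar>) \<longlonglongrightarrow> 0" by (simp only:)
    then have "(\<lambda>m. X m \<omega> - u \<omega>) \<longlonglongrightarrow> 0" by (simp add: tendsto_rabs_zero_iff)
    then show ?case by (rule LIM_zero_cancel)
  qed
qed

text \<open>By Fubini and Girsanov, the weighted fibre integral of the rescaled increment has as
  expectation the volume of the ball times the moment at the unshifted path, of order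
  \<open>(1/2) ^ m\<close>. Almost surely these integrals are summable and hence bounded in
  \<open>m\<close>; the weight, positive and continuous in \<open>y\<close>, can then be
  removed.\<close>

lemma AE_bounded_fibre_increments:
  fixes J :: "'d::finite \<Rightarrow> 'n \<times> real"
  assumes p: "0 < p" and J: "\<And>j. snd (J j) \<in> {0..1}"
    and U[measurable]: "\<And>m. U m \<in> borel_measurable path_measure" and [measurable]: "u \<in> borel_measurable M"
    and err: "\<And>m. (\<integral>\<^sup>+\<omega>. ennreal (\<bar>U m (shifted_path W J 0 \<omega>) - u \<omega>\<bar> powr p) \<partial>M) \<le> ennreal (path_error p m)"
  shows "AE \<omega> in M. \<exists>K\<ge>0. \<forall>m. (\<integral>\<^sup>+y. ennreal (\<bar>2 ^ m * (U (Suc m) (shifted_path W J y \<omega>) - U m (shifted_path W J y \<omega>))\<bar> powr p)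
     * indicator (ball 0 1) y \<partial>lborel) \<le> ennreal K"
proof -
  let ?B = "ball 0 1 :: (real^'d) set"
  have Bm[measurable]: "?B \<in> sets borel" by simp
  interpret P: pair_sigma_finite M "lborel :: (real^'d) measure" ..
  note spm[measurable] = shifted_path_measurable[of J]
  note wm[measurable] = shift_weight_measurable[OF J]
  define D where "D m \<pi> = ennreal (\<bar>2 ^ m * (U (Suc m) \<pi> - U m \<pi>)\<bar> powr p)" for m \<pi>
  have Dm[measurable]: "D m \<in> borel_measurable path_measure" for m unfolding D_def by measurable
  have Dm2: "(\<lambda>(\<omega>, y). D m (shifted_path W J y \<omega>)) \<in> borel_measurable (M \<Otimes>\<^sub>M borel)" for m
    using measurable_compose[OF spm Dm] by (simp add: split_beta')
  define T where "T m \<omega> = (\<integral>\<^sup>+y. ennreal (shift_weight W J y \<omega>) * D m (shifted_path W J y \<omega>) * indicator ?B y \<partial>lborel)" for m \<omega>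
  have Tm0: "(\<lambda>(\<omega>, y). ennreal (shift_weight W J y \<omega>) * D m (shifted_path W J y \<omega>) * indicator ?B y) \<in> borel_measurable (M \<Otimes>\<^sub>M lborel)" for m
    using wm Dm2[of m] unfolding split_beta' by measurable
  have Tm[measurable]: "T m \<in> borel_measurable M" for m
    unfolding T_def using lborel.borel_measurable_nn_integral[OF Tm0] .
  define c where "c = measure lborel ?B * (2 powr p * 2)"
  have em: "emeasure lborel ?B = ennreal (measure lborel ?B)"
    using emeasure_bounded_finite[of ?B] by (simp add: emeasure_eq_ennreal_measure)
  \<comment> \<open>Both terms of the increment are compared with \<open>u\<close>; the factor
    \<open>(2 ^ m) powr p\<close> created by the rescaling cancels against the one in
    \<open>path_error\<close>.\<close>
  have Dint: "(\<integral>\<^sup>+\<omega>. D m (shifted_path W J 0 \<omega>) \<partial>M) \<le> ennreal ((2 powr p * 2) * (1/2) ^ m)" for m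
  proof -
    define a where "a = (\<lambda>\<omega>. \<bar>U (Suc m) (shifted_path W J 0 \<omega>) - u \<omega>\<bar>)"
    define b where "b = (\<lambda>\<omega>. \<bar>U m (shifted_path W J 0 \<omega>) - u \<omega>\<bar>)"
    have [measurable]: "a \<in> borel_measurable M" "b \<in> borel_measurable M" unfolding a_def b_def by measurable
    define q where "q = (2 ^ m :: real) powr p"
    have q: "q > 0" by (simp add: q_def)
    have "D m (shifted_path W J 0 \<omega>) \<le> ennreal (q * 2 powr p) * (ennreal (a \<omega> powr p) + ennreal (b \<omega> powr p))" for \<omega>
    proof -
      have "\<bar>2 ^ m * (U (Suc m) (shifted_path W J 0 \<omega>) - U m (shifted_path W J 0 \<omega>))\<bar> powr p \<le> (2 ^ m * (a \<omega> + b \<omega>)) powr p"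
        using p by (intro powr_mono2) (auto simp: abs_mult a_def b_def)
      also have "\<dots> = q * (a \<omega> + b \<omega>) powr p"
        by (simp add: q_def powr_mult a_def b_def)
      also have "\<dots> \<le> q * (2 powr p * (a \<omega> powr p + b \<omega> powr p))"
        using q p by (intro mult_left_mono powr_add_le) (auto simp: a_def b_def)
      finally have "D m (shifted_path W J 0 \<omega>) \<le> ennreal (q * (2 powr p * (a \<omega> powr p + b \<omega> powr p)))"
        unfolding D_def by (rule ennreal_leI)
      also have "\<dots> = ennreal (q * 2 powr p) * (ennreal (a \<omega> powr p) + ennreal (b \<omega> powr p))"
        using q by (simp add: ennreal_mult'[symmetric] ennreal_plus[symmetric] mult.assoc del: ennreal_plus)
      finally show ?thesis .
    qed
    then have "(\<integral>\<^sup>+\<omega>. D m (shifted_path W J 0 \<omega>) \<partial>M) \<le> (\<integral>\<^sup>+\<omega>. ennreal (q * 2 powr p) * (ennreal (a \<omega> powr p) + ennreal (b \<omega> powr p)) \<partial>M)"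
      by (rule nn_integral_mono)
    also have "\<dots> = ennreal (q * 2 powr p) * ((\<integral>\<^sup>+\<omega>. ennreal (a \<omega> powr p) \<partial>M) + (\<integral>\<^sup>+\<omega>. ennreal (b \<omega> powr p) \<partial>M))"
      by (subst nn_integral_cmult) (auto simp: nn_integral_add)
    also have "\<dots> \<le> ennreal (q * 2 powr p) * (ennreal (path_error p (Suc m)) + ennreal (path_error p m))"
      unfolding a_def b_def by (intro mult_left_mono add_mono err) auto
    also have "\<dots> \<le> ennreal (q * 2 powr p) * (ennreal (path_error p m) + ennreal (path_error p m))"
    proof (intro mult_left_mono add_mono ennreal_leI order_refl)
      have "(2 ^ Suc m) powr (- p) \<le> (2 ^ m :: real) powr (- p)"
        using p by (intro powr_mono2') auto
      then show "path_error p (Suc m) \<le> path_error p m"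
        unfolding path_error_def by (intro mult_mono) auto
    qed auto
    also have "\<dots> = ennreal (q * 2 powr p * (path_error p m + path_error p m))"
      using q path_error_pos[of p m] by (simp add: ennreal_mult'[symmetric] ennreal_plus[symmetric] del: ennreal_plus)
    also have "q * 2 powr p * (path_error p m + path_error p m) = (2 powr p * 2) * (1/2) ^ m * (q * (2 ^ m) powr (- p))"
      by (simp add: path_error_def algebra_simps)
    also have "q * (2 ^ m) powr (- p) = 1"
      by (simp add: q_def powr_minus field_simps)
    finally show ?thesis by simp
  qed
  have Tint: "(\<integral>\<^sup>+\<omega>. T m \<omega> \<partial>M) \<le> ennreal (c * (1/2) ^ m)" for m
  proof -
    have "(\<integral>\<^sup>+\<omega>. T m \<omega> \<partial>M) = (\<integral>\<^sup>+y. (\<integral>\<^sup>+\<omega>. ennreal (shift_weight W J y \<omega>) * D m (shifted_path W J y \<omega>) * indicator ?B y \<partial>M) \<partial>lborel)"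
      unfolding T_def by (rule P.Fubini'[symmetric, OF Tm0])
    \<comment> \<open>For fixed \<open>y\<close> the Girsanov identity removes the weight and the
      shift together.\<close>
    also have "\<dots> = (\<integral>\<^sup>+y. (\<integral>\<^sup>+\<omega>. D m (shifted_path W J 0 \<omega>) \<partial>M) * indicator ?B y \<partial>lborel)"
    proof (intro nn_integral_cong)
      fix y
      have [measurable]: "shift_weight W J y \<in> borel_measurable M" by (rule shift_weight_measurable'[OF J])
      show "(\<integral>\<^sup>+\<omega>. ennreal (shift_weight W J y \<omega>) * D m (shifted_path W J y \<omega>) * indicator ?B y \<partial>M) =
         (\<integral>\<^sup>+\<omega>. D m (shifted_path W J 0 \<omega>) \<partial>M) * indicator ?B y"
        using nn_integral_shifted_path[where J = J and y = y, OF J Dm[of m]] by (subst nn_integral_multc) auto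
    qed
    also have "\<dots> = (\<integral>\<^sup>+\<omega>. D m (shifted_path W J 0 \<omega>) \<partial>M) * ennreal (measure lborel ?B)"
      by (simp add: nn_integral_cmult_indicator em)
    also have "\<dots> \<le> ennreal ((2 powr p * 2) * (1/2) ^ m) * ennreal (measure lborel ?B)"
      by (intro mult_right_mono Dint) auto
    also have "\<dots> = ennreal (c * (1/2) ^ m)"
      by (simp add: c_def ennreal_mult'[symmetric] mult_ac)
    finally show ?thesis .
  qed
  have "AE \<omega> in M. (\<Sum>m. T m \<omega>) < \<top>"
    by (rule AE_summable_of_geometric[OF _ Tint]) (auto simp: c_def)
  then show ?thesis
    using AE_space
  proof eventually_elim
    case (elim \<omega>)
    then obtain S where S: "0 \<le> S" "(\<Sum>m. T m \<omega>) = ennreal S" by (cases "\<Sum>m. T m \<omega>") auto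
    \<comment> \<open>On the compact closed ball the weight attains a positive minimum, depending on
      \<omega>; dividing by it gives an unweighted bound.\<close>
    have "\<exists>x\<in>cball 0 1. \<forall>y\<in>cball 0 1. shift_weight W J x \<omega> \<le> shift_weight W J y \<omega>"
      by (rule continuous_attains_inf) (auto intro: continuous_on_subset[OF continuous_on_shift_weight])
    then obtain y0 where y0: "\<And>y. y \<in> cball 0 1 \<Longrightarrow> shift_weight W J y0 \<omega> \<le> shift_weight W J y \<omega>"
      by blast
    define w0 where "w0 = shift_weight W J y0 \<omega>"
    have w0: "w0 > 0" unfolding w0_def by (rule shift_weight_pos)
    have "(\<integral>\<^sup>+y. D m (shifted_path W J y \<omega>) * indicator ?B y \<partial>lborel) \<le> ennreal (S / w0)" for m
    proof -
      have "(\<integral>\<^sup>+y. D m (shifted_path W J y \<omega>) * indicator ?B y \<partial>lborel) \<le>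
          (\<integral>\<^sup>+y. ennreal (1 / w0) * (ennreal (shift_weight W J y \<omega>) * D m (shifted_path W J y \<omega>) * indicator ?B y) \<partial>lborel)"
      proof (rule nn_integral_mono)
        fix y
        show "D m (shifted_path W J y \<omega>) * indicator ?B y \<le>
          ennreal (1 / w0) * (ennreal (shift_weight W J y \<omega>) * D m (shifted_path W J y \<omega>) * indicator ?B y)"
        proof (cases "y \<in> ?B")
          case True
          then have "w0 \<le> shift_weight W J y \<omega>" using y0[of y] by (simp add: w0_def)
          then have "1 \<le> (1 / w0) * shift_weight W J y \<omega>" using w0 by (simp add: field_simps)
          then have "ennreal 1 \<le> ennreal (1 / w0) * ennreal (shift_weight W J y \<omega>)"
            using w0 by (subst ennreal_mult'[symmetric]) (auto intro: ennreal_leI)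
          then have "1 * D m (shifted_path W J y \<omega>) \<le> (ennreal (1 / w0) * ennreal (shift_weight W J y \<omega>)) * D m (shifted_path W J y \<omega>)"
            by (intro mult_right_mono) auto
          then show ?thesis using True by (simp add: mult.assoc)
        qed simp
      qed
      also have "\<dots> \<le> ennreal (1 / w0) * T m \<omega>"
      proof -
        have "(\<lambda>y. ennreal (shift_weight W J y \<omega>) * D m (shifted_path W J y \<omega>) * indicator ?B y) \<in> borel_measurable lborel"
          using measurable_compose[OF measurable_Pair1'[OF elim(2)] Tm0[of m]] by simp
        then show ?thesis unfolding T_def by (simp add: nn_integral_cmult)
      qed
      also have "\<dots> \<le> ennreal (1 / w0) * ennreal S"
        using le_suminf_ennreal[of "\<lambda>m. T m \<omega>" m] S by (intro mult_left_mono) auto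
      also have "\<dots> = ennreal (S / w0)" using w0 by (simp add: ennreal_mult'[symmetric])
      finally show ?thesis .
    qed
    then show ?case using S w0 unfolding D_def by (intro exI[of _ "S / w0"]) auto
  qed
qed

text \<open>Provides versions of \<open>F\<close> and of its directional derivatives on path space
  for which almost every fibre is continuously differentiable in the unit ball. Countability of
  \<open>R\<close> keeps unions of exceptional sets null. The versions serve all \<open>J\<close> at
  once, while the null set may depend on \<open>J\<close>.\<close>

theorem malliavin_path:
  fixes \<iota> :: "'d::finite itself" and R :: "('n \<times> real) set"
  assumes p: "real CARD('d) < p" and F: "has_malliavin_derivs_2 M W p F DF D2F"
    and R: "countable R" "\<And>I. I \<in> R \<Longrightarrow> snd I \<in> {0..1}"
  shows "\<exists>\<Psi>0 \<Psi>1. \<Psi>0 \<in> borel_measurable path_measure \<and> (\<forall>I. \<Psi>1 I \<in> borel_measurable path_measure) \<and>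
    (\<forall>J :: 'd \<Rightarrow> _. range J \<subseteq> R \<longrightarrow>
      (AE \<omega> in M. \<Psi>0 (shifted_path W J 0 \<omega>) = F \<omega> \<and> (\<forall>I\<in>R. \<Psi>1 I (shifted_path W J 0 \<omega>) = pairing (DF \<omega>) I)) \<and>
      (AE \<omega> in M.
        (\<forall>y\<in>ball 0 1. ((\<lambda>y. \<Psi>0 (shifted_path W J y \<omega>)) has_derivative
           (\<lambda>v. \<Sum>j\<in>UNIV. v $ j * \<Psi>1 (J j) (shifted_path W J y \<omega>))) (at y)) \<and>
        (\<forall>I\<in>R. continuous_on (ball 0 1) (\<lambda>y. \<Psi>1 I (shifted_path W J y \<omega>)))))"
proof -
  have p0: "0 < p" using p of_nat_0_le_iff[of "CARD('d)", where ?'a = real] by linarith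
  have Fm[measurable]: "F \<in> borel_measurable M"
    using F unfolding has_malliavin_derivs_2_def by (elim conjE)
  obtain G DG D2G where sm0: "\<forall>m::nat. smooth_functional M W (G m) (DG m) (D2G m)"
    and lim0: "(\<lambda>m. \<integral>\<^sup>+\<omega>. ennreal (\<bar>G m \<omega> - F \<omega>\<bar> powr p) \<partial>M) \<longlonglongrightarrow> 0"
    and L1: "Lp_L2_tendsto M noise p DG DF" and L2: "Lp_L2_tendsto M (noise \<Otimes>\<^sub>M noise) p D2G D2F"
    using F unfolding has_malliavin_derivs_2_def by (elim conjE exE)
  have sm: "smooth_functional M W (G m) (DG m) (D2G m)" for m
    using sm0 by (rule spec)
  have DFm[measurable]: "case_prod DF \<in> borel_measurable (M \<Otimes>\<^sub>M noise)"
    and DF2: "AE \<omega> in M. integrable noise (\<lambda>z. (DF \<omega> z)\<^sup>2)"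
    and lim1: "(\<lambda>m. \<integral>\<^sup>+\<omega>. ennreal (L2_norm noise (\<lambda>z. DG m \<omega> z - DF \<omega> z) powr p) \<partial>M) \<longlonglongrightarrow> 0"
    using L1 unfolding Lp_L2_tendsto_def by blast+
  have D2Fm[measurable]: "case_prod D2F \<in> borel_measurable (M \<Otimes>\<^sub>M (noise \<Otimes>\<^sub>M noise))"
    and D2F2: "AE \<omega> in M. integrable (noise \<Otimes>\<^sub>M noise) (\<lambda>z. (D2F \<omega> z)\<^sup>2)"
    and lim2: "(\<lambda>m. \<integral>\<^sup>+\<omega>. ennreal (L2_norm (noise \<Otimes>\<^sub>M noise) (\<lambda>z. D2G m \<omega> z - D2F \<omega> z) powr p) \<partial>M) \<longlonglongrightarrow> 0"
    using L2 unfolding Lp_L2_tendsto_def by blast+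
  \<comment> \<open>The three errors are made small along one subsequence, so that the same smooth
    functionals approximate \<open>F\<close> together with both derivatives.\<close>
  define close where "close n m \<longleftrightarrow>
     (\<integral>\<^sup>+\<omega>. ennreal (\<bar>G n \<omega> - F \<omega>\<bar> powr p) \<partial>M) < ennreal (path_error p m) \<and>
     (\<integral>\<^sup>+\<omega>. ennreal (L2_norm noise (\<lambda>z. DG n \<omega> z - DF \<omega> z) powr p) \<partial>M) < ennreal (path_error p m) \<and>
     (\<integral>\<^sup>+\<omega>. ennreal (L2_norm (noise \<Otimes>\<^sub>M noise) (\<lambda>z. D2G n \<omega> z - D2F \<omega> z) powr p) \<partial>M) < ennreal (path_error p m)" for n m
  have "\<exists>n. close n m" for m
  proof -
    have "0 < ennreal (path_error p m)" using path_error_pos by simp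
    then have "\<forall>\<^sub>F n in sequentially. close n m"
      unfolding close_def by (intro eventually_conj order_tendstoD(2)[OF lim0] order_tendstoD(2)[OF lim1] order_tendstoD(2)[OF lim2])
    then show ?thesis by (auto simp: eventually_sequentially)
  qed
  then obtain r where r: "\<And>m. close (r m) m" by metis
  have r0: "(\<integral>\<^sup>+\<omega>. ennreal (\<bar>G (r m) \<omega> - F \<omega>\<bar> powr p) \<partial>M) \<le> ennreal (path_error p m)"
    and r1: "(\<integral>\<^sup>+\<omega>. ennreal (L2_norm noise (\<lambda>z. DG (r m) \<omega> z - DF \<omega> z) powr p) \<partial>M) \<le> ennreal (path_error p m)"
    and r2: "(\<integral>\<^sup>+\<omega>. ennreal (L2_norm (noise \<Otimes>\<^sub>M noise) (\<lambda>z. D2G (r m) \<omega> z - D2F \<omega> z) powr p) \<partial>M) \<le> ennreal (path_error p m)"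
    for m
    using r[of m] unfolding close_def by (elim conjE less_imp_le)+
  define rep where "rep m \<Gamma>0 \<Gamma>1 \<Gamma>2 \<longleftrightarrow> \<Gamma>0 \<in> borel_measurable path_measure \<and>
    (\<forall>I. \<Gamma>1 I \<in> borel_measurable path_measure) \<and>
    (\<forall>I I'. \<Gamma>2 I I' \<in> borel_measurable path_measure) \<and>
    (\<forall>\<omega>. DG (r m) \<omega> \<in> borel_measurable noise \<and> integrable noise (\<lambda>z. (DG (r m) \<omega> z)\<^sup>2)) \<and>
    (\<forall>\<omega>. D2G (r m) \<omega> \<in> borel_measurable (noise \<Otimes>\<^sub>M noise) \<and> integrable (noise \<Otimes>\<^sub>M noise) (\<lambda>z. (D2G (r m) \<omega> z)\<^sup>2)) \<and>
    (AE \<omega> in M. \<forall>J :: 'd \<Rightarrow> 'n \<times> real. (\<forall>j. snd (J j) \<in> {0..1}) \<longrightarrow>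
      \<Gamma>0 (shifted_path W J 0 \<omega>) = G (r m) \<omega> \<and>
      (\<forall>I. snd I \<in> {0..1} \<longrightarrow> \<Gamma>1 I (shifted_path W J 0 \<omega>) = pairing (DG (r m) \<omega>) I) \<and>
      (\<forall>I I'. snd I \<in> {0..1} \<longrightarrow> snd I' \<in> {0..1} \<longrightarrow> \<Gamma>2 I I' (shifted_path W J 0 \<omega>) = pairing2 (D2G (r m) \<omega>) I I') \<and>
      fibre_smooth W J \<Gamma>0 \<Gamma>1 \<Gamma>2 \<omega>)" for m \<Gamma>0 \<Gamma>1 \<Gamma>2
  have "\<exists>\<Gamma>0 \<Gamma>1 \<Gamma>2. rep m \<Gamma>0 \<Gamma>1 \<Gamma>2" for m
    unfolding rep_def by (rule smooth_functional_path[OF sm])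
  then obtain \<Gamma>0 \<Gamma>1 \<Gamma>2 where rep: "\<And>m. rep m (\<Gamma>0 m) (\<Gamma>1 m) (\<Gamma>2 m)" by metis
  have [measurable]: "\<Gamma>0 m \<in> borel_measurable path_measure" "\<Gamma>1 m I \<in> borel_measurable path_measure"
    "\<Gamma>2 m I I' \<in> borel_measurable path_measure" for m I I'
    using rep[of m] unfolding rep_def by blast+
  have DGm: "DG (r m) \<omega> \<in> borel_measurable noise" "integrable noise (\<lambda>z. (DG (r m) \<omega> z)\<^sup>2)"
    "D2G (r m) \<omega> \<in> borel_measurable (noise \<Otimes>\<^sub>M noise)" "integrable (noise \<Otimes>\<^sub>M noise) (\<lambda>z. (D2G (r m) \<omega> z)\<^sup>2)" for m \<omega>
    using rep[of m] unfolding rep_def by blast+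
  have repAE: "AE \<omega> in M. \<Gamma>0 m (shifted_path W J 0 \<omega>) = G (r m) \<omega> \<and>
      (\<forall>I. snd I \<in> {0..1} \<longrightarrow> \<Gamma>1 m I (shifted_path W J 0 \<omega>) = pairing (DG (r m) \<omega>) I) \<and>
      (\<forall>I I'. snd I \<in> {0..1} \<longrightarrow> snd I' \<in> {0..1} \<longrightarrow> \<Gamma>2 m I I' (shifted_path W J 0 \<omega>) = pairing2 (D2G (r m) \<omega>) I I') \<and>
      fibre_smooth W J (\<Gamma>0 m) (\<Gamma>1 m) (\<Gamma>2 m) \<omega>"
    if "range J \<subseteq> R" for J :: "'d \<Rightarrow> 'n \<times> real" and m
  proof -
    have J: "\<forall>j. snd (J j) \<in> {0..1}" using that R(2) by blast
    show ?thesis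
      using rep[of m, unfolded rep_def, THEN conjunct2, THEN conjunct2, THEN conjunct2, THEN conjunct2, THEN conjunct2]
      by eventually_elim (use J in blast)
  qed
  interpret noise_noise: finite_measure "(noise :: ('n \<times> real) measure) \<Otimes>\<^sub>M noise" by (rule finite_measure_noise2)
  have pm1: "(\<lambda>\<omega>. pairing (DF \<omega>) I) \<in> borel_measurable M" if I: "snd I \<in> {0..1}" for I
  proof -
    note [measurable] = sets_cell[OF I]
    have "(\<lambda>(\<omega>, z). DF \<omega> z * indicator (cell I) z) \<in> borel_measurable (M \<Otimes>\<^sub>M noise)"
      using DFm unfolding split_beta' by measurable
    then show ?thesis unfolding pairing_def by (rule noise.borel_measurable_lebesgue_integral)
  qed
  have pm2: "(\<lambda>\<omega>. pairing2 (D2F \<omega>) I I') \<in> borel_measurable M" if I: "snd I \<in> {0..1}" "snd I' \<in> {0..1}" for I I'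
  proof -
    note [measurable] = sets_cell2[OF I]
    have "(\<lambda>(\<omega>, z). D2F \<omega> z * indicator (cell I \<times> cell I') z) \<in> borel_measurable (M \<Otimes>\<^sub>M (noise \<Otimes>\<^sub>M noise))"
      using D2Fm unfolding split_beta' by measurable
    then show ?thesis unfolding pairing2_def by (rule noise_noise.borel_measurable_lebesgue_integral)
  qed
  have err0: "(\<integral>\<^sup>+\<omega>. ennreal (\<bar>\<Gamma>0 m (shifted_path W J 0 \<omega>) - F \<omega>\<bar> powr p) \<partial>M) \<le> ennreal (path_error p m)"
    if J: "range J \<subseteq> R" for m and J :: "'d \<Rightarrow> 'n \<times> real"
  proof -
    have "(\<integral>\<^sup>+\<omega>. ennreal (\<bar>\<Gamma>0 m (shifted_path W J 0 \<omega>) - F \<omega>\<bar> powr p) \<partial>M) = (\<integral>\<^sup>+\<omega>. ennreal (\<bar>G (r m) \<omega> - F \<omega>\<bar> powr p) \<partial>M)"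
      using repAE[OF J, of m] by (intro nn_integral_cong_AE) auto
    then show ?thesis using r0[of m] by (simp only:)
  qed
  have err1: "(\<integral>\<^sup>+\<omega>. ennreal (\<bar>\<Gamma>1 m I (shifted_path W J 0 \<omega>) - pairing (DF \<omega>) I\<bar> powr p) \<partial>M) \<le> ennreal (path_error p m)"
    if J: "range J \<subseteq> R" and I: "snd I \<in> {0..1}" for m I and J :: "'d \<Rightarrow> 'n \<times> real"
  proof -
    have "(\<integral>\<^sup>+\<omega>. ennreal (\<bar>\<Gamma>1 m I (shifted_path W J 0 \<omega>) - pairing (DF \<omega>) I\<bar> powr p) \<partial>M) \<le>
       (\<integral>\<^sup>+\<omega>. ennreal (L2_norm noise (\<lambda>z. DG (r m) \<omega> z - DF \<omega> z) powr p) \<partial>M)"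
    proof (rule nn_integral_mono_AE)
      show "AE \<omega> in M. ennreal (\<bar>\<Gamma>1 m I (shifted_path W J 0 \<omega>) - pairing (DF \<omega>) I\<bar> powr p) \<le>
         ennreal (L2_norm noise (\<lambda>z. DG (r m) \<omega> z - DF \<omega> z) powr p)"
        using repAE[OF J, of m] DF2 AE_space
      proof eventually_elim
        case (elim \<omega>)
        have "DF \<omega> \<in> borel_measurable noise"
          using measurable_compose[OF measurable_Pair1'[OF elim(3)] DFm] by simp
        moreover have "\<Gamma>1 m I (shifted_path W J 0 \<omega>) = pairing (DG (r m) \<omega>) I" using elim(1) I by blast
        ultimately have "\<bar>\<Gamma>1 m I (shifted_path W J 0 \<omega>) - pairing (DF \<omega>) I\<bar> \<le> L2_norm noise (\<lambda>z. DG (r m) \<omega> z - DF \<omega> z)"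
          using abs_pairing_diff_le[OF DGm(1,2)[of m \<omega>] _ elim(2) I] by simp
        then show ?case using p0 by (intro ennreal_leI powr_mono2) auto
      qed
    qed
    also have "\<dots> \<le> ennreal (path_error p m)" by (rule r1)
    finally show ?thesis .
  qed
  have err2: "(\<integral>\<^sup>+\<omega>. ennreal (\<bar>\<Gamma>2 m I I' (shifted_path W J 0 \<omega>) - pairing2 (D2F \<omega>) I I'\<bar> powr p) \<partial>M) \<le> ennreal (path_error p m)"
    if J: "range J \<subseteq> R" and I: "snd I \<in> {0..1}" "snd I' \<in> {0..1}" for m I I' and J :: "'d \<Rightarrow> 'n \<times> real"
  proof -
    have "(\<integral>\<^sup>+\<omega>. ennreal (\<bar>\<Gamma>2 m I I' (shifted_path W J 0 \<omega>) - pairing2 (D2F \<omega>) I I'\<bar> powr p) \<partial>M) \<le>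
       (\<integral>\<^sup>+\<omega>. ennreal (L2_norm (noise \<Otimes>\<^sub>M noise) (\<lambda>z. D2G (r m) \<omega> z - D2F \<omega> z) powr p) \<partial>M)"
    proof (rule nn_integral_mono_AE)
      show "AE \<omega> in M. ennreal (\<bar>\<Gamma>2 m I I' (shifted_path W J 0 \<omega>) - pairing2 (D2F \<omega>) I I'\<bar> powr p) \<le>
         ennreal (L2_norm (noise \<Otimes>\<^sub>M noise) (\<lambda>z. D2G (r m) \<omega> z - D2F \<omega> z) powr p)"
        using repAE[OF J, of m] D2F2 AE_space
      proof eventually_elim
        case (elim \<omega>)
        have "D2F \<omega> \<in> borel_measurable (noise \<Otimes>\<^sub>M noise)"
          using measurable_compose[OF measurable_Pair1'[OF elim(3)] D2Fm] by simp
        moreover have "\<Gamma>2 m I I' (shifted_path W J 0 \<omega>) = pairing2 (D2G (r m) \<omega>) I I'" using elim(1) I by blast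
        ultimately have "\<bar>\<Gamma>2 m I I' (shifted_path W J 0 \<omega>) - pairing2 (D2F \<omega>) I I'\<bar> \<le>
            L2_norm (noise \<Otimes>\<^sub>M noise) (\<lambda>z. D2G (r m) \<omega> z - D2F \<omega> z)"
          using abs_pairing2_diff_le[OF DGm(3,4)[of m \<omega>] _ elim(2) I] by simp
        then show ?case using p0 by (intro ennreal_leI powr_mono2) auto
      qed
    qed
    also have "\<dots> \<le> ennreal (path_error p m)" by (rule r2)
    finally show ?thesis .
  qed
  \<comment> \<open>\<open>lim\<close> has some value at every path, convergent or not, and is
    measurable; the almost sure statements below show where it is a genuine limit.\<close>
  define \<Psi>0 where "\<Psi>0 = (\<lambda>\<pi>. lim (\<lambda>m. \<Gamma>0 m \<pi>))"
  define \<Psi>1 where "\<Psi>1 = (\<lambda>I \<pi>. lim (\<lambda>m. \<Gamma>1 m I \<pi>))"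
  have m0: "\<Psi>0 \<in> borel_measurable path_measure"
    unfolding \<Psi>0_def by (rule borel_measurable_lim_metric[where f = \<Gamma>0]) measurable
  have m1: "\<Psi>1 I \<in> borel_measurable path_measure" for I
    unfolding \<Psi>1_def by (rule borel_measurable_lim_metric[where f = "\<lambda>m. \<Gamma>1 m I"]) measurable
  have base: "AE \<omega> in M. \<Psi>0 (shifted_path W J 0 \<omega>) = F \<omega> \<and> (\<forall>I\<in>R. \<Psi>1 I (shifted_path W J 0 \<omega>) = pairing (DF \<omega>) I)"
    if J: "range J \<subseteq> R" for J :: "'d \<Rightarrow> 'n \<times> real"
  proof -
    have "AE \<omega> in M. (\<lambda>m. \<Gamma>0 m (shifted_path W J 0 \<omega>)) \<longlonglongrightarrow> F \<omega>"
      by (rule AE_tendsto_of_error[OF p0 _ Fm err0[OF J]]) measurable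
    moreover have "AE \<omega> in M. \<forall>I\<in>R. (\<lambda>m. \<Gamma>1 m I (shifted_path W J 0 \<omega>)) \<longlonglongrightarrow> pairing (DF \<omega>) I"
      unfolding AE_ball_countable[OF R(1)]
    proof
      fix I assume "I \<in> R"
      then have I: "snd I \<in> {0..1}" by (rule R)
      show "AE \<omega> in M. (\<lambda>m. \<Gamma>1 m I (shifted_path W J 0 \<omega>)) \<longlonglongrightarrow> pairing (DF \<omega>) I"
        by (rule AE_tendsto_of_error[OF p0 _ pm1[OF I] err1[OF J I]]) measurable
    qed
    ultimately show ?thesis
      by eventually_elim (auto simp: \<Psi>0_def \<Psi>1_def intro: limI)
  qed
  have fibre: "AE \<omega> in M.
        (\<forall>y\<in>ball 0 1. ((\<lambda>y. \<Psi>0 (shifted_path W J y \<omega>)) has_derivative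
           (\<lambda>v. \<Sum>j\<in>UNIV. v $ j * \<Psi>1 (J j) (shifted_path W J y \<omega>))) (at y)) \<and>
        (\<forall>I\<in>R. continuous_on (ball 0 1) (\<lambda>y. \<Psi>1 I (shifted_path W J y \<omega>)))"
    if J: "range J \<subseteq> R" for J :: "'d \<Rightarrow> 'n \<times> real"
  proof -
    let ?B = "ball 0 1 :: (real^'d) set"
    define bdd where "bdd U \<omega> \<longleftrightarrow> (\<exists>K\<ge>0. \<forall>m. (\<integral>\<^sup>+y. ennreal (\<bar>2 ^ m * (U (Suc m) (shifted_path W J y \<omega>) - U m (shifted_path W J y \<omega>))\<bar> powr p)
        * indicator ?B y \<partial>lborel) \<le> ennreal K)" for U \<omega>
    have J': "\<And>j. snd (J j) \<in> {0..1}" using J R(2) by blast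
    have JR: "J j \<in> R" for j using J by blast
    have b0: "AE \<omega> in M. bdd \<Gamma>0 \<omega>"
      unfolding bdd_def by (rule AE_bounded_fibre_increments[OF p0 J' _ Fm err0[OF J]]) measurable
    have b1: "AE \<omega> in M. \<forall>I\<in>R. bdd (\<lambda>m. \<Gamma>1 m I) \<omega>"
      unfolding AE_ball_countable[OF R(1)]
    proof
      fix I assume "I \<in> R"
      then have I: "snd I \<in> {0..1}" by (rule R)
      show "AE \<omega> in M. bdd (\<lambda>m. \<Gamma>1 m I) \<omega>"
        unfolding bdd_def by (rule AE_bounded_fibre_increments[OF p0 J' _ pm1[OF I] err1[OF J I]]) measurable
    qed
    have b2: "AE \<omega> in M. \<forall>I\<in>R. \<forall>I'\<in>R. bdd (\<lambda>m. \<Gamma>2 m I I') \<omega>"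
      unfolding AE_ball_countable[OF R(1)]
    proof (intro ballI)
      fix I I' assume "I \<in> R" "I' \<in> R"
      then have I: "snd I \<in> {0..1}" "snd I' \<in> {0..1}" by (blast dest: R(2))+
      show "AE \<omega> in M. bdd (\<lambda>m. \<Gamma>2 m I I') \<omega>"
        unfolding bdd_def by (rule AE_bounded_fibre_increments[OF p0 J' _ pm2[OF I] err2[OF J I]]) measurable
    qed
    have rm: "AE \<omega> in M. \<forall>m.
      fibre_smooth W J (\<Gamma>0 m) (\<Gamma>1 m) (\<Gamma>2 m) \<omega>"
      unfolding AE_all_countable
    proof
      show "AE \<omega> in M. fibre_smooth W J (\<Gamma>0 m) (\<Gamma>1 m) (\<Gamma>2 m) \<omega>" for m
        using repAE[OF J, of m] by eventually_elim blast
    qed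
    from b0 b1 b2 rm show ?thesis
    proof eventually_elim
      case (elim \<omega>)
      have der0: "((\<lambda>y. \<Gamma>0 m (shifted_path W J y \<omega>)) has_derivative
         (\<lambda>v. \<Sum>j\<in>UNIV. v $ j * \<Gamma>1 m (J j) (shifted_path W J y \<omega>))) (at y)"
        and der1: "((\<lambda>y. \<Gamma>1 m I (shifted_path W J y \<omega>)) has_derivative
         (\<lambda>v. \<Sum>j\<in>UNIV. v $ j * \<Gamma>2 m (J j) I (shifted_path W J y \<omega>))) (at y)"
        and cont2: "continuous_on UNIV (\<lambda>y. \<Gamma>2 m I I' (shifted_path W J y \<omega>))" for m y I I'
        using elim(4) unfolding fibre_smooth_def by blast+
      \<comment> \<open>Morrey's inequality for the rescaled increments of a functional and its
        fibre derivatives. It is used twice: for \<open>\<Gamma>1\<close> with derivatives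
        \<open>\<Gamma>2\<close>, and for \<open>\<Gamma>0\<close> with derivatives
        \<open>\<Gamma>1\<close>.\<close>
      have unif: "uniform_limit ?B (\<lambda>m y. U m (shifted_path W J y \<omega>)) (\<lambda>y. lim (\<lambda>m. U m (shifted_path W J y \<omega>))) sequentially"
        if U: "bdd U \<omega>" and A: "\<And>j. bdd (\<lambda>m. A m j) \<omega>"
          and der: "\<And>m y. ((\<lambda>y. U m (shifted_path W J y \<omega>)) has_derivative
             (\<lambda>v. \<Sum>j\<in>UNIV. v $ j * A m j (shifted_path W J y \<omega>))) (at y)"
          and cont: "\<And>m j. continuous_on UNIV (\<lambda>y. A m j (shifted_path W J y \<omega>))"
        for U :: "nat \<Rightarrow> ('n \<times> real \<Rightarrow> real) \<Rightarrow> real" and A :: "nat \<Rightarrow> 'd \<Rightarrow> ('n \<times> real \<Rightarrow> real) \<Rightarrow> real"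
      proof -
        obtain K0 where K0: "0 \<le> K0" "\<And>m. (\<integral>\<^sup>+y. ennreal (\<bar>2 ^ m * (U (Suc m) (shifted_path W J y \<omega>) - U m (shifted_path W J y \<omega>))\<bar> powr p)
          * indicator ?B y \<partial>lborel) \<le> ennreal K0" using U unfolding bdd_def by blast
        have "\<forall>j. \<exists>K. 0 \<le> K \<and> (\<forall>m. (\<integral>\<^sup>+y. ennreal (\<bar>2 ^ m * (A (Suc m) j (shifted_path W J y \<omega>) - A m j (shifted_path W J y \<omega>))\<bar> powr p)
          * indicator ?B y \<partial>lborel) \<le> ennreal K)" using A unfolding bdd_def by blast
        from choice[OF this] obtain K1 where K1: "\<And>j. 0 \<le> K1 j" "\<And>j m. (\<integral>\<^sup>+y. ennreal (\<bar>2 ^ m * (A (Suc m) j (shifted_path W J y \<omega>) - A m j (shifted_path W J y \<omega>))\<bar> powr p)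
          * indicator ?B y \<partial>lborel) \<le> ennreal (K1 j)" by blast
        \<comment> \<open>\<open>morrey\<close> asks for a single bound on the function and all its
          partial derivatives; the sum dominates each of the non-negative bounds.\<close>
        define K where "K = K0 + (\<Sum>j\<in>UNIV. K1 j)"
        have K: "0 \<le> K" "K0 \<le> K" "\<And>j. K1 j \<le> K"
        proof -
          show "0 \<le> K" using K0 K1 by (simp add: K_def sum_nonneg)
          show "K0 \<le> K" using K1 by (simp add: K_def sum_nonneg)
          show "K1 j \<le> K" for j
            using K0(1) member_le_sum[of j UNIV K1] K1(1) by (simp add: K_def)
        qed
        obtain C where C: "\<And>(u :: real^'d \<Rightarrow> real) a.
           (\<forall>y\<in>ball 0 1. (u has_derivative (\<lambda>v. \<Sum>j\<in>UNIV. v $ j * a j y)) (at y)) \<Longrightarrow>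
           (\<forall>j. continuous_on (ball 0 1) (a j)) \<Longrightarrow>
           (\<integral>\<^sup>+y. ennreal (\<bar>u y\<bar> powr p) * indicator (ball 0 1) y \<partial>lborel) \<le> ennreal K \<Longrightarrow>
           (\<forall>j. (\<integral>\<^sup>+y. ennreal (\<bar>a j y\<bar> powr p) * indicator (ball 0 1) y \<partial>lborel) \<le> ennreal K) \<Longrightarrow>
           (\<forall>x\<in>ball 0 1. \<bar>u x\<bar> \<le> C)"
          using morrey[OF p K(1)] by blast
        have "\<forall>x\<in>?B. \<bar>2 ^ m * (U (Suc m) (shifted_path W J x \<omega>) - U m (shifted_path W J x \<omega>))\<bar> \<le> C" for m
        proof (rule C[of "\<lambda>x. 2 ^ m * (U (Suc m) (shifted_path W J x \<omega>) - U m (shifted_path W J x \<omega>))" "\<lambda>j y. 2 ^ m * (A (Suc m) j (shifted_path W J y \<omega>) - A m j (shifted_path W J y \<omega>))"])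
          show "\<forall>y\<in>?B. ((\<lambda>x. 2 ^ m * (U (Suc m) (shifted_path W J x \<omega>) - U m (shifted_path W J x \<omega>))) has_derivative
            (\<lambda>v. \<Sum>j\<in>UNIV. v $ j * (2 ^ m * (A (Suc m) j (shifted_path W J y \<omega>) - A m j (shifted_path W J y \<omega>))))) (at y)"
          proof
            fix y
            have "((\<lambda>x. 2 ^ m * (U (Suc m) (shifted_path W J x \<omega>) - U m (shifted_path W J x \<omega>))) has_derivative
              (\<lambda>v. 2 ^ m * ((\<Sum>j\<in>UNIV. v $ j * A (Suc m) j (shifted_path W J y \<omega>)) - (\<Sum>j\<in>UNIV. v $ j * A m j (shifted_path W J y \<omega>))))) (at y)"
              by (intro has_derivative_mult_right has_derivative_diff der)
            moreover have "2 ^ m * ((\<Sum>j\<in>UNIV. v $ j * A (Suc m) j (shifted_path W J y \<omega>)) - (\<Sum>j\<in>UNIV. v $ j * A m j (shifted_path W J y \<omega>))) =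
              (\<Sum>j\<in>UNIV. v $ j * (2 ^ m * (A (Suc m) j (shifted_path W J y \<omega>) - A m j (shifted_path W J y \<omega>))))" for v
              by (simp add: sum_distrib_left sum_subtractf algebra_simps)
            ultimately show "((\<lambda>x. 2 ^ m * (U (Suc m) (shifted_path W J x \<omega>) - U m (shifted_path W J x \<omega>))) has_derivative
            (\<lambda>v. \<Sum>j\<in>UNIV. v $ j * (2 ^ m * (A (Suc m) j (shifted_path W J y \<omega>) - A m j (shifted_path W J y \<omega>))))) (at y)"
              by (simp only:)
          qed
          show "\<forall>j. continuous_on ?B (\<lambda>y. 2 ^ m * (A (Suc m) j (shifted_path W J y \<omega>) - A m j (shifted_path W J y \<omega>)))"
            by (intro allI continuous_intros continuous_on_subset[OF cont]) auto
          show "(\<integral>\<^sup>+y. ennreal (\<bar>2 ^ m * (U (Suc m) (shifted_path W J y \<omega>) - U m (shifted_path W J y \<omega>))\<bar> powr p) * indicator ?B y \<partial>lborel) \<le> ennreal K"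
            using K0(2)[of m] ennreal_leI[OF K(2)] by (rule order_trans)
          show "\<forall>j. (\<integral>\<^sup>+y. ennreal (\<bar>2 ^ m * (A (Suc m) j (shifted_path W J y \<omega>) - A m j (shifted_path W J y \<omega>))\<bar> powr p) * indicator ?B y \<partial>lborel) \<le> ennreal K"
            using K1(2)[of m] ennreal_leI[OF K(3)] by (blast intro: order_trans)
        qed
        then show ?thesis
          by (intro uniform_limit_geometric_increments[where C = C]) blast
      qed
      have u1: "uniform_limit ?B (\<lambda>m y. \<Gamma>1 m I (shifted_path W J y \<omega>)) (\<lambda>y. \<Psi>1 I (shifted_path W J y \<omega>)) sequentially"
        if I: "I \<in> R" for I
        unfolding \<Psi>1_def
      proof (rule unif[of "\<lambda>m. \<Gamma>1 m I" "\<lambda>m j. \<Gamma>2 m (J j) I"])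
        show "bdd (\<lambda>m. \<Gamma>1 m I) \<omega>" using elim(2) I by blast
        show "bdd (\<lambda>m. \<Gamma>2 m (J j) I) \<omega>" for j using elim(3) I JR by blast
      qed (rule der1, rule cont2)
      have c1: "continuous_on UNIV (\<lambda>y. \<Gamma>1 m I (shifted_path W J y \<omega>))" for m I
        by (rule has_derivative_continuous_on[OF has_derivative_at_withinI[OF der1]])
      have u0: "uniform_limit ?B (\<lambda>m y. \<Gamma>0 m (shifted_path W J y \<omega>)) (\<lambda>y. \<Psi>0 (shifted_path W J y \<omega>)) sequentially"
        unfolding \<Psi>0_def
      proof (rule unif[of \<Gamma>0 "\<lambda>m j. \<Gamma>1 m (J j)"])
        show "bdd \<Gamma>0 \<omega>" by (rule elim(1))
        show "bdd (\<lambda>m. \<Gamma>1 m (J j)) \<omega>" for j using elim(2) JR by blast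
        show "continuous_on UNIV (\<lambda>y. \<Gamma>1 m (J j) (shifted_path W J y \<omega>))" for m j by (rule c1)
      qed (rule der0)
      show ?case
      proof (intro conjI ballI)
        show "((\<lambda>y. \<Psi>0 (shifted_path W J y \<omega>)) has_derivative
           (\<lambda>v. \<Sum>j\<in>UNIV. v $ j * \<Psi>1 (J j) (shifted_path W J y \<omega>))) (at y)" if y: "y \<in> ?B" for y
        proof (rule has_derivative_uniform_limit[where B = ?B and u = "\<lambda>m y. \<Gamma>0 m (shifted_path W J y \<omega>)"
              and a = "\<lambda>m j y. \<Gamma>1 m (J j) (shifted_path W J y \<omega>)"])
          show "(\<lambda>m. \<Gamma>0 m (shifted_path W J y \<omega>)) \<longlonglongrightarrow> \<Psi>0 (shifted_path W J y \<omega>)" if "y \<in> ?B" for y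
            using tendsto_uniform_limitI[OF u0 that] .
          show "uniform_limit ?B (\<lambda>m y. \<Gamma>1 m (J j) (shifted_path W J y \<omega>)) (\<lambda>y. \<Psi>1 (J j) (shifted_path W J y \<omega>)) sequentially" for j
            by (rule u1[OF JR])
        qed (use der0 y in auto)
        show "continuous_on ?B (\<lambda>y. \<Psi>1 I (shifted_path W J y \<omega>))" if "I \<in> R" for I
        proof (rule uniform_limit_theorem[OF _ u1[OF that]])
          show "\<forall>\<^sub>F m in sequentially. continuous_on ?B (\<lambda>y. \<Gamma>1 m I (shifted_path W J y \<omega>))"
            by (intro always_eventually allI continuous_on_subset[OF c1]) auto
        qed simp
      qed
    qed
  qed
  from m0 m1 base fibre show ?thesis
    by (intro exI[of _ \<Psi>0] exI[of _ \<Psi>1] conjI allI impI)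
qed

end

section \<open>The Malliavin covariance as a Gram matrix\<close>

lemma integral_noise:
  fixes g :: "'n::finite \<times> real \<Rightarrow> real"
  assumes "integrable noise g"
  shows "(\<integral>z. g z \<partial>noise) = (\<Sum>k\<in>UNIV. LBINT s:{0..1}. g (k, s))"
proof -
  interpret U: sigma_finite_measure "restrict_space lborel {0..1::real}" by (rule sigma_finite_unit)
  interpret C: finite_measure "count_space (UNIV :: 'n set)" by (rule finite_measure_count)
  interpret P: pair_sigma_finite "count_space (UNIV :: 'n set)" "restrict_space lborel {0..1::real}" ..
  have "(\<integral>z. g z \<partial>noise) = (\<integral>k. (\<integral>s. g (k, s) \<partial>restrict_space lborel {0..1}) \<partial>count_space UNIV)"
    using P.integral_fst'[OF assms[unfolded noise_def]] by (simp add: noise_def)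
  also have "\<dots> = (\<Sum>k\<in>UNIV. \<integral>s. g (k, s) \<partial>restrict_space lborel {0..1})"
    by (simp add: lebesgue_integral_count_space_finite)
  also have "\<dots> = (\<Sum>k\<in>UNIV. LBINT s:{0..1}. g (k, s))"
    by (simp add: integral_restrict_space set_lebesgue_integral_def)
  finally show ?thesis .
qed

text \<open>The positive and negative parts of \<open>g\<close> are densities of finite measures
  whose distribution functions agree at rational points. Right continuity extends the agreement to
  all points, and a distribution function determines its measure.\<close>

lemma AE_zero_of_integral_atMost_zero:
  fixes g :: "real \<Rightarrow> real"
  assumes g: "integrable lborel g"
    and 0: "\<And>b. b \<in> \<rat> \<Longrightarrow> (\<integral>s. g s * indicator {..b} s \<partial>lborel) = 0"
  shows "AE s in lborel. g s = 0"
proof -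
  have [measurable]: "g \<in> borel_measurable borel" using borel_measurable_integrable[OF g] by simp
  define P where "P = density lborel (\<lambda>s. ennreal (max 0 (g s)))"
  define N where "N = density lborel (\<lambda>s. ennreal (max 0 (- g s)))"
  have ip: "integrable lborel (\<lambda>s. max 0 (g s))" and im: "integrable lborel (\<lambda>s. max 0 (- g s))"
    using g by (auto intro!: integrable_max)
  have fin: "finite_borel_measure P" "finite_borel_measure N"
  proof -
    have "finite_measure (density lborel (\<lambda>s. ennreal (h s)))"
      if h: "integrable lborel h" "\<And>s. 0 \<le> h s" for h :: "real \<Rightarrow> real"
    proof (rule finite_measureI)
      have "emeasure (density lborel (\<lambda>s. ennreal (h s))) UNIV = (\<integral>\<^sup>+s. ennreal (h s) \<partial>lborel)"
        using h by (subst emeasure_density) auto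
      also have "\<dots> = ennreal (\<integral>s. h s \<partial>lborel)"
        using h by (intro nn_integral_eq_integral) auto
      finally show "emeasure (density lborel (\<lambda>s. ennreal (h s))) (space (density lborel (\<lambda>s. ennreal (h s)))) \<noteq> \<infinity>"
        by simp
    qed
    from this[OF ip] this[OF im] show "finite_borel_measure P" "finite_borel_measure N"
      by (auto simp: finite_borel_measure_def finite_borel_measure_axioms_def P_def N_def)
  qed
  have cdf_dens: "cdf (density lborel (\<lambda>s. ennreal (h s))) b = (\<integral>s. h s * indicator {..b} s \<partial>lborel)"
    if h: "integrable lborel h" "\<And>s. 0 \<le> h s" for h b
  proof -
    have "emeasure (density lborel (\<lambda>s. ennreal (h s))) {..b} = (\<integral>\<^sup>+s. ennreal (h s * indicator {..b} s) \<partial>lborel)"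
      using h(1) by (subst emeasure_density) (auto intro!: nn_integral_cong split: split_indicator)
    also have "\<dots> = ennreal (\<integral>s. h s * indicator {..b} s \<partial>lborel)"
      using h by (intro nn_integral_eq_integral integrable_real_mult_indicator) auto
    finally show ?thesis using h(2) by (simp add: cdf_def measure_def)
  qed
  have cdf_rat: "cdf P b = cdf N b" if "b \<in> \<rat>" for b
  proof -
    have "cdf P b - cdf N b = (\<integral>s. max 0 (g s) * indicator {..b} s - max 0 (- g s) * indicator {..b} s \<partial>lborel)"
    proof -
      have "cdf P b = (\<integral>s. max 0 (g s) * indicator {..b} s \<partial>lborel)"
        unfolding P_def by (rule cdf_dens[OF ip]) simp
      moreover have "cdf N b = (\<integral>s. max 0 (- g s) * indicator {..b} s \<partial>lborel)"
        unfolding N_def by (rule cdf_dens[OF im]) simp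
      moreover have "(\<integral>s. max 0 (g s) * indicator {..b} s - max 0 (- g s) * indicator {..b} s \<partial>lborel) =
        (\<integral>s. max 0 (g s) * indicator {..b} s \<partial>lborel) - (\<integral>s. max 0 (- g s) * indicator {..b} s \<partial>lborel)"
        by (intro Bochner_Integration.integral_diff integrable_real_mult_indicator ip im) auto
      ultimately show ?thesis by simp
    qed
    also have "\<dots> = (\<integral>s. g s * indicator {..b} s \<partial>lborel)"
      by (intro Bochner_Integration.integral_cong) (auto split: split_indicator)
    also have "\<dots> = 0" by (rule 0[OF that])
    finally show ?thesis by simp
  qed
  have "cdf P b = cdf N b" for b
  proof (rule ccontr)
    assume ne: "cdf P b \<noteq> cdf N b"
    have "((\<lambda>x. cdf P x - cdf N x) \<longlongrightarrow> cdf P b - cdf N b) (at_right b)"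
      using finite_borel_measure.cdf_is_right_cont[OF fin(1), of b] finite_borel_measure.cdf_is_right_cont[OF fin(2), of b]
      by (intro tendsto_diff) (auto simp: continuous_within)
    then have "\<forall>\<^sub>F x in at_right b. cdf P x - cdf N x \<noteq> 0"
      using ne by (intro tendsto_imp_eventually_ne) auto
    then obtain c where c: "c > b" "\<And>x. b < x \<Longrightarrow> x < c \<Longrightarrow> cdf P x - cdf N x \<noteq> 0"
      by (auto simp: eventually_at_right_field)
    obtain q where "q \<in> \<rat>" "b < q" "q < c" using Rats_dense_in_real[OF c(1)] by blast
    then show False using c(2)[of q] cdf_rat[of q] by simp
  qed
  then have "P = N" by (intro cdf_unique' fin ext)
  then have "AE s in lborel. ennreal (max 0 (g s)) = ennreal (max 0 (- g s))"
    unfolding P_def N_def by (subst (asm) sigma_finite_measure.density_unique_iff[OF sigma_finite_lborel]) auto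
  then show ?thesis by eventually_elim (auto simp: max_def split: if_splits)
qed

text \<open>Cells with rational end points separate integrable functions: in each component they are
  half-lines restricted to the unit interval, up to the single point 0 that cells omit.\<close>

lemma AE_noise_zero:
  fixes g :: "'n::finite \<times> real \<Rightarrow> real"
  assumes g: "integrable noise g"
    and 0: "\<And>k b. b \<in> \<rat> \<Longrightarrow> 0 \<le> b \<Longrightarrow> b \<le> 1 \<Longrightarrow> pairing g (k, b) = 0"
  shows "AE z in noise. g z = 0"
proof -
  interpret U: sigma_finite_measure "restrict_space lborel {0..1::real}" by (rule sigma_finite_unit)
  interpret C: finite_measure "count_space (UNIV :: 'n set)" by (rule finite_measure_count)
  interpret P: pair_sigma_finite "count_space (UNIV :: 'n set)" "restrict_space lborel {0..1::real}" ..
  have gm: "g \<in> borel_measurable noise" using g by simp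
  have AEk: "AE s in restrict_space lborel {0..1}. g (k, s) = 0" for k
  proof -
    have int: "integrable (restrict_space lborel {0..1}) (\<lambda>s. g (k, s))"
    proof -
      have "AE k in count_space UNIV. integrable (restrict_space lborel {0..1}) (\<lambda>s. g (k, s))"
        using P.AE_integrable_fst'[OF g[unfolded noise_def]] .
      then show ?thesis by (simp add: AE_count_space)
    qed
    then have int': "integrable lborel (\<lambda>s. indicator {0..1} s * g (k, s))"
      by (simp add: integrable_restrict_space)
    have "(\<integral>s. (indicator {0..1} s * g (k, s)) * indicator {..b} s \<partial>lborel) = 0" if b: "b \<in> \<rat>" for b
    proof (cases "b < 0")
      case True
      then have eq: "(indicator {0..1} s * g (k, s)) * indicator {..b} s = 0" for s
        by (auto split: split_indicator)
      show ?thesis unfolding eq by simp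
    next
      case False
      \<comment> \<open>The integrand vanishes beyond 1, so the end point may be truncated to stay
        in the range where the pairing is known to be zero.\<close>
      define b' where "b' = min b 1"
      have b': "b' \<in> \<rat>" "0 \<le> b'" "b' \<le> 1" using b False by (auto simp: b'_def min_def)
      have "pairing g (k, b') = (\<Sum>k'\<in>UNIV. LBINT s:{0..1}. g (k', s) * indicator (cell (k, b')) (k', s))"
        unfolding pairing_def
        using g b' by (intro integral_noise integrable_real_mult_indicator sets_cell) auto
      also have "\<dots> = (\<Sum>k'\<in>UNIV. if k' = k then LBINT s:{0..1}. g (k', s) * indicator (cell (k, b')) (k', s) else 0)"
      proof (intro sum.cong refl)
        fix k'
        show "(LBINT s:{0..1}. g (k', s) * indicator (cell (k, b')) (k', s)) =
          (if k' = k then LBINT s:{0..1}. g (k', s) * indicator (cell (k, b')) (k', s) else 0)"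
          by (cases "k' = k") (auto simp: cell_def indicator_def set_lebesgue_integral_def)
      qed
      also have "\<dots> = (LBINT s:{0..1}. g (k, s) * indicator (cell (k, b')) (k, s))" by simp
      also have "\<dots> = (\<integral>s. (indicator {0..1} s * g (k, s)) * indicator {..b} s \<partial>lborel)"
        unfolding set_lebesgue_integral_def
      proof (rule integral_cong_AE)
        have [measurable]: "(\<lambda>s. indicator {0..1} s * g (k, s)) \<in> borel_measurable lborel" using int' by simp
        have e: "indicator {0..1} s *\<^sub>R (g (k, s) * indicator (cell (k, b')) (k, s)) = (indicator {0..1} s * g (k, s)) * indicator {0<..b'} s" for s
          by (auto simp: cell_def indicator_def)
        show "(\<lambda>s. indicator {0..1} s *\<^sub>R (g (k, s) * indicator (cell (k, b')) (k, s))) \<in> borel_measurable lborel"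
          unfolding e by measurable
        show "(\<lambda>s. (indicator {0..1} s * g (k, s)) * indicator {..b} s) \<in> borel_measurable lborel" by measurable
        have "AE s in lborel. s \<noteq> (0::real)" by (rule AE_lborel_singleton)
        then show "AE s in lborel. indicator {0..1} s *\<^sub>R (g (k, s) * indicator (cell (k, b')) (k, s)) = (indicator {0..1} s * g (k, s)) * indicator {..b} s"
          by eventually_elim (auto simp: e b'_def indicator_def cell_def)
      qed
      finally show ?thesis using 0[OF b'(1-3), of k] by simp
    qed
    from AE_zero_of_integral_atMost_zero[OF int' this]
    have "AE s in lborel. indicator {0..1} s * g (k, s) = 0" .
    then have "AE s in lborel. s \<in> {0..1} \<longrightarrow> g (k, s) = 0"
      by eventually_elim (auto simp: indicator_def)
    then show ?thesis by (simp add: AE_restrict_space_iff)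
  qed
  have "AE z in count_space UNIV \<Otimes>\<^sub>M restrict_space lborel {0..1}. g z = 0"
  proof (rule P.AE_pair_measure)
    have "{z \<in> space noise. g z = 0} \<in> sets noise" using gm by measurable
    then show "{z \<in> space (count_space UNIV \<Otimes>\<^sub>M restrict_space lborel {0..1}). g z = 0} \<in> sets (count_space UNIV \<Otimes>\<^sub>M restrict_space lborel {0..1})"
      by (simp add: noise_def)
    show "AE k in count_space UNIV. AE s in restrict_space lborel {0..1}. g (k, s) = 0"
      using AEk by (simp add: AE_count_space)
  qed
  then show ?thesis unfolding noise_def .
qed

lemma det_eq_0_iff_kernel:
  fixes A :: "real^'d::finite^'d"
  shows "det A = 0 \<longleftrightarrow> (\<exists>x. x \<noteq> 0 \<and> A *v x = 0)"
  using invertible_det_nz[of A] invertible_left_inverse[of A] matrix_left_invertible_ker[of A] by blast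

text \<open>Every matrix on the segment from the identity to \<open>A\<close> has a positive
  quadratic form, so the determinant has no zero on it and keeps the sign it has at the
  identity.\<close>

lemma det_pos_of_positive_definite:
  fixes A :: "real^'d::finite^'d"
  assumes pd: "\<And>x. x \<noteq> 0 \<Longrightarrow> 0 < x \<bullet> (A *v x)"
  shows "0 < det A"
proof (rule ccontr)
  assume neg: "\<not> 0 < det A"
  define B where "B t = (\<chi> i j. (1 - t) * mat 1 $ i $ j + t * A $ i $ j)" for t :: real
  have cont: "continuous_on {0..1} (\<lambda>t. det (B t))"
    by (rule continuous_on_det) (auto simp: B_def intro!: continuous_intros)
  have B0: "B 0 = mat 1" and B1: "B 1 = A" by (auto simp: B_def vec_eq_iff)
  have "\<exists>t\<ge>0. t \<le> 1 \<and> det (B t) = 0"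
    by (rule IVT2'[of "\<lambda>t. det (B t)", OF _ _ _ cont]) (use neg in \<open>auto simp: B0 B1\<close>)
  then obtain t where t: "0 \<le> t" "t \<le> 1" "det (B t) = 0" by blast
  then obtain x where x: "x \<noteq> 0" "B t *v x = 0"
    using det_eq_0_iff_kernel by blast
  have "B t *v x = (1 - t) *\<^sub>R x + t *\<^sub>R (A *v x)"
  proof -
    have "B t *v x = (\<chi> i. \<Sum>j\<in>UNIV. (1 - t) * (mat 1 $ i $ j * x $ j) + t * (A $ i $ j * x $ j))"
      by (simp add: B_def matrix_vector_mult_def algebra_simps)
    also have "\<dots> = (1 - t) *\<^sub>R (mat 1 *v x) + t *\<^sub>R (A *v x)"
      by (simp add: vec_eq_iff matrix_vector_mult_def sum.distrib sum_distrib_left)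
    finally show ?thesis by simp
  qed
  then have "0 = (1 - t) * (x \<bullet> x) + t * (x \<bullet> (A *v x))"
    using arg_cong[OF x(2), of "\<lambda>v. x \<bullet> v"] by (simp add: inner_add_right)
  moreover have "0 < x \<bullet> x" "0 < x \<bullet> (A *v x)" using x(1) pd by auto
  ultimately show False using t
    by (cases "t = 0") (auto intro: add_nonneg_pos simp: add_nonneg_eq_0_iff)
qed

context
  fixes u :: "'d::finite \<Rightarrow> 'n::finite \<times> real \<Rightarrow> real"
  assumes um: "\<And>i. u i \<in> borel_measurable noise" and u2: "\<And>i. integrable noise (\<lambda>z. (u i z)\<^sup>2)"
begin

lemma integrable_u_mult: "integrable noise (\<lambda>z. u i z * u j z)"
proof (rule Bochner_Integration.integrable_bound)
  note [measurable] = um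
  show "integrable noise (\<lambda>z. (u i z)\<^sup>2 + (u j z)\<^sup>2)" using u2 by simp
  show "(\<lambda>z. u i z * u j z) \<in> borel_measurable noise" by measurable
  show "AE z in noise. norm (u i z * u j z) \<le> norm ((u i z)\<^sup>2 + (u j z)\<^sup>2)"
  proof (rule AE_I2)
    fix z
    have "2 * (\<bar>u i z\<bar> * \<bar>u j z\<bar>) \<le> \<bar>u i z\<bar>\<^sup>2 + \<bar>u j z\<bar>\<^sup>2"
      using sum_squares_bound[of "\<bar>u i z\<bar>" "\<bar>u j z\<bar>"] by simp
    moreover have "0 \<le> \<bar>u i z\<bar> * \<bar>u j z\<bar>" by simp
    ultimately have "\<bar>u i z\<bar> * \<bar>u j z\<bar> \<le> \<bar>u i z\<bar>\<^sup>2 + \<bar>u j z\<bar>\<^sup>2" by linarith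
    then show "norm (u i z * u j z) \<le> norm ((u i z)\<^sup>2 + (u j z)\<^sup>2)" by (simp add: abs_mult)
  qed
qed

lemma integrable_u_sum: "integrable noise (\<lambda>z. u i z * (\<Sum>j\<in>UNIV. c $ j * u j z))"
proof -
  have "integrable noise (\<lambda>z. \<Sum>j\<in>UNIV. c $ j * (u i z * u j z))"
    by (intro Bochner_Integration.integrable_sum integrable_mult_right integrable_u_mult)
  then show ?thesis by (simp add: sum_distrib_left mult_ac)
qed

lemma gram_mult:
  assumes \<sigma>: "\<sigma> = (\<chi> i j. \<integral>z. u i z * u j z \<partial>noise)"
  shows "(\<sigma> *v c) $ i = (\<integral>z. u i z * (\<Sum>j\<in>UNIV. c $ j * u j z) \<partial>noise)"
proof -
  have "(\<sigma> *v c) $ i = (\<Sum>j\<in>UNIV. \<integral>z. c $ j * (u i z * u j z) \<partial>noise)"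
    using integrable_u_mult by (simp add: \<sigma> matrix_vector_mult_def mult.commute)
  also have "\<dots> = (\<integral>z. (\<Sum>j\<in>UNIV. c $ j * (u i z * u j z)) \<partial>noise)"
    by (intro Bochner_Integration.integral_sum[symmetric] integrable_mult_right integrable_u_mult)
  finally show ?thesis by (simp add: sum_distrib_left mult_ac)
qed

lemma integrable_u_sq: "integrable noise (\<lambda>z. (\<Sum>j\<in>UNIV. c $ j * u j z)\<^sup>2)"
proof -
  have "integrable noise (\<lambda>z. \<Sum>i\<in>UNIV. c $ i * (u i z * (\<Sum>j\<in>UNIV. c $ j * u j z)))"
    by (intro Bochner_Integration.integrable_sum integrable_mult_right integrable_u_sum)
  then show ?thesis by (simp add: power2_eq_square sum_distrib_right mult.assoc)
qed

lemma gram_quadratic: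
  assumes \<sigma>: "\<sigma> = (\<chi> i j. \<integral>z. u i z * u j z \<partial>noise)"
  shows "c \<bullet> (\<sigma> *v c) = (\<integral>z. (\<Sum>j\<in>UNIV. c $ j * u j z)\<^sup>2 \<partial>noise)"
proof -
  have "c \<bullet> (\<sigma> *v c) = (\<Sum>i\<in>UNIV. \<integral>z. c $ i * (u i z * (\<Sum>j\<in>UNIV. c $ j * u j z)) \<partial>noise)"
    using integrable_u_sum by (simp add: inner_vec_def gram_mult[OF \<sigma>])
  also have "\<dots> = (\<integral>z. (\<Sum>i\<in>UNIV. c $ i * (u i z * (\<Sum>j\<in>UNIV. c $ j * u j z))) \<partial>noise)"
    by (intro Bochner_Integration.integral_sum[symmetric] integrable_mult_right integrable_u_sum)
  finally show ?thesis by (simp add: power2_eq_square sum_distrib_right mult.assoc)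
qed

lemma pairing_u_sum:
  assumes "snd I \<in> {0..1}"
  shows "pairing (\<lambda>z. \<Sum>j\<in>UNIV. c $ j * u j z) I = (\<Sum>j\<in>UNIV. c $ j * pairing (u j) I)"
proof -
  have "integrable noise (\<lambda>z. u j z * indicator (cell I) z)" for j
    by (rule integrable_pairing[OF um u2 assms])
  then show ?thesis
    unfolding pairing_def sum_distrib_right mult.assoc by (subst Bochner_Integration.integral_sum) auto
qed

text \<open>The Gram determinant is positive exactly when the \<open>u i\<close> are linearly
  independent in the Hilbert space. Rational step directions separate its elements, so independence
  is visible in the vectors of pairings: these span the whole space, and a basis chosen among them
  gives \<open>J\<close>.\<close>

lemma gram_det_pos_iff:
  assumes \<sigma>: "\<sigma> = (\<chi> i j. \<integral>z. u i z * u j z \<partial>noise)"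
  shows "0 < det \<sigma> \<longleftrightarrow> (\<exists>J. range J \<subseteq> UNIV \<times> (\<rat> \<inter> {0..1}) \<and> det (\<chi> i j. pairing (u i) (J j)) \<noteq> 0)"
proof
  note [measurable] = um
  assume pos: "0 < det \<sigma>"
  define R where "R = (UNIV :: 'n set) \<times> (\<rat> \<inter> {0..1::real})"
  define v where "v I = (\<chi> i. pairing (u i) I)" for I
  \<comment> \<open>A vector \<open>c\<close> orthogonal to all pairing vectors makes the
    combination of the \<open>u j\<close> with coefficients \<open>c\<close> vanish almost
    everywhere, and hence lies in the kernel of \<sigma>.\<close>
  have span: "span (v ` R) = UNIV"
  proof (rule ccontr)
    assume "span (v ` R) \<noteq> UNIV"
    then obtain c where c: "c \<noteq> 0" "\<And>x. x \<in> span (v ` R) \<Longrightarrow> c \<bullet> x = 0"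
      using span_not_univ_subset_hyperplane by blast
    have "c \<bullet> v I = 0" if "I \<in> R" for I using c(2) that by (simp add: span_base)
    then have p0: "pairing (\<lambda>z. \<Sum>j\<in>UNIV. c $ j * u j z) (k, b) = 0" if "b \<in> \<rat>" "0 \<le> b" "b \<le> 1" for k b
      using that by (subst pairing_u_sum) (auto simp: R_def v_def inner_vec_def)
    have i1: "integrable noise (\<lambda>z. \<Sum>j\<in>UNIV. c $ j * u j z)"
    proof -
      have "integrable noise (u j)" for j
      proof -
        have "integrable noise (\<lambda>z. u j z * indicator (space noise) z)"
          by (rule integrable_mult_indicator_L2[OF finite_measure_noise um sets.top u2])
        then show ?thesis by (rule Bochner_Integration.integrable_cong[THEN iffD1, rotated 2]) auto
      qed
      then show ?thesis by (intro Bochner_Integration.integrable_sum integrable_mult_right)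
    qed
    have "AE z in noise. (\<Sum>j\<in>UNIV. c $ j * u j z) = 0"
      by (rule AE_noise_zero[OF i1 p0])
    then have "(\<integral>z. u i z * (\<Sum>j\<in>UNIV. c $ j * u j z) \<partial>noise) = (\<integral>z. 0 \<partial>(noise :: ('n \<times> real) measure))" for i
      by (intro integral_cong_AE) auto
    then have "\<sigma> *v c = 0" by (simp add: vec_eq_iff gram_mult[OF \<sigma>])
    then have "det \<sigma> = 0" using c(1) det_eq_0_iff_kernel by blast
    then show False using pos by simp
  qed
  obtain B where B: "B \<subseteq> v ` R" "independent B" "v ` R \<subseteq> span B" "card B = dim (v ` R)"
    using basis_exists by blast
  have "dim (v ` R) = dim (span (v ` R))" by (simp add: dim_span)
  then have "dim (v ` R) = CARD('d)" by (simp add: span)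
  then have cB: "card B = CARD('d)" using B by simp
  have fB: "finite B" using B(2) independent_imp_finite by blast
  \<comment> \<open>The basis has \<open>CARD('d)\<close> elements and can be indexed by
    \<open>'d\<close>; its vectors become the columns of the matrix of pairings.\<close>
  then obtain b where b: "bij_betw b (UNIV :: 'd set) B"
    using finite_same_card_bij[of "UNIV :: 'd set" B] cB by auto
  have "\<forall>j. \<exists>I\<in>R. b j = v I" using b B(1) by (auto simp: bij_betw_def)
  then obtain J where J: "\<And>j. J j \<in> R" "\<And>j. b j = v (J j)" by metis
  define A where "A = (\<chi> i j. pairing (u i) (J j))"
  have col: "column j A = b j" for j by (simp add: A_def column_def J v_def vec_eq_iff)
  have "det A \<noteq> 0"
  proof
    assume "det A = 0"
    then obtain x where x: "x \<noteq> 0" "A *v x = 0"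
      using det_eq_0_iff_kernel by blast
    have "(\<Sum>j\<in>UNIV. x $ j *\<^sub>R b j) = 0"
      using x(2) by (simp add: matrix_vector_mult_def vec_eq_iff col[symmetric] column_def mult.commute)
    moreover have inv: "inv_into UNIV b (b j) = j" for j
      using b by (intro inv_f_f) (simp add: bij_betw_def)
    moreover have "(\<Sum>j\<in>UNIV. x $ inv_into UNIV b (b j) *\<^sub>R b j) = (\<Sum>w\<in>B. x $ inv_into UNIV b w *\<^sub>R w)"
      by (rule sum.reindex_bij_betw[OF b])
    ultimately have sum0: "(\<Sum>w\<in>B. x $ inv_into UNIV b w *\<^sub>R w) = 0" by simp
    have "x $ j = 0" for j
    proof -
      have "b j \<in> B" using b by (auto simp: bij_betw_def)
      from independentD[OF B(2) fB subset_refl sum0 this] show ?thesis by (simp add: inv)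
    qed
    then show False using x(1) by (simp add: vec_eq_iff)
  qed
  then show "\<exists>J. range J \<subseteq> UNIV \<times> (\<rat> \<inter> {0..1}) \<and> det (\<chi> i j. pairing (u i) (J j)) \<noteq> 0"
    using J(1) unfolding A_def R_def by blast
next
  note [measurable] = um
  assume "\<exists>J. range J \<subseteq> UNIV \<times> (\<rat> \<inter> {0..1}) \<and> det (\<chi> i j. pairing (u i) (J j)) \<noteq> 0"
  then obtain J where J: "range J \<subseteq> UNIV \<times> (\<rat> \<inter> {0..1})" and det: "det (\<chi> i j. pairing (u i) (J j)) \<noteq> 0" by blast
  define A where "A = (\<chi> i j. pairing (u i) (J j))"
  show "0 < det \<sigma>"
  proof (rule det_pos_of_positive_definite)
    fix c :: "real^'d" assume c: "c \<noteq> 0"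
    have "0 \<le> c \<bullet> (\<sigma> *v c)" unfolding gram_quadratic[OF \<sigma>] by simp
    \<comment> \<open>If the quadratic form vanishes at \<open>c\<close>, so does the combination of
      the \<open>u j\<close>, and with it the pairing in each direction \<open>J j\<close>; then
      \<open>c\<close> is in the kernel of the transposed matrix of pairings.\<close>
    moreover have "c \<bullet> (\<sigma> *v c) \<noteq> 0"
    proof
      assume "c \<bullet> (\<sigma> *v c) = 0"
      then have "AE z in noise. (\<Sum>j\<in>UNIV. c $ j * u j z)\<^sup>2 = 0"
        unfolding gram_quadratic[OF \<sigma>] using integrable_u_sq by (subst (asm) integral_nonneg_eq_0_iff_AE) auto
      then have AE: "AE z in noise. (\<Sum>j\<in>UNIV. c $ j * u j z) = 0" by simp
      have "(\<Sum>i\<in>UNIV. c $ i * pairing (u i) (J j)) = 0" for j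
      proof -
        have "J j \<in> UNIV \<times> (\<rat> \<inter> {0..1})" using J by blast
        then have sJ: "snd (J j) \<in> {0..1}" by auto
        note [measurable] = sets_cell[OF sJ]
        have "pairing (\<lambda>z. \<Sum>j\<in>UNIV. c $ j * u j z) (J j) = (\<integral>z. 0 \<partial>(noise :: ('n \<times> real) measure))"
          unfolding pairing_def using AE by (intro integral_cong_AE) auto
        then show ?thesis by (simp add: pairing_u_sum[OF sJ])
      qed
      then have "transpose A *v c = 0"
        by (simp add: A_def matrix_vector_mult_def transpose_def vec_eq_iff mult.commute)
      then have "det (transpose A) = 0" using c det_eq_0_iff_kernel by blast
      then show False using det by (simp add: det_transpose A_def)
    qed
    ultimately show "0 < c \<bullet> (\<sigma> *v c)" by simp
  qed
qed

end

text \<open>Rewrites the sum of Lebesgue integrals in the definition as one integral over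
  \<open>noise\<close>, the form to which the Gram matrix lemmas apply.\<close>

lemma malliavin_covariance_gram:
  fixes DF :: "'d::finite \<Rightarrow> 'a \<Rightarrow> 'n::finite \<times> real \<Rightarrow> real"
  assumes "\<And>i. DF i \<omega> \<in> borel_measurable noise" "\<And>i. integrable noise (\<lambda>z. (DF i \<omega> z)\<^sup>2)"
  shows "malliavin_covariance DF \<omega> = (\<chi> i j. \<integral>z. DF i \<omega> z * DF j \<omega> z \<partial>noise)"
  unfolding malliavin_covariance_def
  by (simp add: vec_eq_iff integral_noise[OF integrable_u_mult[of "\<lambda>i. DF i \<omega>", OF assms]])

section \<open>The law of a Malliavin differentiable functional\<close>

lemma has_derivative_vec:
  fixes f :: "'a::real_normed_vector \<Rightarrow> real^'d::finite"
  assumes "\<And>i. ((\<lambda>x. f x $ i) has_derivative (\<lambda>v. f' v $ i)) (at a within S)"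
  shows "(f has_derivative f') (at a within S)"
proof (subst has_derivative_componentwise_within, intro ballI)
  fix b :: "real^'d" assume "b \<in> Basis"
  then obtain i where "b = axis i 1" by (auto simp: Basis_vec_def)
  then show "((\<lambda>x. f x \<bullet> b) has_derivative (\<lambda>x. f' x \<bullet> b)) (at a within S)"
    using assms[of i] by (simp add: inner_axis)
qed

lemma borel_measurable_vec:
  fixes f :: "'a \<Rightarrow> real^'d::finite"
  assumes "\<And>i. (\<lambda>x. f x $ i) \<in> borel_measurable M"
  shows "f \<in> borel_measurable M"
proof (subst borel_measurable_euclidean_space, intro ballI)
  fix b :: "real^'d" assume "b \<in> Basis"
  then obtain i where "b = axis i 1" by (auto simp: Basis_vec_def)
  then show "(\<lambda>x. f x \<bullet> b) \<in> borel_measurable M"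
    using assms[of i] by (simp add: inner_axis)
qed

definition clamp01 :: "real \<Rightarrow> real" where
  "clamp01 t = min 1 (max 0 t)"

lemma clamp01_bounds: "0 \<le> clamp01 t" "clamp01 t \<le> 1"
  by (auto simp: clamp01_def)

lemma clamp01_pos_iff: "0 < clamp01 t \<longleftrightarrow> 0 < t"
  by (auto simp: clamp01_def)

lemma continuous_on_clamp01: "continuous_on S f \<Longrightarrow> continuous_on S (\<lambda>x. clamp01 (f x))"
  unfolding clamp01_def by (intro continuous_intros)

text \<open>
  A continuous substitute for a partition of \<open>\<Union>\<^sub>n {u\<^sub>n > 0}\<close>: unlike the differences of the sets, the
  weights stay continuous along the fibres.
\<close>

definition total_weight :: "(nat \<Rightarrow> 'a \<Rightarrow> real) \<Rightarrow> 'a \<Rightarrow> real" where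
  "total_weight u x = (\<Sum>n. (1/2) ^ n * u n x)"

definition rel_weight :: "(nat \<Rightarrow> 'a \<Rightarrow> real) \<Rightarrow> nat \<Rightarrow> 'a \<Rightarrow> real" where
  "rel_weight u n x = (1/2) ^ n * u n x / total_weight u x"

lemma weights:
  assumes u: "\<And>n. 0 \<le> u n x" "\<And>n. u n x \<le> 1"
  shows "summable (\<lambda>n. (1/2) ^ n * u n x)" "0 \<le> total_weight u x"
    "0 < total_weight u x \<longleftrightarrow> (\<exists>n. 0 < u n x)" "0 \<le> rel_weight u n x"
    "(\<Sum>n. ennreal (rel_weight u n x)) = (if \<exists>n. 0 < u n x then 1 else 0)"
proof -
  show s: "summable (\<lambda>n. (1/2) ^ n * u n x)"
  proof (rule summable_comparison_test')
    show "summable (\<lambda>n. (1/2::real) ^ n)" by (rule summable_geometric) simp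
    show "norm ((1/2) ^ n * u n x) \<le> (1/2) ^ n" if "n \<ge> 0" for n
      using u[of n] by (simp add: mult_left_le)
  qed
  show t: "0 \<le> total_weight u x" unfolding total_weight_def by (rule suminf_nonneg[OF s]) (simp add: u)
  show p: "0 < total_weight u x \<longleftrightarrow> (\<exists>n. 0 < u n x)"
    unfolding total_weight_def using suminf_pos_iff[OF s] u by (simp add: zero_less_mult_iff)
  show r: "0 \<le> rel_weight u n x" for n
    unfolding rel_weight_def using t u by (intro divide_nonneg_nonneg mult_nonneg_nonneg) auto
  show "(\<Sum>n. ennreal (rel_weight u n x)) = (if \<exists>n. 0 < u n x then 1 else 0)"
  proof (cases "\<exists>n. 0 < u n x")
    case True
    then have pos: "total_weight u x > 0" using p by blast
    have "(\<lambda>n. rel_weight u n x) sums (total_weight u x / total_weight u x)"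
      unfolding rel_weight_def by (intro sums_divide) (simp add: total_weight_def summable_sums[OF s])
    then have "(\<lambda>n. ennreal (rel_weight u n x)) sums ennreal 1"
      using pos r by (subst sums_ennreal) auto
    then show ?thesis using True by (simp add: sums_iff)
  next
    case False
    then have "u n x = 0" for n using u(1)[of n] by (meson antisym_conv2 not_less)
    then show ?thesis using False by (simp add: rel_weight_def)
  qed
qed

lemma rel_weight_measurable:
  assumes [measurable]: "\<And>n. u n \<in> borel_measurable N"
  shows "rel_weight u n \<in> borel_measurable N"
  unfolding rel_weight_def total_weight_def by measurable

lemma continuous_on_total_weight:
  assumes c: "\<And>n. continuous_on S (u n)" and u: "\<And>n x. 0 \<le> u n x" "\<And>n x. u n x \<le> 1"
  shows "continuous_on S (total_weight u)"
proof -
  have "uniform_limit S (\<lambda>n x. \<Sum>i<n. (1/2) ^ i * u i x) (\<lambda>x. \<Sum>i. (1/2) ^ i * u i x) sequentially"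
  proof (rule Weierstrass_m_test)
    show "summable (\<lambda>n. (1/2::real) ^ n)" by (rule summable_geometric) simp
    show "norm ((1/2) ^ n * u n x) \<le> (1/2) ^ n" for n x
      using u[of n x] by (simp add: mult_left_le)
  qed
  then have "uniform_limit S (\<lambda>n x. \<Sum>i<n. (1/2) ^ i * u i x) (total_weight u) sequentially"
    by (simp add: total_weight_def[abs_def])
  then show ?thesis
    by (rule uniform_limit_theorem[rotated]) (auto intro!: always_eventually continuous_intros c)
qed

text \<open>A function with non-zero integral is positive somewhere, and lower semi-continuity lets
  a strict lower bound at a point persist on a neighbourhood.\<close>

lemma lower_semicontinuous_positive:
  fixes f :: "'a::euclidean_space \<Rightarrow> ennreal"
  assumes lsc: "lower_semicontinuous f" and ne: "(\<integral>\<^sup>+x. f x \<partial>lborel) \<noteq> 0"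
  shows "\<exists>D \<delta>. open D \<and> D \<noteq> {} \<and> 0 < \<delta> \<and> (\<forall>x\<in>D. ennreal \<delta> \<le> f x)"
proof -
  have "\<exists>x. f x \<noteq> 0"
  proof (rule ccontr)
    assume "\<nexists>x. f x \<noteq> 0"
    then have "f = (\<lambda>_. 0)" by auto
    then show False using ne by simp
  qed
  then obtain x where "0 < f x" by (auto simp: zero_less_iff_neq_zero)
  then obtain e where e: "0 < e" "e < f x" using dense by blast
  then obtain \<delta> where \<delta>: "e = ennreal \<delta>" "0 \<le> \<delta>" by (cases e) auto
  have "\<forall>\<^sub>F z in at x. e < f z" using lsc e(2) unfolding lower_semicontinuous_iff by blast
  then obtain S where S: "open S" "x \<in> S" "\<And>z. z \<in> S \<Longrightarrow> z \<noteq> x \<Longrightarrow> e < f z"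
    by (auto simp: eventually_at_topological)
  have "ennreal \<delta> \<le> f z" if "z \<in> S" for z
    using S(3)[OF that] e(2) \<delta>(1) by (cases "z = x") (auto intro: less_imp_le)
  moreover have "0 < \<delta>" using e(1) \<delta> by simp
  ultimately show ?thesis using S(1,2) by blast
qed

context brownian
begin

text \<open>
  Along the fibres of \<open>J\<close> the functional is \<open>C\<^sup>1\<close>, and the weight is supported where its
  derivative is invertible.
\<close>

lemma fibre_pushforward_density:
  fixes J :: "'d::finite \<Rightarrow> 'n \<times> real" and c :: real and \<alpha> :: "'d \<Rightarrow> 'n \<times> real \<Rightarrow> ('n \<times> real \<Rightarrow> real) \<Rightarrow> real"
  assumes der: "\<And>i y. y \<in> ball 0 1 \<Longrightarrow> ((\<lambda>y. \<phi> i (shifted_path W J y \<omega>)) has_derivative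
         (\<lambda>v. \<Sum>j\<in>UNIV. v $ j * \<alpha> i (J j) (shifted_path W J y \<omega>))) (at y)"
    and cont: "\<And>n. continuous_on (ball 0 1) (\<lambda>y. u n (shifted_path W J y \<omega>))"
    and cont1: "\<And>i j. continuous_on (ball 0 1) (\<lambda>y. \<alpha> i (J j) (shifted_path W J y \<omega>))"
    and u: "\<And>n \<pi>. 0 \<le> u n \<pi>" "\<And>n \<pi>. u n \<pi> \<le> 1"
    and un: "\<And>\<pi>. u n \<pi> = clamp01 (real (Suc m) * \<bar>det (\<chi> i j. \<alpha> i (J j) \<pi>)\<bar> - 1)"
    and un': "\<And>\<pi>. u n' \<pi> = clamp01 (real (Suc (Suc m)) * \<bar>det (\<chi> i j. \<alpha> i (J j) \<pi>)\<bar> - 1)"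
    and c: "0 \<le> c"
  shows "\<exists>f. pushforward_density
     (\<lambda>y. c * max 0 (1/2 - norm y) * shift_weight W J y \<omega> * rel_weight u n (shifted_path W J y \<omega>))
     (\<lambda>y. \<chi> i. \<phi> i (shifted_path W J y \<omega>)) f"
proof -
  let ?B = "ball 0 1 :: (real^'d) set"
  define A where "A y = (\<chi> i j. \<alpha> i (J j) (shifted_path W J y \<omega>))" for y
  define \<Delta> where "\<Delta> y = \<bar>det (A y)\<bar>" for y
  define V where "V = (\<lambda>y. c * max 0 (1/2 - norm y) * shift_weight W J y \<omega> * rel_weight u n (shifted_path W J y \<omega>))"
  define F' where "F' y = Blinfun ((*v) (A y))" for y
  have F': "blinfun_apply (F' y) = (*v) (A y)" for y
    unfolding F'_def by (rule bounded_linear_Blinfun_apply) (rule matrix_vector_mul_bounded_linear)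
  have cont\<Delta>: "continuous_on ?B \<Delta>"
    unfolding \<Delta>_def by (intro continuous_on_rabs continuous_on_det) (simp add: A_def cont1)
  \<comment> \<open>The tent confines the weight to the ball of radius 1/2, inside the unit ball
    where the fibre is differentiable; the threshold \<open>1 / Suc m\<close> keeps the determinant
    away from zero.\<close>
  define K where "K = {y \<in> cball 0 (1/2). 1 \<le> real (Suc m) * \<Delta> y}"
  have K: "compact K" "K \<subseteq> ?B"
  proof -
    have "closed (cball 0 (1/2) \<inter> (\<lambda>y. real (Suc m) * \<Delta> y) -` {1..})"
      by (intro continuous_closed_preimage continuous_on_mult continuous_on_const continuous_on_subset[OF cont\<Delta>]) auto
    moreover have "cball 0 (1/2) \<inter> (\<lambda>y. real (Suc m) * \<Delta> y) -` {1..} = K" by (auto simp: K_def)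
    ultimately have "closed K" by simp
    moreover have "bounded K" by (rule bounded_subset[of "cball 0 (1/2)"]) (auto simp: K_def)
    ultimately show "compact K" by (simp add: compact_eq_bounded_closed)
    show "K \<subseteq> ?B" by (auto simp: K_def)
  qed
  have V0: "V y = 0" if "y \<notin> K" for y
  proof (cases "norm y \<le> 1/2")
    case True
    then have "real (Suc m) * \<Delta> y < 1" using that by (simp add: K_def)
    then have "u n (shifted_path W J y \<omega>) = 0" unfolding un by (simp add: clamp01_def \<Delta>_def A_def)
    then show ?thesis by (simp add: V_def rel_weight_def)
  qed (simp add: V_def)
  have Vpos: "0 \<le> V y" for y
  proof -
    have "0 \<le> rel_weight u n (shifted_path W J y \<omega>)" by (rule weights(4)) (simp_all add: u)
    then show ?thesis unfolding V_def using c shift_weight_pos[of J y \<omega>] by (intro mult_nonneg_nonneg) auto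
  qed
  define T where "T y = total_weight (\<lambda>n y. u n (shifted_path W J y \<omega>)) y" for y
  have T: "total_weight u (shifted_path W J y \<omega>) = T y" for y by (simp add: T_def total_weight_def)
  have contT: "continuous_on ?B T"
    unfolding T_def by (rule continuous_on_total_weight) (simp_all add: cont u)
  define U where "U = {y \<in> ?B. 0 < T y}"
  have openU: "open U"
  proof -
    have "open (?B \<inter> T -` {0<..})" by (rule continuous_open_preimage[OF contT]) auto
    moreover have "?B \<inter> T -` {0<..} = U" by (auto simp: U_def)
    ultimately show ?thesis by simp
  qed
  \<comment> \<open>Where the determinant equals the threshold, \<open>u n\<close> is zero, but the
    lower threshold of \<open>u n'\<close> makes that weight positive on all of \<open>K\<close>. So
    the denominator is positive on the open set \<open>U\<close> around \<open>K\<close>, and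
    continuity on \<open>U\<close> and on the complement of \<open>K\<close> gives continuity
    everywhere.\<close>
  have KU: "K \<subseteq> U"
  proof
    fix y assume y: "y \<in> K"
    then have le: "1 \<le> real (Suc m) * \<Delta> y" by (simp add: K_def)
    then have "0 < \<Delta> y" by (metis mult_zero_right not_one_le_zero \<Delta>_def zero_less_abs_iff abs_zero)
    then have "0 < u n' (shifted_path W J y \<omega>)"
      unfolding un' clamp01_pos_iff using le by (simp add: \<Delta>_def A_def algebra_simps)
    then have "0 < total_weight u (shifted_path W J y \<omega>)"
      using weights(3)[of u "shifted_path W J y \<omega>"] u by blast
    then show "y \<in> U" using K y by (auto simp: U_def T)
  qed
  have contV: "continuous_on UNIV V"
  proof -
    have "continuous_on U V"
      unfolding V_def rel_weight_def T
    proof (intro continuous_on_mult continuous_on_divide continuous_on_const)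
      show "continuous_on U (\<lambda>y. max 0 (1/2 - norm y))" by (intro continuous_intros)
      show "continuous_on U (\<lambda>y. shift_weight W J y \<omega>)"
        by (rule continuous_on_subset[OF continuous_on_shift_weight]) simp
      show "continuous_on U (\<lambda>y. u n (shifted_path W J y \<omega>))"
        by (rule continuous_on_subset[OF cont]) (auto simp: U_def)
      show "continuous_on U T" by (rule continuous_on_subset[OF contT]) (auto simp: U_def)
    qed (auto simp: U_def)
    moreover have "continuous_on (- K) V"
      by (rule continuous_on_cong[THEN iffD2, OF refl _ continuous_on_const[of _ 0]]) (simp add: V0)
    moreover have "open (- K)" using K(1) compact_imp_closed by blast
    ultimately have "continuous_on (U \<union> - K) V" using openU by (intro continuous_on_open_Un)
    moreover have "U \<union> - K = UNIV" using KU by auto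
    ultimately show ?thesis by simp
  qed
  have "\<exists>f. pushforward_density V (\<lambda>y. \<chi> i. \<phi> i (shifted_path W J y \<omega>)) f"
  proof (rule pushforward_density_exists[OF _ _ _ contV Vpos K V0])
    show "open ?B" by simp
    show "((\<lambda>y. \<chi> i. \<phi> i (shifted_path W J y \<omega>)) has_derivative blinfun_apply (F' y)) (at y)" if "y \<in> ?B" for y
      unfolding F' using der[OF that] by (intro has_derivative_vec) (simp add: A_def matrix_vector_mult_def mult.commute)
    show "continuous_on ?B F'"
    proof (rule continuous_on_blinfun_componentwise)
      fix b :: "real^'d"
      show "continuous_on ?B (\<lambda>y. blinfun_apply (F' y) b)"
        unfolding F' A_def matrix_vector_mult_def by (simp, intro continuous_intros cont1)
    qed
    show "inj (blinfun_apply (F' y))" if "y \<in> K" for y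
    proof -
      have "1 \<le> real (Suc m) * \<Delta> y" using that by (simp add: K_def)
      then have "det (A y) \<noteq> 0" by (auto simp: \<Delta>_def)
      then show ?thesis unfolding F'
        by (simp add: inj_matrix_vector_mult invertible_det_nz)
    qed
  qed
  then show ?thesis unfolding V_def .
qed

end

lemma borel_measurable_det:
  fixes A :: "'a \<Rightarrow> real^'d::finite^'d"
  assumes [measurable]: "\<And>i j. (\<lambda>x. A x $ i $ j) \<in> borel_measurable M"
  shows "(\<lambda>x. det (A x)) \<in> borel_measurable M"
  unfolding det_def by measurable

lemma malliavin_derivs_facts:
  assumes "has_malliavin_derivs_2 M W p F DF D2F"
  shows "F \<in> borel_measurable M" "case_prod DF \<in> borel_measurable (M \<Otimes>\<^sub>M noise)"
    "AE \<omega> in M. integrable noise (\<lambda>z. (DF \<omega> z)\<^sup>2)"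
proof -
  show "F \<in> borel_measurable M"
    using assms unfolding has_malliavin_derivs_2_def by (elim conjE)
  obtain DG where "Lp_L2_tendsto M noise p DG DF"
    using assms unfolding has_malliavin_derivs_2_def by (elim conjE exE)
  then show "case_prod DF \<in> borel_measurable (M \<Otimes>\<^sub>M noise)" "AE \<omega> in M. integrable noise (\<lambda>z. (DF \<omega> z)\<^sup>2)"
    unfolding Lp_L2_tendsto_def by blast+
qed

text \<open>Positivity and finiteness of the mass allow the tent to be normalised to a probability
  density.\<close>

lemma nn_integral_tent:
  obtains r where "0 < r" "(\<integral>\<^sup>+y. ennreal (max 0 (1/2 - norm (y :: real^'d::finite))) \<partial>lborel) = ennreal r"
proof -
  define T where "T = (\<integral>\<^sup>+y. ennreal (max 0 (1/2 - norm (y :: real^'d))) \<partial>lborel)"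
  have m: "emeasure lborel (ball (0 :: real^'d) r) = ennreal (measure lborel (ball (0 :: real^'d) r))" for r
    using emeasure_bounded_finite[of "ball (0 :: real^'d) r"] by (simp add: emeasure_eq_ennreal_measure)
  have "T \<le> (\<integral>\<^sup>+y. indicator (ball (0 :: real^'d) 1) y \<partial>lborel)"
    unfolding T_def
  proof (rule nn_integral_mono)
    fix y :: "real^'d"
    show "ennreal (max 0 (1/2 - norm y)) \<le> indicator (ball 0 1) y"
    proof (cases "norm y < 1")
      case True
      have "max 0 (1/2 - norm y) \<le> 1" using norm_ge_zero[of y] by linarith
      then have "ennreal (max 0 (1/2 - norm y)) \<le> ennreal 1" by (rule ennreal_leI)
      then show ?thesis using True by simp
    qed (simp add: ennreal_neg)
  qed
  also have "\<dots> < \<top>" using m[of 1] by simp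
  finally have "T < \<top>" .
  then obtain r where r: "T = ennreal r" "0 \<le> r" by (cases T) auto
  have "(\<integral>\<^sup>+y. ennreal (1/4) * indicator (ball (0 :: real^'d) (1/4)) y \<partial>lborel) \<le> T"
    unfolding T_def
  proof (rule nn_integral_mono)
    fix y :: "real^'d"
    show "ennreal (1/4) * indicator (ball 0 (1/4)) y \<le> ennreal (max 0 (1/2 - norm y))"
      by (cases "norm y < 1/4") (auto intro!: ennreal_leI simp: indicator_def)
  qed
  moreover have "0 < measure lborel (ball (0 :: real^'d) (1/4))" by (rule content_ball_pos) simp
  then have "0 < (\<integral>\<^sup>+y. ennreal (1/4) * indicator (ball (0 :: real^'d) (1/4)) y \<partial>lborel)"
    by (simp add: nn_integral_cmult_indicator m ennreal_zero_less_mult_iff)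
  ultimately have "0 < T" by (rule less_le_trans[rotated])
  then have "0 < r" using r by simp
  with r show ?thesis unfolding T_def by (intro that) auto
qed

theorem theorem2p11:
  fixes M :: "'a measure"
    and W :: "'n::finite \<Rightarrow> real \<Rightarrow> 'a \<Rightarrow> real"
    and p :: real
    and F :: "'a \<Rightarrow> real ^ 'd::finite"
    and DF :: "'d \<Rightarrow> 'a \<Rightarrow> 'n \<times> real \<Rightarrow> real"
    and D2F :: "'d \<Rightarrow> 'a \<Rightarrow> ('n \<times> real) \<times> ('n \<times> real) \<Rightarrow> real"
  defines "B \<equiv> {\<omega> \<in> space M. 0 < det (malliavin_covariance DF \<omega>)}"
  assumes "brownian_motion M W"
    and "p > real CARD('d)"
    and "\<And>i. has_malliavin_derivs_2 M W p (\<lambda>\<omega>. F \<omega> $ i) (DF i) (D2F i)"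
    and "measure M B > 0"
  shows "(absolutely_continuous lborel (distr (uniform_measure M B) borel F) \<and>
          (\<exists>f. f \<in> borel_measurable borel \<and> lower_semicontinuous f \<and>
               distr (uniform_measure M B) borel F = density lborel f)) \<and>
         (\<exists>D \<delta>. open D \<and> D \<noteq> {} \<and> \<delta> > (0::real) \<and>
            (\<forall>A\<in>sets borel.
               emeasure M {\<omega> \<in> space M. F \<omega> \<in> A} \<ge> ennreal \<delta> * emeasure lborel (A \<inter> D)))"
proof -
  interpret brownian M W
    by standard (rule \<open>brownian_motion M W\<close>)
  note malliavin = \<open>\<And>i. has_malliavin_derivs_2 M W p (\<lambda>\<omega>. F \<omega> $ i) (DF i) (D2F i)\<close>

  \<comment> \<open>Versions of the functional and its derivatives on path space\<close>
  define R where "R = (UNIV :: 'n set) \<times> (\<rat> \<inter> {0..1::real})"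
  have cR: "countable R"
    unfolding R_def by (rule countable_SIGMA) (auto intro: countable_finite countable_subset[OF _ countable_rat])
  have R: "snd I \<in> {0..1}" if "I \<in> R" for I using that by (auto simp: R_def)
  define lift where "lift i \<Psi>0 \<Psi>1 \<longleftrightarrow> \<Psi>0 \<in> borel_measurable path_measure \<and> (\<forall>I. \<Psi>1 I \<in> borel_measurable path_measure) \<and>
    (\<forall>J :: 'd \<Rightarrow> _. range J \<subseteq> R \<longrightarrow>
      (AE \<omega> in M. \<Psi>0 (shifted_path W J 0 \<omega>) = F \<omega> $ i \<and> (\<forall>I\<in>R. \<Psi>1 I (shifted_path W J 0 \<omega>) = pairing (DF i \<omega>) I)) \<and>
      (AE \<omega> in M.
        (\<forall>y\<in>ball 0 1. ((\<lambda>y. \<Psi>0 (shifted_path W J y \<omega>)) has_derivative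
           (\<lambda>v. \<Sum>j\<in>UNIV. v $ j * \<Psi>1 (J j) (shifted_path W J y \<omega>))) (at y)) \<and>
        (\<forall>I\<in>R. continuous_on (ball 0 1) (\<lambda>y. \<Psi>1 I (shifted_path W J y \<omega>)))))" for i \<Psi>0 \<Psi>1
  have "\<exists>\<Psi>0 \<Psi>1. lift i \<Psi>0 \<Psi>1" for i
    unfolding lift_def by (rule malliavin_path[OF \<open>p > real CARD('d)\<close> malliavin cR R])
  then obtain \<Psi>0 \<Psi>1 where lift: "\<And>i. lift i (\<Psi>0 i) (\<Psi>1 i)" by metis
  have \<Psi>0m: "\<Psi>0 i \<in> borel_measurable path_measure" and \<Psi>1m: "\<Psi>1 i I \<in> borel_measurable path_measure" for i I
    using lift[of i] unfolding lift_def by blast+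
  have base: "AE \<omega> in M. \<forall>i. \<Psi>0 i (shifted_path W J 0 \<omega>) = F \<omega> $ i \<and> (\<forall>I\<in>R. \<Psi>1 i I (shifted_path W J 0 \<omega>) = pairing (DF i \<omega>) I)"
    if "range J \<subseteq> R" for J :: "'d \<Rightarrow> 'n \<times> real"
    unfolding AE_all_countable
  proof
    show "AE \<omega> in M. \<Psi>0 i (shifted_path W J 0 \<omega>) = F \<omega> $ i \<and> (\<forall>I\<in>R. \<Psi>1 i I (shifted_path W J 0 \<omega>) = pairing (DF i \<omega>) I)" for i
      using lift[of i] that unfolding lift_def by blast
  qed
  have fibre: "AE \<omega> in M. \<forall>i. (\<forall>y\<in>ball 0 1. ((\<lambda>y. \<Psi>0 i (shifted_path W J y \<omega>)) has_derivative
           (\<lambda>v. \<Sum>j\<in>UNIV. v $ j * \<Psi>1 i (J j) (shifted_path W J y \<omega>))) (at y)) \<and>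
        (\<forall>I\<in>R. continuous_on (ball 0 1) (\<lambda>y. \<Psi>1 i I (shifted_path W J y \<omega>)))"
    if "range J \<subseteq> R" for J :: "'d \<Rightarrow> 'n \<times> real"
    unfolding AE_all_countable
  proof
    show "AE \<omega> in M. (\<forall>y\<in>ball 0 1. ((\<lambda>y. \<Psi>0 i (shifted_path W J y \<omega>)) has_derivative
           (\<lambda>v. \<Sum>j\<in>UNIV. v $ j * \<Psi>1 i (J j) (shifted_path W J y \<omega>))) (at y)) \<and>
        (\<forall>I\<in>R. continuous_on (ball 0 1) (\<lambda>y. \<Psi>1 i I (shifted_path W J y \<omega>)))" for i
      using lift[of i] that unfolding lift_def by blast
  qed

  \<comment> \<open>Continuous weights exhausting the non-degenerate event\<close>
  define JJ where "JJ = {J :: 'd \<Rightarrow> 'n \<times> real. range J \<subseteq> R}"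
  \<comment> \<open>An index consists of \<open>d\<close> directions and a threshold: each weight
    has to be supported where the determinant stays away from zero, and letting the threshold vary
    exhausts the set where it is non-zero.\<close>
  define KK where "KK = JJ \<times> (UNIV :: nat set)"
  \<comment> \<open>A witness that \<open>JJ\<close> is inhabited; by \<open>shifted_path_0\<close>
    it also represents the unshifted path for all other directions.\<close>
  define J0 where "J0 = (\<lambda>_ :: 'd. (undefined :: 'n, 0 :: real))"
  have J0: "J0 \<in> JJ" by (auto simp: JJ_def J0_def R_def)
  have "JJ = PiE UNIV (\<lambda>_. R)" by (auto simp: JJ_def PiE_def)
  then have "countable JJ" using cR by (simp add: countable_PiE)
  then have KK: "countable KK" "KK \<noteq> {}" using J0 by (auto simp: KK_def)
  define e where "e = from_nat_into KK"
  have e: "e n \<in> KK" for n unfolding e_def by (rule from_nat_into[OF KK(2)])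
  have e_surj: "\<exists>n. e n = x" if "x \<in> KK" for x
    unfolding e_def using from_nat_into_surj[OF KK(1) that] .
  have eR: "range (fst (e n)) \<subseteq> R" for n using e[of n] by (auto simp: KK_def JJ_def)
  have eR': "fst (e n) j \<in> R" for n j using eR by blast
  have eI: "snd (fst (e n) j) \<in> {0..1}" for n j using R[OF eR'] .
  \<comment> \<open>Positive exactly where the absolute value of the determinant exceeds
    \<open>1 / Suc m\<close>, with \<open>m = snd (e n)\<close>.\<close>
  define u where "u n \<pi> = clamp01 (real (Suc (snd (e n))) * \<bar>det (\<chi> i j. \<Psi>1 i (fst (e n) j) \<pi>)\<bar> - 1)" for n \<pi>
  have u01: "0 \<le> u n \<pi>" "u n \<pi> \<le> 1" for n \<pi> by (simp_all add: u_def clamp01_bounds)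
  have um: "u n \<in> borel_measurable path_measure" for n
  proof -
    have [measurable]: "(\<lambda>\<pi>. det (\<chi> i j. \<Psi>1 i (fst (e n) j) \<pi>)) \<in> borel_measurable path_measure"
      by (rule borel_measurable_det) (simp add: \<Psi>1m)
    show ?thesis unfolding u_def[abs_def] clamp01_def by measurable
  qed
  note rm[measurable] = rel_weight_measurable[where u = u, OF um]
  define S0 where "S0 = shifted_path W J0 0"
  have S0: "shifted_path W J 0 = S0" for J :: "'d \<Rightarrow> 'n \<times> real" unfolding S0_def by (rule shifted_path_0)
  have S0m[measurable]: "S0 \<in> measurable M path_measure" unfolding S0_def by (rule shifted_path_measurable')
  have base0: "AE \<omega> in M. \<forall>i. \<Psi>0 i (S0 \<omega>) = F \<omega> $ i \<and> (\<forall>I\<in>R. \<Psi>1 i I (S0 \<omega>) = pairing (DF i \<omega>) I)"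
    using base[of J0] J0 by (simp add: S0 JJ_def)
  have Fm[measurable]: "F \<in> borel_measurable M"
    by (rule borel_measurable_vec) (rule malliavin_derivs_facts(1)[OF malliavin])
  \<comment> \<open>At the unshifted path the determinants are formed from the pairings with
    \<open>DF\<close>, so by \<open>gram_det_pos_iff\<close> some \<open>u n\<close> is positive
    exactly on \<open>B\<close>, up to a null set.\<close>
  have total: "AE \<omega> in M. (\<Sum>n. ennreal (rel_weight u n (S0 \<omega>))) = indicator B \<omega>"
  proof -
    have "AE \<omega> in M. \<forall>i. integrable noise (\<lambda>z. (DF i \<omega> z)\<^sup>2)"
      unfolding AE_all_countable using malliavin_derivs_facts(3)[OF malliavin] by blast
    with base0 AE_space show ?thesis
    proof eventually_elim
      case (elim \<omega>)
      have m: "DF i \<omega> \<in> borel_measurable noise" for i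
        using measurable_compose[OF measurable_Pair1'[OF elim(2)] malliavin_derivs_facts(2)[OF malliavin]] by simp
      have l2: "integrable noise (\<lambda>z. (DF i \<omega> z)\<^sup>2)" for i using elim(3) by blast
      have "\<omega> \<in> B \<longleftrightarrow> 0 < det (malliavin_covariance DF \<omega>)" using elim(2) by (simp add: B_def)
      also have "\<dots> \<longleftrightarrow> (\<exists>J. range J \<subseteq> R \<and> det (\<chi> i j. pairing (DF i \<omega>) (J j)) \<noteq> 0)"
        unfolding R_def
        by (rule gram_det_pos_iff[where u = "\<lambda>i. DF i \<omega>", OF m l2 malliavin_covariance_gram[where DF = DF and \<omega> = \<omega>, OF m l2]])
      also have "\<dots> \<longleftrightarrow> (\<exists>J\<in>JJ. det (\<chi> i j. \<Psi>1 i (J j) (S0 \<omega>)) \<noteq> 0)"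
      proof -
        have "det (\<chi> i j. \<Psi>1 i (J j) (S0 \<omega>)) = det (\<chi> i j. pairing (DF i \<omega>) (J j))" if "range J \<subseteq> R" for J :: "'d \<Rightarrow> _"
        proof -
          have "\<Psi>1 i (J j) (S0 \<omega>) = pairing (DF i \<omega>) (J j)" for i j using elim(1) that by blast
          then show ?thesis by simp
        qed
        then show ?thesis unfolding JJ_def by auto
      qed
      also have "\<dots> \<longleftrightarrow> (\<exists>n. 0 < u n (S0 \<omega>))"
      proof
        assume "\<exists>J\<in>JJ. det (\<chi> i j. \<Psi>1 i (J j) (S0 \<omega>)) \<noteq> 0"
        then obtain J where J: "J \<in> JJ" "det (\<chi> i j. \<Psi>1 i (J j) (S0 \<omega>)) \<noteq> 0" by blast
        then obtain m where m: "1 < real m * \<bar>det (\<chi> i j. \<Psi>1 i (J j) (S0 \<omega>))\<bar>"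
          using reals_Archimedean3[of "\<bar>det (\<chi> i j. \<Psi>1 i (J j) (S0 \<omega>))\<bar>"] by auto
        obtain n where n: "e n = (J, m)" using e_surj[of "(J, m)"] J(1) by (auto simp: KK_def)
        have "real m * \<bar>det (\<chi> i j. \<Psi>1 i (J j) (S0 \<omega>))\<bar> \<le> real (Suc m) * \<bar>det (\<chi> i j. \<Psi>1 i (J j) (S0 \<omega>))\<bar>"
          by (intro mult_right_mono) auto
        with m have "0 < u n (S0 \<omega>)" unfolding u_def clamp01_pos_iff n by simp
        then show "\<exists>n. 0 < u n (S0 \<omega>)" ..
      next
        assume "\<exists>n. 0 < u n (S0 \<omega>)"
        then obtain n where "0 < u n (S0 \<omega>)" ..
        then have "det (\<chi> i j. \<Psi>1 i (fst (e n) j) (S0 \<omega>)) \<noteq> 0" unfolding u_def clamp01_pos_iff by auto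
        moreover have "fst (e n) \<in> JJ" using eR by (simp add: JJ_def)
        ultimately show "\<exists>J\<in>JJ. det (\<chi> i j. \<Psi>1 i (J j) (S0 \<omega>)) \<noteq> 0" by blast
      qed
      finally show ?case using weights(5)[of u "S0 \<omega>"] u01 by (simp add: indicator_def)
    qed
  qed

  \<comment> \<open>Lower semi-continuous densities of the weighted laws\<close>
  define b where "b = measure M B"
  have b: "0 < b" using \<open>measure M B > 0\<close> by (simp add: b_def)
  \<comment> \<open>\<open>measure\<close> is 0 on non-measurable sets, so a positive value forces
    \<open>B\<close> to be measurable.\<close>
  have Bm[measurable]: "B \<in> sets M"
    using b measure_notin_sets unfolding b_def by fastforce
  obtain r where r: "0 < r" "(\<integral>\<^sup>+y. ennreal (max 0 (1/2 - norm (y :: real^'d))) \<partial>lborel) = ennreal r"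
    by (rule nn_integral_tent)
  \<comment> \<open>Division by \<open>r\<close> normalises the tent to total mass 1, and division
    by \<open>b\<close> accounts for the conditioning on \<open>B\<close>.\<close>
  define \<kappa> where "\<kappa> = 1 / (r * b)"
  have \<kappa>: "0 \<le> \<kappa>" using r b by (simp add: \<kappa>_def)
  define V where "V n \<omega> y = \<kappa> * max 0 (1/2 - norm y) * shift_weight W (fst (e n)) y \<omega> * rel_weight u n (shifted_path W (fst (e n)) y \<omega>)"
    for n \<omega> and y :: "real^'d"
  define H where "H n \<omega> y = (\<chi> i. \<Psi>0 i (shifted_path W (fst (e n)) y \<omega>))" for n \<omega> and y :: "real^'d"
  have Vm: "case_prod (V n) \<in> borel_measurable (M \<Otimes>\<^sub>M borel)" for n
    unfolding V_def split_beta'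
    using shift_weight_measurable[of "fst (e n)", OF eI] measurable_compose[OF shifted_path_measurable[of "fst (e n)"] rm[of n]]
    by (intro borel_measurable_times) (simp_all add: split_beta')
  have Hm: "case_prod (H n) \<in> borel_measurable (M \<Otimes>\<^sub>M borel)" for n
    unfolding H_def split_beta'
  proof (rule borel_measurable_vec)
    show "(\<lambda>x. (\<chi> i. \<Psi>0 i (shifted_path W (fst (e n)) (snd x) (fst x))) $ i) \<in> borel_measurable (M \<Otimes>\<^sub>M borel)" for i
      using measurable_compose[OF shifted_path_measurable[of "fst (e n)"] \<Psi>0m[of i]] by (simp add: split_beta')
  qed
  have dens: "AE \<omega> in M. \<exists>f. pushforward_density (V n \<omega>) (H n \<omega>) f" for n
  proof -
    \<comment> \<open>Same directions with the next threshold: the companion weight that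
      \<open>fibre_pushforward_density\<close> asks for.\<close>
    obtain n' where n': "e n' = (fst (e n), Suc (snd (e n)))"
      using e_surj[of "(fst (e n), Suc (snd (e n)))"] e[of n] by (auto simp: KK_def)
    show ?thesis
      using fibre[OF eR[of n]]
    proof eventually_elim
      case (elim \<omega>)
      show ?case unfolding V_def[abs_def] H_def[abs_def]
      proof (rule fibre_pushforward_density[where m = "snd (e n)" and n' = n' and \<alpha> = \<Psi>1])
        show "((\<lambda>y. \<Psi>0 i (shifted_path W (fst (e n)) y \<omega>)) has_derivative
           (\<lambda>v. \<Sum>j\<in>UNIV. v $ j * \<Psi>1 i (fst (e n) j) (shifted_path W (fst (e n)) y \<omega>))) (at y)" if "y \<in> ball 0 1" for i y
          using elim that by blast
        have c1: "continuous_on (ball 0 1) (\<lambda>y. \<Psi>1 i (fst (e k) j) (shifted_path W (fst (e n)) y \<omega>))" for i j k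
          using elim eR'[of k j] by blast
        then show "continuous_on (ball 0 1) (\<lambda>y. \<Psi>1 i (fst (e n) j) (shifted_path W (fst (e n)) y \<omega>))" for i j .
        show "continuous_on (ball 0 1) (\<lambda>y. u k (shifted_path W (fst (e n)) y \<omega>))" for k
          unfolding u_def
          by (intro continuous_on_clamp01 continuous_on_diff continuous_on_mult continuous_on_const continuous_on_rabs continuous_on_det)
             (simp add: c1)
        show "u n' \<pi> = clamp01 (real (Suc (Suc (snd (e n)))) * \<bar>det (\<chi> i j. \<Psi>1 i (fst (e n) j) \<pi>)\<bar> - 1)" for \<pi>
          unfolding u_def n' by simp
        show "u n \<pi> = clamp01 (real (Suc (snd (e n))) * \<bar>det (\<chi> i j. \<Psi>1 i (fst (e n) j) \<pi>)\<bar> - 1)" for \<pi>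
          by (rule u_def)
      qed (rule u01 \<kappa>)+
    qed
  qed
  define G where "G n g \<longleftrightarrow> g \<in> borel_measurable borel \<and> lower_semicontinuous g \<and> (\<forall>A\<in>sets borel.
     (\<integral>\<^sup>+\<omega>. (\<integral>\<^sup>+y. ennreal (V n \<omega> y) * indicator A (H n \<omega> y) \<partial>lborel) \<partial>M) = (\<integral>\<^sup>+x. g x * indicator A x \<partial>lborel))" for n g
  have "\<exists>g. G n g" for n
    unfolding G_def by (rule mixture_lower_semicontinuous_density[OF sigma_finite_measure_axioms Vm Hm dens])
  then have "\<exists>g. \<forall>n. G n (g n)" by (intro choice allI)
  then obtain g where g: "\<And>n. G n (g n)" by blast
  have gm[measurable]: "g n \<in> borel_measurable borel" and glsc: "lower_semicontinuous (g n)" for n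
    using g[of n] unfolding G_def by blast+
  have gA: "(\<integral>\<^sup>+\<omega>. (\<integral>\<^sup>+y. ennreal (V n \<omega> y) * indicator A (H n \<omega> y) \<partial>lborel) \<partial>M) = (\<integral>\<^sup>+x. g n x * indicator A x \<partial>lborel)"
    if "A \<in> sets borel" for n A
    using g[of n] that unfolding G_def by blast
  interpret P: pair_sigma_finite M "lborel :: (real^'d) measure" ..
  \<comment> \<open>For fixed \<open>y\<close> Girsanov brings the weighted expectation back to the
    unshifted path. What then remains of the integral over \<open>y\<close> is the mass
    \<open>1 / b\<close> of the rescaled tent.\<close>
  have gint: "(\<integral>\<^sup>+x. g n x * indicator A x \<partial>lborel) = ennreal (1 / b) * (\<integral>\<^sup>+\<omega>. ennreal (rel_weight u n (S0 \<omega>)) * indicator A (F \<omega>) \<partial>M)"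
    if A[measurable]: "A \<in> sets borel" for n A
  proof -
    define \<Phi> where "\<Phi> \<pi> = ennreal (rel_weight u n \<pi>) * indicator A (\<chi> i. \<Psi>0 i \<pi>)" for \<pi>
    have [measurable]: "(\<lambda>\<pi>. \<chi> i. \<Psi>0 i \<pi>) \<in> borel_measurable path_measure"
      by (rule borel_measurable_vec) (simp add: \<Psi>0m)
    have \<Phi>m: "\<Phi> \<in> borel_measurable path_measure" unfolding \<Phi>_def by measurable
    define \<rho> where "\<rho> y = \<kappa> * max 0 (1/2 - norm y)" for y :: "real^'d"
    have \<rho>: "0 \<le> \<rho> y" for y using \<kappa> by (simp add: \<rho>_def)
    have [measurable]: "\<rho> \<in> borel_measurable borel" unfolding \<rho>_def by measurable
    have eq: "ennreal (V n \<omega> y) * indicator A (H n \<omega> y) = ennreal (\<rho> y) * (ennreal (shift_weight W (fst (e n)) y \<omega>) * \<Phi> (shifted_path W (fst (e n)) y \<omega>))" for \<omega> y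
    proof -
      have "V n \<omega> y = \<rho> y * (shift_weight W (fst (e n)) y \<omega> * rel_weight u n (shifted_path W (fst (e n)) y \<omega>))"
        by (simp add: V_def \<rho>_def mult.assoc)
      then show ?thesis
        using \<rho>[of y] shift_weight_pos[of "fst (e n)" y \<omega>]
        by (simp add: \<Phi>_def H_def ennreal_mult' less_imp_le mult.assoc)
    qed
    have meas: "(\<lambda>(\<omega>, y). ennreal (V n \<omega> y) * indicator A (H n \<omega> y)) \<in> borel_measurable (M \<Otimes>\<^sub>M lborel)"
      using Vm[of n] Hm[of n] unfolding split_beta' by measurable
    have "(\<integral>\<^sup>+x. g n x * indicator A x \<partial>lborel) = (\<integral>\<^sup>+y. (\<integral>\<^sup>+\<omega>. ennreal (V n \<omega> y) * indicator A (H n \<omega> y) \<partial>M) \<partial>lborel)"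
      unfolding gA[OF A, symmetric] by (rule P.Fubini'[OF meas, symmetric])
    also have "\<dots> = (\<integral>\<^sup>+y. ennreal (\<rho> y) * (\<integral>\<^sup>+\<omega>. \<Phi> (S0 \<omega>) \<partial>M) \<partial>lborel)"
    proof (intro nn_integral_cong)
      fix y :: "real^'d"
      have [measurable]: "shift_weight W (fst (e n)) y \<in> borel_measurable M" by (rule shift_weight_measurable'[OF eI])
      have [measurable]: "(\<lambda>\<omega>. \<Phi> (shifted_path W (fst (e n)) y \<omega>)) \<in> borel_measurable M"
        by (rule measurable_compose[OF shifted_path_measurable' \<Phi>m])
      have "(\<integral>\<^sup>+\<omega>. ennreal (V n \<omega> y) * indicator A (H n \<omega> y) \<partial>M) =
         ennreal (\<rho> y) * (\<integral>\<^sup>+\<omega>. ennreal (shift_weight W (fst (e n)) y \<omega>) * \<Phi> (shifted_path W (fst (e n)) y \<omega>) \<partial>M)"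
        unfolding eq by (rule nn_integral_cmult) measurable
      also have "(\<integral>\<^sup>+\<omega>. ennreal (shift_weight W (fst (e n)) y \<omega>) * \<Phi> (shifted_path W (fst (e n)) y \<omega>) \<partial>M) = (\<integral>\<^sup>+\<omega>. \<Phi> (S0 \<omega>) \<partial>M)"
        using nn_integral_shifted_path[where J = "fst (e n)" and y = y, OF eI \<Phi>m] by (simp add: S0)
      finally show "(\<integral>\<^sup>+\<omega>. ennreal (V n \<omega> y) * indicator A (H n \<omega> y) \<partial>M) = ennreal (\<rho> y) * (\<integral>\<^sup>+\<omega>. \<Phi> (S0 \<omega>) \<partial>M)" .
    qed
    also have "\<dots> = (\<integral>\<^sup>+y. ennreal (\<rho> y) \<partial>lborel) * (\<integral>\<^sup>+\<omega>. \<Phi> (S0 \<omega>) \<partial>M)"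
      by (rule nn_integral_multc) measurable
    also have "(\<integral>\<^sup>+y. ennreal (\<rho> y) \<partial>lborel) = ennreal (1 / b)"
    proof -
      have "(\<integral>\<^sup>+y. ennreal (\<rho> y) \<partial>lborel) = ennreal \<kappa> * (\<integral>\<^sup>+y. ennreal (max 0 (1/2 - norm (y :: real^'d))) \<partial>lborel)"
        unfolding \<rho>_def ennreal_mult'[OF \<kappa>] by (rule nn_integral_cmult) measurable
      also have "\<dots> = ennreal (1 / b)"
        unfolding r(2) using r(1) b by (simp add: \<kappa>_def ennreal_mult'[symmetric])
      finally show ?thesis .
    qed
    also have "(\<integral>\<^sup>+\<omega>. \<Phi> (S0 \<omega>) \<partial>M) = (\<integral>\<^sup>+\<omega>. ennreal (rel_weight u n (S0 \<omega>)) * indicator A (F \<omega>) \<partial>M)"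
    proof (rule nn_integral_cong_AE)
      show "AE \<omega> in M. \<Phi> (S0 \<omega>) = ennreal (rel_weight u n (S0 \<omega>)) * indicator A (F \<omega>)"
        using base0
      proof eventually_elim
        case (elim \<omega>)
        then have "(\<chi> i. \<Psi>0 i (S0 \<omega>)) = F \<omega>" by (simp add: vec_eq_iff)
        then show ?case by (simp add: \<Phi>_def)
      qed
    qed
    finally show ?thesis .
  qed

  \<comment> \<open>The density of the conditional law\<close>
  define f where "f x = (\<Sum>n. g n x)" for x
  have fm[measurable]: "f \<in> borel_measurable borel" unfolding f_def by measurable
  have flsc: "lower_semicontinuous f" unfolding f_def by (rule lower_semicontinuous_suminf[OF glsc])
  have fint: "(\<integral>\<^sup>+x. f x * indicator A x \<partial>lborel) = ennreal (1 / b) * emeasure M (B \<inter> (F -` A \<inter> space M))"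
    if A[measurable]: "A \<in> sets borel" for A
  proof -
    have "(\<integral>\<^sup>+x. f x * indicator A x \<partial>lborel) = (\<integral>\<^sup>+x. (\<Sum>n. g n x * indicator A x) \<partial>lborel)"
      by (simp add: f_def ennreal_suminf_multc)
    also have "\<dots> = (\<Sum>n. \<integral>\<^sup>+x. g n x * indicator A x \<partial>lborel)"
      by (rule nn_integral_suminf) measurable
    also have "\<dots> = (\<Sum>n. ennreal (1 / b) * (\<integral>\<^sup>+\<omega>. ennreal (rel_weight u n (S0 \<omega>)) * indicator A (F \<omega>) \<partial>M))"
      by (simp only: gint[OF A])
    also have "\<dots> = ennreal (1 / b) * (\<Sum>n. \<integral>\<^sup>+\<omega>. ennreal (rel_weight u n (S0 \<omega>)) * indicator A (F \<omega>) \<partial>M)"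
      by (rule ennreal_suminf_cmult)
    also have "(\<Sum>n. \<integral>\<^sup>+\<omega>. ennreal (rel_weight u n (S0 \<omega>)) * indicator A (F \<omega>) \<partial>M) =
      (\<integral>\<^sup>+\<omega>. (\<Sum>n. ennreal (rel_weight u n (S0 \<omega>)) * indicator A (F \<omega>)) \<partial>M)"
      by (rule nn_integral_suminf[symmetric]) measurable
    also have "\<dots> = (\<integral>\<^sup>+\<omega>. indicator (B \<inter> (F -` A \<inter> space M)) \<omega> \<partial>M)"
    proof (rule nn_integral_cong_AE)
      show "AE \<omega> in M. (\<Sum>n. ennreal (rel_weight u n (S0 \<omega>)) * indicator A (F \<omega>)) = indicator (B \<inter> (F -` A \<inter> space M)) \<omega>"
        using total AE_space
        by eventually_elim (simp add: ennreal_suminf_multc indicator_def)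
    qed
    also have "\<dots> = emeasure M (B \<inter> (F -` A \<inter> space M))"
      by (rule nn_integral_indicator) measurable
    finally show ?thesis .
  qed
  have law: "distr (uniform_measure M B) borel F = density lborel f"
  proof (rule measure_eqI)
    fix A assume "A \<in> sets (distr (uniform_measure M B) borel F)"
    then have A[measurable]: "A \<in> sets borel" by simp
    have "emeasure (distr (uniform_measure M B) borel F) A = emeasure (uniform_measure M B) (F -` A \<inter> space M)"
      by (subst emeasure_distr) auto
    also have "\<dots> = emeasure M (B \<inter> (F -` A \<inter> space M)) / emeasure M B"
      by (rule emeasure_uniform_measure) measurable
    also have "\<dots> = ennreal (1 / b) * emeasure M (B \<inter> (F -` A \<inter> space M))"
      using b by (simp add: emeasure_eq_measure b_def divide_ennreal ennreal_mult'[symmetric])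
    also have "\<dots> = emeasure (density lborel f) A"
      by (simp add: emeasure_density fint[OF A])
    finally show "emeasure (distr (uniform_measure M B) borel F) A = emeasure (density lborel f) A" .
  qed simp
  have ac: "absolutely_continuous lborel (distr (uniform_measure M B) borel F)"
    unfolding law by (rule absolutely_continuousI_density) simp

  \<comment> \<open>The local lower bound\<close>
  have "(\<integral>\<^sup>+x. f x \<partial>lborel) \<noteq> 0"
    using fint[of UNIV] b by (simp add: emeasure_eq_measure ennreal_mult'[symmetric] Int_absorb2 sets.sets_into_space b_def)
  from lower_semicontinuous_positive[OF flsc this]
  obtain D \<delta> where D: "open D" "D \<noteq> {}" "0 < \<delta>" "\<forall>x\<in>D. ennreal \<delta> \<le> f x"
    by blast
  \<comment> \<open>Undoing the conditioning multiplies the bound by \<open>b\<close>, the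
    probability of \<open>B\<close>, and dropping the restriction to \<open>B\<close> can only
    increase the probability of the event.\<close>
  have lower: "ennreal (b * \<delta>) * emeasure lborel (A \<inter> D) \<le> emeasure M {\<omega> \<in> space M. F \<omega> \<in> A}"
    if A[measurable]: "A \<in> sets borel" for A
  proof -
    have [measurable]: "D \<in> sets borel" using D(1) by simp
    have "ennreal \<delta> * emeasure lborel (A \<inter> D) = (\<integral>\<^sup>+x. ennreal \<delta> * indicator (A \<inter> D) x \<partial>lborel)"
      by (simp add: nn_integral_cmult_indicator)
    also have "\<dots> \<le> (\<integral>\<^sup>+x. f x * indicator A x \<partial>lborel)"
      using D(4) by (intro nn_integral_mono) (auto split: split_indicator)
    finally have "ennreal \<delta> * emeasure lborel (A \<inter> D) \<le> ennreal (1 / b) * emeasure M (B \<inter> (F -` A \<inter> space M))"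
      unfolding fint[OF A] .
    then have "ennreal b * (ennreal \<delta> * emeasure lborel (A \<inter> D)) \<le> ennreal b * (ennreal (1 / b) * emeasure M (B \<inter> (F -` A \<inter> space M)))"
      by (rule mult_left_mono) simp
    also have "\<dots> = emeasure M (B \<inter> (F -` A \<inter> space M))"
      using b by (simp add: mult.assoc[symmetric] ennreal_mult'[symmetric])
    also have "\<dots> \<le> emeasure M {\<omega> \<in> space M. F \<omega> \<in> A}"
      by (rule emeasure_mono) auto
    finally show ?thesis using b D(3) by (simp add: ennreal_mult' mult.assoc)
  qed
  have "0 < b * \<delta>" using b D(3) by simp
  then have "\<exists>D \<delta>. open D \<and> D \<noteq> {} \<and> \<delta> > (0::real) \<and>
      (\<forall>A\<in>sets borel. emeasure M {\<omega> \<in> space M. F \<omega> \<in> A} \<ge> ennreal \<delta> * emeasure lborel (A \<inter> D))"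
    using D(1,2) lower by (intro exI[of _ D] exI[of _ "b * \<delta>"] conjI ballI)
  moreover have "\<exists>f. f \<in> borel_measurable borel \<and> lower_semicontinuous f \<and>
      distr (uniform_measure M B) borel F = density lborel f"
    using fm flsc law by (intro exI[of _ f] conjI)
  ultimately show ?thesis using ac by (intro conjI)
qed

end
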